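(* Let $(I_\alpha)_{\alpha\in\Gamma}$ be a finite family of $\{0,1\}$-valued random variables, and suppose that for each $\alpha\in\Gamma$ there are $\{0,1\}$-valued random variables $(J_{\beta\alpha})_{\beta\in\Gamma}$ on the same probability space with $\mathcal L(J_{\beta\alpha},\beta\in\Gamma\mid I_\alpha=1)=\mathcal L(I_\beta,\beta\in\Gamma)$. Let $\Gamma=\Gamma_1\uplus\Gamma_2$, $\Gamma_1=\biguplus_{j=1}^d\Gamma_{1j}$, $\Gamma_2=\biguplus_{j=1}^r\Gamma_{2j}$, $p_\alpha=\mathbb EI_\alpha$, and for positive constants $s_j$ set $W_{1j}=s_j^{-1}\sum_{\alpha\in\Gamma_{1j}}(I_\alpha-p_\alpha)$, $W_{2j}=\sum_{\alpha\in\Gamma_{2j}}I_\alpha$, $W_1=(W_{1j})_{j\le d}$, $W_2=(W_{2j})_{j\le r}$. Let $\Sigma=\mathrm{Cov}(W_1)$, $\lambda_j=\mathbb EW_{2j}$, assume all $\lambda_j>0$, and let $Z\sim\mathcal N_d(0,\Sigma)$, $N\sim\prod_j\mathrm{Po}(\lambda_j)$ be independent. Then for every $h\in\mathcal H_3$, $$\begin{aligned}|\mathbb Eh(W_1,W_2)-\mathbb Eh(Z,N)|\le&\sum_{j,k=1}^d\frac{\|\partial_{jk}f_h\|}{s_js_k}\sqrt{\mathrm{Var}\Big(\mathbb E\Big[\sum_{\alpha\in\Gamma_{1j}}I_\alpha\sum_{\beta\in\Gamma_{1k}}(I_\beta-J_{\beta\alpha})\,\Big|\,W_1,W_2\Big]\Big)}\\&+\frac12\sum_{j,k,\ell=1}^d\frac{\|\partial_{jk\ell}f_h\|}{s_js_ks_\ell}\sum_{\alpha\in\Gamma_{1j}}\mathbb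 E\Big|I_\alpha\sum_{\beta\in\Gamma_{1k}}(I_\beta-J_{\beta\alpha})\sum_{\gamma\in\Gamma_{1\ell}}(I_\gamma-J_{\gamma\alpha})\Big|\\&+\sum_{j=1}^d\sum_{k=1}^r\frac{\|\Delta_k(\partial_jf_h)\|}{s_j}\sum_{\alpha\in\Gamma_{1j}}\mathbb E\Big|I_\alpha\sum_{\beta\in\Gamma_{2k}}(I_\beta-J_{\beta\alpha})\Big|\\&+2\sum_{k=1}^r\sum_{j=1}^d\frac{\|\Delta_k(\partial_jf_h)\|}{s_j}\sum_{\alpha\in\Gamma_{2k}}\mathbb E\Big|I_\alpha\sum_{\beta\in\Gamma_{1j}}(I_\beta-J_{\beta\alpha})\Big|\\&+2\max_{1\le j,k\le r}\|\Delta_{jk}f_h\|\Big(\sum_{\alpha\in\Gamma_2}p_\alpha^2+\sum_{\alpha\in\Gamma_2}\sum_{\beta\in\Gamma_2\setminus\{\alpha\}}\mathbb E[I_\alpha|I_\beta-J_{\beta\alpha}|]\Big).\end{aligned}$$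
   Context: The conditional law given $I_\alpha=1$ is understood as a regular conditional distribution (meaningful even if $p_\alpha=0$). $\mathcal C_3=\{g\in C_b^3(\mathbb R^d):|g|_{\rm Lip}\vee|g|_2\vee|g|_3\le1\}$ ($|g|_k$ = max sup norm of $k$-th order partials), $\mathcal H_3=\{h:\mathbb R^d\times\mathbb Z_+^r\to\mathbb R:\sup|h|\le1,\ h(\cdot,y)\in\mathcal C_3\ \forall y\}$. With $\Sigma,\lambda$ as in the claim: $S_sh(x,y)=\mathbb Eh(\sqrt{1-s}x+\sqrt sZ,y)$, $p_s(y,z)=\prod_j\sum_{k=0}^{y_j\wedge z_j}\binom{y_j}k(1-s)^ks^{y_j-k}(\lambda_js)^{z_j-k}e^{-\lambda_js}/(z_j-k)!$, $T_sh(x,y)=\sum_{z\in\mathbb Z_+^r}S_sh(x,z)p_s(y,z)$, $f_h(x,y)=-\int_0^1\frac{1}{2(1-s)}[T_sh(x,y)-\mathbb Eh(Z,N)]ds$. $\partial_j$ are $x$-derivatives with $y$ fixed, $\Delta_kf(x,y)=f(x,y+e_k)-f(x,y)$, $\Delta_{jk}=\Delta_j\Delta_k$, and $\|\cdot\|$ is the supremum over $\mathbb R^d\times\mathbb Z_+^r$.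
   Formalization: In the kernel p_s(y,z) the factor e^{-λ_j} is corrected to e^{-λ_j s}, so that p_s is the law of a Binomial(y_j,1-s) plus an independent Po(λ_j s) variable in each coordinate; with e^{-λ_j} as printed the bound is false. *)

theory Defs
  imports "HOL-Probability.Probability"
begin

definition xpartial :: "'d::finite \<Rightarrow> (real^'d \<Rightarrow> real) \<Rightarrow> real^'d \<Rightarrow> real" where
  "xpartial j g x = deriv (\<lambda>t. g (x + t *\<^sub>R axis j 1)) 0"

definition xdiffble :: "'d::finite \<Rightarrow> (real^'d \<Rightarrow> real) \<Rightarrow> bool" where
  "xdiffble j g \<longleftrightarrow> (\<forall>x. (\<lambda>t. g (x + t *\<^sub>R axis j 1)) differentiable (at 0))"

definition pdx :: "'d::finite \<Rightarrow> (real^'d \<Rightarrow> 'y \<Rightarrow> real) \<Rightarrow> real^'d \<Rightarrow> 'y \<Rightarrow> real" where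
  "pdx j f x y = xpartial j (\<lambda>x'. f x' y) x"

definition ydiff :: "'r \<Rightarrow> ('x \<Rightarrow> ('r \<Rightarrow> nat) \<Rightarrow> real) \<Rightarrow> 'x \<Rightarrow> ('r \<Rightarrow> nat) \<Rightarrow> real" where
  "ydiff k f x y = f x (y(k := Suc (y k))) - f x y"

definition supnorm :: "('x \<Rightarrow> 'y \<Rightarrow> real) \<Rightarrow> real" where
  "supnorm f = (SUP p\<in>UNIV. \<bar>f (fst p) (snd p)\<bar>)"

definition C3 :: "(real^'d::finite \<Rightarrow> real) \<Rightarrow> bool" where
  "C3 g \<longleftrightarrow> bounded (range g) \<and> continuous_on UNIV g \<and>
     (\<forall>j. xdiffble j g \<and> continuous_on UNIV (xpartial j g)) \<and>
     (\<forall>j k. xdiffble j (xpartial k g) \<and> continuous_on UNIV (xpartial j (xpartial k g))) \<and>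
     (\<forall>j k l. xdiffble j (xpartial k (xpartial l g)) \<and>
              continuous_on UNIV (xpartial j (xpartial k (xpartial l g)))) \<and>
     (\<forall>x y. \<bar>g x - g y\<bar> \<le> dist x y) \<and>
     (\<forall>j k x. \<bar>xpartial j (xpartial k g) x\<bar> \<le> 1) \<and>
     (\<forall>j k l x. \<bar>xpartial j (xpartial k (xpartial l g)) x\<bar> \<le> 1)"

definition H3 :: "(real^'d::finite \<Rightarrow> ('r \<Rightarrow> nat) \<Rightarrow> real) set" where
  "H3 = {h. (\<forall>x y. \<bar>h x y\<bar> \<le> 1) \<and> (\<forall>y. C3 (\<lambda>x. h x y))}"

definition std_gauss :: "(real^'d::finite) measure" where
  "std_gauss = density lborel (\<lambda>x. ennreal (\<Prod>i\<in>UNIV. std_normal_density (x $ i)))"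

definition gauss :: "real^'d^'d \<Rightarrow> (real^'d::finite) measure" where
  "gauss Sig = distr std_gauss borel (\<lambda>x. (SOME A::real^'d^'d. A ** transpose A = Sig) *v x)"

definition poissons :: "('r::finite \<Rightarrow> real) \<Rightarrow> ('r \<Rightarrow> nat) measure" where
  "poissons lam = measure_pmf (Pi_pmf UNIV 0 (\<lambda>j. poisson_pmf (lam j)))"

definition EhZN :: "real^'d^'d \<Rightarrow> ('r::finite \<Rightarrow> real) \<Rightarrow> (real^'d::finite \<Rightarrow> ('r \<Rightarrow> nat) \<Rightarrow> real) \<Rightarrow> real" where
  "EhZN Sig lam h = (\<integral>p. h (fst p) (snd p) \<partial>(gauss Sig \<Otimes>\<^sub>M poissons lam))"

definition pker :: "('r::finite \<Rightarrow> real) \<Rightarrow> real \<Rightarrow> ('r \<Rightarrow> nat) \<Rightarrow> ('r \<Rightarrow> nat) \<Rightarrow> real" where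
  "pker lam s y z = (\<Prod>j\<in>UNIV. \<Sum>k\<le>min (y j) (z j).
      real (y j choose k) * (1 - s) ^ k * s ^ (y j - k) * (lam j * s) ^ (z j - k)
      * exp (- (lam j * s)) / fact (z j - k))"

definition Ssemi :: "real^'d^'d \<Rightarrow> (real^'d::finite \<Rightarrow> 'y \<Rightarrow> real) \<Rightarrow> real \<Rightarrow> real^'d \<Rightarrow> 'y \<Rightarrow> real" where
  "Ssemi Sig h s x y = (\<integral>u. h (sqrt (1 - s) *\<^sub>R x + sqrt s *\<^sub>R u) y \<partial>gauss Sig)"

definition Tsemi :: "real^'d^'d \<Rightarrow> ('r::finite \<Rightarrow> real) \<Rightarrow> (real^'d::finite \<Rightarrow> ('r \<Rightarrow> nat) \<Rightarrow> real)
     \<Rightarrow> real \<Rightarrow> real^'d \<Rightarrow> ('r \<Rightarrow> nat) \<Rightarrow> real" where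
  "Tsemi Sig lam h s x y = (\<Sum>\<^sub>\<infinity>z\<in>UNIV. Ssemi Sig h s x z * pker lam s y z)"

definition fsol :: "real^'d^'d \<Rightarrow> ('r::finite \<Rightarrow> real) \<Rightarrow> (real^'d::finite \<Rightarrow> ('r \<Rightarrow> nat) \<Rightarrow> real)
     \<Rightarrow> real^'d \<Rightarrow> ('r \<Rightarrow> nat) \<Rightarrow> real" where
  "fsol Sig lam h x y = - (LBINT s=0..1. (1 / (2 * (1 - s))) * (Tsemi Sig lam h s x y - EhZN Sig lam h))"

definition cexp_disc :: "'a measure \<Rightarrow> ('a \<Rightarrow> 'b) \<Rightarrow> ('a \<Rightarrow> real) \<Rightarrow> 'a \<Rightarrow> real" where
  "cexp_disc M V X \<omega> = (let A = {\<omega>'\<in>space M. V \<omega>' = V \<omega>} in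
     if measure M A = 0 then 0 else (\<integral>\<omega>'. indicator A \<omega>' * X \<omega>' \<partial>M) / measure M A)"

definition varM :: "'a measure \<Rightarrow> ('a \<Rightarrow> real) \<Rightarrow> real" where
  "varM M X = (\<integral>\<omega>. (X \<omega> - (\<integral>\<omega>'. X \<omega>' \<partial>M))\<^sup>2 \<partial>M)"

end

theory Submission
  imports Defs
begin

text \<open>
  The function f solves the Stein equation of a process whose first component is an
  Ornstein--Uhlenbeck process with stationary law N(0, \<Sigma>) and whose second component is an
  immigration-death process with stationary law Po(\<lambda>) in each coordinate, run at twice the speed so
  that s = 1 - exp(-2t) parametrises both: differentiating \<open>T\<^sub>s h\<close> in s (Gaussian integration by parts for
  x, the recursion q(y+1, z) = (1-s) q(y, z-1) + s q(y, z) of the kernel for y) gives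
  \[ \sum_{jk} \Sigma_{jk} \partial_{jk} f - \sum_j x_j \partial_j f
     + 2 \sum_k (\lambda_k \Delta_k f(x,y) - y_k \Delta_k f(x, y - e_k)) = h(x,y) - E h(Z,N). \]
  Each \<open>\<partial>\<^sub>j\<close> pulls a factor (1-s)^(1/2) out of \<open>T\<^sub>s\<close> and each \<open>\<Delta>\<^sub>k\<close> a factor 1-s, so all the
  derivatives of f in the bound are bounded. Evaluating the equation at W, the coupling turns
  \<open>p\<^sub>\<alpha> E \<phi>(W)\<close> into \<open>E I\<^sub>\<alpha> \<phi>(W\<^sup>\<alpha>)\<close>, with \<open>W\<^sup>\<alpha>\<close> built from J, and a second-order Taylor
  expansion of \<open>\<partial>\<^sub>j f\<close> and first-order differences of \<open>\<Delta>\<^sub>k f\<close> yield the five terms.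
\<close>

section \<open>Calculus: differentiation under the integral and axis-directional derivatives\<close>

text \<open>Under s = 1 - exp(-2t) the weight ds/(2(1-s)) is dt, so f is minus the integral over all
  time of the centred semigroup. The Gaussian part contracts by sqrt(1-s) = exp(-t), but an
  individual survives with probability 1-s = exp(-2t); this mismatch is the origin of the factor 2
  in the last two terms. The square of p_alpha is E[I_alpha J_alpha_alpha]: the death term removes
  alpha from W_2, while the coupled configuration may still contain it. The variance term arises
  because Sigma_jk is exactly 1/(s_j s_k) times the mean of the coupled sum, so the second-order
  part becomes a covariance of that sum with a bounded function of (W_1, W_2), and there the sum may
  be replaced by its conditional expectation. Analytically, every derivative must pass through three
  layers (Gaussian average, lattice sum, time integral), each time by a majorant; the delicate place
  is s = 1, where the bare weight is not integrable. Probabilistically, all variables take finitely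
  many values, so the coupling, the conditional expectations and the square root of Sigma reduce to
  finite sums.\<close>

lemma leibniz_lebesgue:
  fixes \<phi> :: "real \<Rightarrow> 'a \<Rightarrow> real"
  assumes t0: "a < t0" "t0 < b"
    and deriv: "\<And>t \<omega>. a < t \<Longrightarrow> t < b \<Longrightarrow> \<omega> \<in> space M \<Longrightarrow> ((\<lambda>t. \<phi> t \<omega>) has_field_derivative \<phi>' t \<omega>) (at t)"
    and int: "\<And>t. a < t \<Longrightarrow> t < b \<Longrightarrow> integrable M (\<phi> t)"
    and w: "integrable M w"
    and dom: "\<And>t \<omega>. a < t \<Longrightarrow> t < b \<Longrightarrow> \<omega> \<in> space M \<Longrightarrow> \<bar>\<phi>' t \<omega>\<bar> \<le> w \<omega>"
  shows "integrable M (\<phi>' t0)"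
    and "((\<lambda>t. \<integral>\<omega>. \<phi> t \<omega> \<partial>M) has_field_derivative (\<integral>\<omega>. \<phi>' t0 \<omega> \<partial>M)) (at t0)"
proof -
  define S where "S = {a - t0<..<b - t0}"
  have S: "open S" "0 \<in> S" using t0 by (auto simp: S_def)
  have lim: "(\<lambda>i. (\<phi> (t0 + X i) \<omega> - \<phi> t0 \<omega>) / X i) \<longlonglongrightarrow> \<phi>' t0 \<omega>"
    if X: "X \<longlonglongrightarrow> 0" "\<And>i. X i \<noteq> 0" and \<omega>: "\<omega> \<in> space M" for X :: "nat \<Rightarrow> real" and \<omega>
  proof -
    have "((\<lambda>h. (\<phi> (t0 + h) \<omega> - \<phi> t0 \<omega>) / h) \<longlongrightarrow> \<phi>' t0 \<omega>) (at 0)"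
      using deriv[OF t0 \<omega>] by (simp add: DERIV_def)
    moreover have "filterlim X (at 0) sequentially"
      using X by (auto simp: filterlim_at)
    ultimately show ?thesis by (rule filterlim_compose)
  qed
  \<comment> \<open>Measurability of the derivative is not assumed: it is a pointwise limit of
    difference quotients. The steps c/(i+2) are strictly below b - t0, so every quotient uses only
    times in (a, b).\<close>
  have meas: "\<phi>' t0 \<in> borel_measurable M"
  proof (rule borel_measurable_LIMSEQ_real)
    define c where "c = min (b - t0) 1"
    have c: "c > 0" "c \<le> b - t0" using t0 by (auto simp: c_def)
    define X where "X = (\<lambda>i::nat. c / real (i + 2))"
    have X0: "X \<longlonglongrightarrow> 0" unfolding X_def
      by (rule real_tendsto_divide_at_top[OF tendsto_const])
         (intro filterlim_compose[OF filterlim_real_sequentially], rule filterlim_add_const_nat_at_top)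
    have Xp: "X i > 0" "X i < b - t0" for i
    proof -
      show "X i > 0" using c by (simp add: X_def)
      have "0 < c + c * real i" using c by (intro add_pos_nonneg) auto
      hence "X i < c" using c by (simp add: X_def field_simps)
      thus "X i < b - t0" using c by simp
    qed
    show "\<And>\<omega>. \<omega> \<in> space M \<Longrightarrow> (\<lambda>i. (\<phi> (t0 + X i) \<omega> - \<phi> t0 \<omega>) / X i) \<longlonglongrightarrow> \<phi>' t0 \<omega>"
      using X0 Xp(1) by (intro lim) (auto simp: less_imp_neq[symmetric])
    show "(\<lambda>\<omega>. (\<phi> (t0 + X i) \<omega> - \<phi> t0 \<omega>) / X i) \<in> borel_measurable M" for i
    proof -
      have [measurable]: "\<phi> (t0 + X i) \<in> borel_measurable M" "\<phi> t0 \<in> borel_measurable M"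
        using int[of "t0 + X i"] int[OF t0] Xp[of i] t0 by auto
      show ?thesis by measurable
    qed
  qed
  show integ: "integrable M (\<phi>' t0)"
    by (rule Bochner_Integration.integrable_bound[OF w meas]) (use dom[OF t0] in \<open>force intro!: AE_I2\<close>)
  show "((\<lambda>t. \<integral>\<omega>. \<phi> t \<omega> \<partial>M) has_field_derivative (\<integral>\<omega>. \<phi>' t0 \<omega> \<partial>M)) (at t0)"
    unfolding DERIV_def at_within_open[OF S(2,1), symmetric] tendsto_at_iff_sequentially comp_def
  proof (intro allI impI)
    fix X :: "nat \<Rightarrow> real"
    assume XS: "\<forall>i. X i \<in> S - {0}" and X0: "X \<longlonglongrightarrow> 0"
    have r: "a < t0 + X i" "t0 + X i < b" "X i \<noteq> 0" for i
      using XS[rule_format, of i] by (auto simp: S_def)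
    have eq: "((\<integral>\<omega>. \<phi> (t0 + X i) \<omega> \<partial>M) - (\<integral>\<omega>. \<phi> t0 \<omega> \<partial>M)) / X i
        = (\<integral>\<omega>. (\<phi> (t0 + X i) \<omega> - \<phi> t0 \<omega>) / X i \<partial>M)" for i
      using int[OF r(1,2)] int[OF t0] by simp
    show "(\<lambda>i. ((\<integral>\<omega>. \<phi> (t0 + X i) \<omega> \<partial>M) - (\<integral>\<omega>. \<phi> t0 \<omega> \<partial>M)) / X i) \<longlonglongrightarrow> (\<integral>\<omega>. \<phi>' t0 \<omega> \<partial>M)"
      unfolding eq
    proof (rule integral_dominated_convergence[OF meas _ w])
      show "(\<lambda>\<omega>. (\<phi> (t0 + X i) \<omega> - \<phi> t0 \<omega>) / X i) \<in> borel_measurable M" for i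
        using int[OF r(1,2)] int[OF t0] by (intro borel_measurable_divide borel_measurable_diff) auto
      show "AE \<omega> in M. (\<lambda>i. (\<phi> (t0 + X i) \<omega> - \<phi> t0 \<omega>) / X i) \<longlonglongrightarrow> \<phi>' t0 \<omega>"
        using lim[OF X0 r(3)] by (intro AE_I2)
      show "AE \<omega> in M. norm ((\<phi> (t0 + X i) \<omega> - \<phi> t0 \<omega>) / X i) \<le> w \<omega>" for i
      proof (rule AE_I2)
        fix \<omega> assume \<omega>: "\<omega> \<in> space M"
        \<comment> \<open>The mean value inequality turns the bound on the derivative into the
          majorant of the quotients.\<close>
        have "norm (\<phi> (t0 + X i) \<omega> - \<phi> t0 \<omega>) \<le> w \<omega> * norm ((t0 + X i) - t0)"
          by (rule field_differentiable_bound[where S="{a<..<b}" and f'="\<lambda>t. \<phi>' t \<omega>"])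
             (use deriv dom \<omega> r t0 in \<open>auto intro: DERIV_subset\<close>)
        thus "norm ((\<phi> (t0 + X i) \<omega> - \<phi> t0 \<omega>) / X i) \<le> w \<omega>"
          using r(3)[of i] by (simp add: abs_divide field_simps)
      qed
    qed
  qed
qed

lemma continuous_on_integral_dominated:
  fixes \<phi> :: "'b::metric_space \<Rightarrow> 'a \<Rightarrow> real"
  assumes "\<And>\<omega>. \<omega> \<in> space M \<Longrightarrow> continuous_on S (\<lambda>t. \<phi> t \<omega>)"
    and "\<And>t. t \<in> S \<Longrightarrow> \<phi> t \<in> borel_measurable M"
    and "integrable M w"
    and "\<And>t \<omega>. t \<in> S \<Longrightarrow> \<omega> \<in> space M \<Longrightarrow> \<bar>\<phi> t \<omega>\<bar> \<le> w \<omega>"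
  shows "continuous_on S (\<lambda>t. \<integral>\<omega>. \<phi> t \<omega> \<partial>M)"
  unfolding continuous_on_sequentially comp_def
proof (intro allI impI ballI)
  fix X t assume *: "t \<in> S" "(\<forall>n. X n \<in> S) \<and> X \<longlonglongrightarrow> t"
  show "(\<lambda>n. \<integral>\<omega>. \<phi> (X n) \<omega> \<partial>M) \<longlonglongrightarrow> (\<integral>\<omega>. \<phi> t \<omega> \<partial>M)"
  proof (rule integral_dominated_convergence[OF _ _ assms(3)])
    show "AE \<omega> in M. (\<lambda>i. \<phi> (X i) \<omega>) \<longlonglongrightarrow> \<phi> t \<omega>"
      using assms(1) * by (intro AE_I2) (auto simp: continuous_on_sequentially comp_def)
  qed (use * assms in auto)
qed

section \<open>Partial derivatives along the coordinate axes\<close>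

definition C1x :: "(real^'d::finite \<Rightarrow> real) \<Rightarrow> bool" where
  "C1x g \<longleftrightarrow> (\<forall>j. xdiffble j g \<and> continuous_on UNIV (xpartial j g))"

lemma xpartial_DERIV:
  assumes "xdiffble j g"
  shows "((\<lambda>t. g (x + t *\<^sub>R axis j 1)) has_field_derivative xpartial j g (x + t *\<^sub>R axis j 1)) (at t)"
proof -
  have "((\<lambda>u. g ((x + t *\<^sub>R axis j 1) + u *\<^sub>R axis j 1)) has_field_derivative xpartial j g (x + t *\<^sub>R axis j 1)) (at 0)"
    using assms unfolding xdiffble_def xpartial_def
    by (simp add: DERIV_deriv_iff_real_differentiable)
  moreover have "(\<lambda>u. g ((x + t *\<^sub>R axis j 1) + u *\<^sub>R axis j 1)) = (\<lambda>u. g (x + (u + t) *\<^sub>R axis j 1))"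
    by (simp add: algebra_simps)
  ultimately show ?thesis
    using DERIV_shift[of "\<lambda>t. g (x + t *\<^sub>R axis j 1)" _ 0 t] by simp
qed

lemma xpartialI:
  assumes "\<And>x. ((\<lambda>t. g (x + t *\<^sub>R axis j 1)) has_field_derivative g' x) (at 0)"
  shows "xdiffble j g" "xpartial j g = g'"
proof -
  show "xdiffble j g" unfolding xdiffble_def
    using assms real_differentiable_def by blast
  show "xpartial j g = g'" unfolding xpartial_def
    using assms by (intro ext DERIV_imp_deriv)
qed

text \<open>Partials are defined along the axes only, so total differentiability has to be recovered
  from their continuity: go from x to y one coordinate at a time and use the mean value inequality
  on each leg.\<close>

lemma C1x_has_derivative:
  fixes g :: "real^'d::finite \<Rightarrow> real"
  assumes g: "C1x g"
  shows "(g has_derivative (\<lambda>v. \<Sum>j\<in>UNIV. v $ j * xpartial j g x)) (at x)"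
  unfolding has_derivative_at_alt
proof (intro conjI allI impI)
  show "bounded_linear (\<lambda>v::real^'d. \<Sum>j\<in>UNIV. v $ j * xpartial j g x)"
    by (intro bounded_linear_sum bounded_linear_mult_const bounded_linear_vec_nth)
  fix e :: real assume e: "e > 0"
  define N where "N = real CARD('d)"
  have N: "N > 0" by (simp add: N_def)
  have "\<exists>d>0. \<forall>y. dist y x < d \<longrightarrow> \<bar>xpartial j g y - xpartial j g x\<bar> < e / N" for j
    using g e N unfolding C1x_def continuous_on_iff by (force simp: dist_real_def)
  then obtain d where d: "\<And>j. d j > 0" "\<And>j y. dist y x < d j \<Longrightarrow> \<bar>xpartial j g y - xpartial j g x\<bar> < e / N"
    by metis
  define D where "D = Min (range d)"
  have D: "D > 0" "\<And>j. D \<le> d j" using d(1) by (auto simp: D_def)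
  show "\<exists>da>0. \<forall>y. norm (y - x) < da \<longrightarrow>
      norm (g y - g x - (\<Sum>j\<in>UNIV. (y - x) $ j * xpartial j g x)) \<le> e * norm (y - x)"
  \<comment> \<open>Every point of the staircase path is within N times the norm of v of x, hence
    within D. Each leg then costs at most e/N times its length, and there are N legs.\<close>
  proof (intro exI[of _ "D / N"] conjI allI impI)
    show "D / N > 0" using D N by simp
    fix y assume y: "norm (y - x) < D / N"
    define v where "v = y - x"
    have vj: "\<bar>v $ j\<bar> \<le> norm v" for j by (rule component_le_norm_cart)
    define vS where "vS = (\<lambda>S. \<Sum>j\<in>S. v $ j *\<^sub>R (axis j 1 :: real^'d))"
    have vU: "vS UNIV = v"
      using basis_expansion[of v] by (simp add: vS_def scalar_mult_eq_scaleR)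
    have ind: "\<bar>g (x + vS S) - g x - (\<Sum>j\<in>S. v $ j * xpartial j g x)\<bar> \<le> (\<Sum>j\<in>S. e / N * \<bar>v $ j\<bar>)"
      if "finite S" for S using that
    proof (induction S)
      case empty thus ?case by (simp add: vS_def)
    next
      case (insert j S)
      let ?z = "x + vS S"
      let ?u = "\<lambda>t. g (?z + t *\<^sub>R axis j 1) - t * xpartial j g x"
      have "norm (?u (v $ j) - ?u 0) \<le> e / N * norm (v $ j - 0)"
      proof (rule field_differentiable_bound[where S="closed_segment 0 (v $ j)"
              and f'="\<lambda>t. xpartial j g (?z + t *\<^sub>R axis j 1) - xpartial j g x"])
        fix t assume t: "t \<in> closed_segment 0 (v $ j)"
        have tv: "\<bar>t\<bar> \<le> \<bar>v $ j\<bar>" using t by (auto simp: closed_segment_eq_real_ivl split: if_splits)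
        show "(?u has_field_derivative xpartial j g (?z + t *\<^sub>R axis j 1) - xpartial j g x)
            (at t within closed_segment 0 (v $ j))"
          by (rule DERIV_subset[of _ _ _ UNIV])
             (use g in \<open>auto intro!: derivative_eq_intros xpartial_DERIV simp: C1x_def\<close>)
        have "dist (?z + t *\<^sub>R axis j 1) x = norm (vS S + t *\<^sub>R (axis j 1 :: real^'d))"
          by (simp add: dist_norm algebra_simps)
        also have "\<dots> \<le> norm (vS S) + \<bar>t\<bar>" 
          by (rule order_trans[OF norm_triangle_ineq]) (simp add: norm_axis_1)
        also have "\<dots> \<le> (\<Sum>i\<in>S. \<bar>v $ i\<bar>) + \<bar>v $ j\<bar>" unfolding vS_def
          by (intro add_mono tv sum_norm_le) (simp add: norm_axis_1)
        also have "\<dots> = (\<Sum>i\<in>insert j S. \<bar>v $ i\<bar>)" using insert by simp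
        also have "\<dots> \<le> (\<Sum>i\<in>insert j S. norm v)" by (intro sum_mono vj)
        also have "\<dots> \<le> N * norm v"
          unfolding N_def sum_constant by (intro mult_right_mono) (auto intro!: card_mono)
        also have "\<dots> < D" using y N by (simp add: v_def field_simps)
        finally show "norm (xpartial j g (?z + t *\<^sub>R axis j 1) - xpartial j g x) \<le> e / N"
          using d(2)[of "?z + t *\<^sub>R axis j 1" j] D(2)[of j] by simp
      qed auto
      hence "\<bar>g (x + vS (insert j S)) - g ?z - v $ j * xpartial j g x\<bar> \<le> e / N * \<bar>v $ j\<bar>"
        using insert by (simp add: vS_def algebra_simps)
      thus ?case using insert by (simp add: algebra_simps)
    qed
    have "norm (g y - g x - (\<Sum>j\<in>UNIV. (y - x) $ j * xpartial j g x)) \<le> (\<Sum>j\<in>UNIV. e / N * \<bar>v $ j\<bar>)"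
      using ind[of UNIV] by (simp add: vU v_def)
    also have "\<dots> \<le> (\<Sum>j\<in>(UNIV::'d set). e / N * norm v)"
      using e N by (intro sum_mono mult_left_mono vj) auto
    also have "\<dots> = e * norm (y - x)" using N by (simp add: N_def v_def)
    finally show "norm (g y - g x - (\<Sum>j\<in>UNIV. (y - x) $ j * xpartial j g x)) \<le> e * norm (y - x)" .
  qed
qed

text \<open>The mean value theorem is applied twice to the second difference over a square of side
  a, first in direction j and then in direction k.\<close>

lemma xpartial_second_mvt:
  assumes "xdiffble j g" "xdiffble k (xpartial j g)" "a > 0"
  shows "\<exists>\<xi>. dist \<xi> x \<le> 2 * a \<and>
    g (x + a *\<^sub>R axis j 1 + a *\<^sub>R axis k 1) - g (x + a *\<^sub>R axis j 1) - g (x + a *\<^sub>R axis k 1) + g x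
      = a * a * xpartial k (xpartial j g) \<xi>"
proof -
  let ?u = "\<lambda>t. g ((x + a *\<^sub>R axis k 1) + t *\<^sub>R axis j 1) - g (x + t *\<^sub>R axis j 1)"
  have "(?u has_field_derivative xpartial j g ((x + a *\<^sub>R axis k 1) + t *\<^sub>R axis j 1) - xpartial j g (x + t *\<^sub>R axis j 1)) (at t)" for t
    by (intro DERIV_diff xpartial_DERIV assms)
  from MVT2[OF \<open>a > 0\<close> this] obtain \<tau> where \<tau>: "0 < \<tau>" "\<tau> < a"
    "?u a - ?u 0 = a * (xpartial j g ((x + a *\<^sub>R axis k 1) + \<tau> *\<^sub>R axis j 1) - xpartial j g (x + \<tau> *\<^sub>R axis j 1))"
    by auto
  let ?y = "x + \<tau> *\<^sub>R axis j 1"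
  from MVT2[OF \<open>a > 0\<close> xpartial_DERIV[OF assms(2), of ?y]] obtain \<sigma> where \<sigma>: "0 < \<sigma>" "\<sigma> < a"
    "xpartial j g (?y + a *\<^sub>R axis k 1) - xpartial j g ?y = a * xpartial k (xpartial j g) (?y + \<sigma> *\<^sub>R axis k 1)"
    by auto
  have "dist (?y + \<sigma> *\<^sub>R axis k 1) x = norm (\<tau> *\<^sub>R axis j 1 + \<sigma> *\<^sub>R (axis k 1 :: real^'a))"
    by (simp add: dist_norm algebra_simps)
  also have "\<dots> \<le> \<tau> + \<sigma>"
    by (rule order_trans[OF norm_triangle_ineq]) (use \<tau> \<sigma> in \<open>simp add: norm_axis_1\<close>)
  finally have "dist (?y + \<sigma> *\<^sub>R axis k 1) x \<le> 2 * a" using \<tau> \<sigma> by simp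
  moreover have "g (x + a *\<^sub>R axis j 1 + a *\<^sub>R axis k 1) - g (x + a *\<^sub>R axis j 1) - g (x + a *\<^sub>R axis k 1) + g x
      = a * a * xpartial k (xpartial j g) (?y + \<sigma> *\<^sub>R axis k 1)"
    using \<tau>(3) \<sigma>(3) by (simp add: algebra_simps)
  ultimately show ?thesis by blast
qed

text \<open>The second difference over a small square is symmetric in j and k. Both mixed partials
  represent it at points near x, so by continuity they cannot differ at x.\<close>

lemma xpartial_commute:
  fixes g :: "real^'d::finite \<Rightarrow> real"
  assumes "xdiffble j g" "xdiffble k g" "xdiffble k (xpartial j g)" "xdiffble j (xpartial k g)"
    and c1: "continuous_on UNIV (xpartial k (xpartial j g))" and c2: "continuous_on UNIV (xpartial j (xpartial k g))"
  shows "xpartial k (xpartial j g) = xpartial j (xpartial k g)"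
proof
  fix x
  show "xpartial k (xpartial j g) x = xpartial j (xpartial k g) x"
  proof (rule ccontr)
    let ?A = "xpartial k (xpartial j g)" let ?B = "xpartial j (xpartial k g)"
    assume ne: "?A x \<noteq> ?B x"
    define e where "e = \<bar>?A x - ?B x\<bar> / 2"
    have e: "e > 0" using ne by (simp add: e_def)
    obtain d1 where d1: "d1 > 0" "\<And>y. dist y x < d1 \<Longrightarrow> \<bar>?A y - ?A x\<bar> < e"
      using c1 e unfolding continuous_on_iff by (force simp: dist_real_def)
    obtain d2 where d2: "d2 > 0" "\<And>y. dist y x < d2 \<Longrightarrow> \<bar>?B y - ?B x\<bar> < e"
      using c2 e unfolding continuous_on_iff by (force simp: dist_real_def)
    \<comment> \<open>The intermediate points are only known to lie within 2a of x, so 2a must stay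
      below both radii.\<close>
    define a where "a = min d1 d2 / 3"
    have a: "a > 0" "2 * a < d1" "2 * a < d2" using d1 d2 by (auto simp: a_def)
    obtain \<xi> where \<xi>: "dist \<xi> x \<le> 2 * a" "g (x + a *\<^sub>R axis j 1 + a *\<^sub>R axis k 1) - g (x + a *\<^sub>R axis j 1) - g (x + a *\<^sub>R axis k 1) + g x
      = a * a * ?A \<xi>"
      using xpartial_second_mvt[OF assms(1,3) a(1), of x] by blast
    obtain \<zeta> where \<zeta>: "dist \<zeta> x \<le> 2 * a" "g (x + a *\<^sub>R axis k 1 + a *\<^sub>R axis j 1) - g (x + a *\<^sub>R axis k 1) - g (x + a *\<^sub>R axis j 1) + g x
      = a * a * ?B \<zeta>"
      using xpartial_second_mvt[OF assms(2,4) a(1), of x] by blast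
    have "x + a *\<^sub>R axis k 1 + a *\<^sub>R axis j 1 = x + a *\<^sub>R axis j 1 + a *\<^sub>R axis k 1"
      by (simp add: add.assoc add.commute)
    hence "a * a * ?A \<xi> = a * a * ?B \<zeta>"
      using \<xi>(2) \<zeta>(2) by (simp only:)
    hence "?A \<xi> = ?B \<zeta>" using a by simp
    thus False using d1(2)[of \<xi>] d2(2)[of \<zeta>] \<xi>(1) \<zeta>(1) a e_def by (auto simp: abs_if split: if_splits)
  qed
qed

lemma C1x_line_DERIV:
  fixes g :: "real^'d::finite \<Rightarrow> real"
  assumes "C1x g"
  shows "((\<lambda>t. g (x + t *\<^sub>R v)) has_field_derivative (\<Sum>j\<in>UNIV. v $ j * xpartial j g (x + t *\<^sub>R v))) (at t)"
proof -
  have "((\<lambda>t. g (x + t *\<^sub>R v)) has_derivative (\<lambda>u. \<Sum>j\<in>UNIV. (u *\<^sub>R v) $ j * xpartial j g (x + t *\<^sub>R v))) (at t)"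
    by (rule has_derivative_compose[of "\<lambda>t. x + t *\<^sub>R v" "\<lambda>u. u *\<^sub>R v", OF _ C1x_has_derivative[OF assms]])
       (auto intro!: derivative_eq_intros)
  thus ?thesis unfolding has_field_derivative_def
    by (rule has_derivative_eq_rhs) (auto simp: sum_distrib_left sum_distrib_right fun_eq_iff ac_simps intro!: sum.cong)
qed

text \<open>A separate constant per coordinate, instead of a norm estimate, lets each partial
  derivative of f keep its own supremum norm in the final bound.\<close>

lemma C1x_lipschitz:
  fixes g :: "real^'d::finite \<Rightarrow> real"
  assumes g: "C1x g" and b: "\<And>j x. \<bar>xpartial j g x\<bar> \<le> B j"
  shows "\<bar>g y - g x\<bar> \<le> (\<Sum>j\<in>UNIV. B j * \<bar>y $ j - x $ j\<bar>)"
proof -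
  define v where "v = y - x"
  obtain \<tau> where \<tau>: "g (x + 1 *\<^sub>R v) - g (x + 0 *\<^sub>R v) = (1 - 0) * (\<Sum>j\<in>UNIV. v $ j * xpartial j g (x + \<tau> *\<^sub>R v))"
    using MVT2[OF zero_less_one C1x_line_DERIV[OF g, of x v]] by blast
  have "\<bar>g y - g x\<bar> \<le> (\<Sum>j\<in>UNIV. \<bar>v $ j * xpartial j g (x + \<tau> *\<^sub>R v)\<bar>)"
    using \<tau> by (simp add: v_def)
  also have "\<dots> \<le> (\<Sum>j\<in>UNIV. B j * \<bar>y $ j - x $ j\<bar>)"
    by (intro sum_mono, simp only: v_def abs_mult vector_minus_component mult.commute[of "B _"])
       (intro mult_left_mono b abs_ge_zero)
  finally show ?thesis .
qed

text \<open>One-dimensional Taylor expansion along the segment from x to y. As the constants depend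
  on the pair (k, l), the third derivatives of f can later be bounded one by one.\<close>

lemma C2x_taylor:
  fixes g :: "real^'d::finite \<Rightarrow> real"
  assumes g: "C1x g" and g': "\<And>k. C1x (xpartial k g)"
    and b: "\<And>k l x. \<bar>xpartial l (xpartial k g) x\<bar> \<le> B k l"
  shows "\<bar>g y - g x - (\<Sum>k\<in>UNIV. (y $ k - x $ k) * xpartial k g x)\<bar>
    \<le> 1/2 * (\<Sum>k\<in>UNIV. \<Sum>l\<in>UNIV. B k l * \<bar>(y $ k - x $ k) * (y $ l - x $ l)\<bar>)"
proof -
  define v where "v = y - x"
  define D where "D = (\<lambda>m::nat. if m = 0 then (\<lambda>t. g (x + t *\<^sub>R v)) else
     if m = 1 then (\<lambda>t. \<Sum>k\<in>UNIV. v $ k * xpartial k g (x + t *\<^sub>R v)) else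
     (\<lambda>t. \<Sum>k\<in>UNIV. v $ k * (\<Sum>l\<in>UNIV. v $ l * xpartial l (xpartial k g) (x + t *\<^sub>R v))))"
  have "\<forall>m t. m < 2 \<and> 0 \<le> t \<and> t \<le> 1 \<longrightarrow> ((D m) has_real_derivative D (Suc m) t) (at t)"
  proof (intro allI impI)
    fix m :: nat and t :: real assume m: "m < 2 \<and> 0 \<le> t \<and> t \<le> 1"
    hence "m = 0 \<or> m = 1" by auto
    thus "((D m) has_real_derivative D (Suc m) t) (at t)"
    proof
      assume "m = 0" thus ?thesis using C1x_line_DERIV[OF g, of x v t] by (simp add: D_def)
    next
      assume "m = 1" thus ?thesis unfolding D_def
        by (auto intro!: DERIV_sum DERIV_cmult C1x_line_DERIV[OF g'])
    qed
  qed
  from Taylor_up[of 2 D "\<lambda>t. g (x + t *\<^sub>R v)" 0 1 0, OF _ _ this] obtain \<tau>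
    where "g (x + 1 *\<^sub>R v) = (\<Sum>m<2. D m 0 / fact m * (1 - 0) ^ m) + D 2 \<tau> / fact 2 * (1 - 0) ^ 2"
    by (auto simp: D_def)
  hence "g y - g x - (\<Sum>k\<in>UNIV. v $ k * xpartial k g x)
      = 1/2 * (\<Sum>k\<in>UNIV. v $ k * (\<Sum>l\<in>UNIV. v $ l * xpartial l (xpartial k g) (x + \<tau> *\<^sub>R v)))"
    by (simp add: D_def v_def numeral_2_eq_2)
  hence "\<bar>g y - g x - (\<Sum>k\<in>UNIV. v $ k * xpartial k g x)\<bar>
      = 1/2 * \<bar>\<Sum>k\<in>UNIV. v $ k * (\<Sum>l\<in>UNIV. v $ l * xpartial l (xpartial k g) (x + \<tau> *\<^sub>R v))\<bar>"
    by (simp only: abs_mult)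
  also have "\<dots> = 1/2 * \<bar>\<Sum>k\<in>UNIV. \<Sum>l\<in>UNIV. v $ k * (v $ l * xpartial l (xpartial k g) (x + \<tau> *\<^sub>R v))\<bar>"
    by (simp only: sum_distrib_left)
  also have "\<dots> \<le> 1/2 * (\<Sum>k\<in>UNIV. \<Sum>l\<in>UNIV. \<bar>v $ k * (v $ l * xpartial l (xpartial k g) (x + \<tau> *\<^sub>R v))\<bar>)"
    by (intro mult_left_mono order_trans[OF sum_abs] sum_mono sum_abs) auto
  also have "\<dots> \<le> 1/2 * (\<Sum>k\<in>UNIV. \<Sum>l\<in>UNIV. B k l * \<bar>v $ k * v $ l\<bar>)"
  proof (intro mult_left_mono sum_mono)
    fix k l
    have "\<bar>v $ k * (v $ l * xpartial l (xpartial k g) (x + \<tau> *\<^sub>R v))\<bar>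
        = \<bar>xpartial l (xpartial k g) (x + \<tau> *\<^sub>R v)\<bar> * \<bar>v $ k * v $ l\<bar>"
      by (simp add: abs_mult ac_simps)
    also have "\<dots> \<le> B k l * \<bar>v $ k * v $ l\<bar>" by (intro mult_right_mono b) auto
    finally show "\<bar>v $ k * (v $ l * xpartial l (xpartial k g) (x + \<tau> *\<^sub>R v))\<bar> \<le> B k l * \<bar>v $ k * v $ l\<bar>" .
  qed auto
  finally show ?thesis by (simp add: v_def)
qed

text \<open>Walk from y to y' by unit steps in one coordinate, then replace the coordinates one
  after another.\<close>

lemma lattice_lipschitz:
  fixes G :: "('r::finite \<Rightarrow> nat) \<Rightarrow> real"
  assumes b: "\<And>k y. \<bar>G (y(k := Suc (y k))) - G y\<bar> \<le> B k"
  shows "\<bar>G y' - G y\<bar> \<le> (\<Sum>k\<in>UNIV. B k * \<bar>real (y' k) - real (y k)\<bar>)"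
proof -
  have up: "\<bar>G (y(k := y k + n)) - G y\<bar> \<le> B k * real n" for k n y
  proof (induction n)
    case (Suc n)
    have "\<bar>G (y(k := y k + Suc n)) - G (y(k := y k + n))\<bar> \<le> B k"
      using b[of "y(k := y k + n)" k] by simp
    moreover have "B k * real (Suc n) = B k * real n + B k" by (simp add: algebra_simps)
    ultimately show ?case using Suc by linarith
  qed simp
  have one: "\<bar>G (y(k := m)) - G y\<bar> \<le> B k * \<bar>real m - real (y k)\<bar>" for k m y
  proof (cases "m \<ge> y k")
    case True thus ?thesis using up[of y k "m - y k"] by simp
  next
    case False thus ?thesis using up[of "y(k := m)" k "y k - m"] by (simp add: abs_minus_commute)
  qed
  have "\<bar>G (\<lambda>i. if i \<in> S then y' i else y i) - G y\<bar> \<le> (\<Sum>k\<in>S. B k * \<bar>real (y' k) - real (y k)\<bar>)"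
    if "finite S" for S using that
  proof (induction S)
    case (insert k S)
    let ?z = "\<lambda>i. if i \<in> S then y' i else y i"
    have "(\<lambda>i. if i \<in> insert k S then y' i else y i) = ?z(k := y' k)" by auto
    moreover have "\<bar>G (?z(k := y' k)) - G ?z\<bar> \<le> B k * \<bar>real (y' k) - real (y k)\<bar>"
      using one[of ?z k "y' k"] insert by simp
    ultimately show ?case using insert by simp
  qed simp
  from this[of UNIV] show ?thesis by simp
qed

section \<open>Gaussian integration by parts\<close>

text \<open>
  If A a = c v and 2 c + |a|^2 = 1, then \<open>A + v a\<^sup>T\<close> is the required factor; such an a exists in the
  kernel of A if A is singular and along the preimage of v otherwise.
\<close>

lemma rank_one_factor_update:
  fixes A :: "real^'d::finite^'d" and v :: "real^'d"
  shows "\<exists>A'::real^'d^'d. A' ** transpose A' = A ** transpose A + (\<chi> j k. v $ j * v $ k)"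
proof -
  have "\<exists>(a::real^'d) c. A *v a = c *\<^sub>R v \<and> 2 * c + a \<bullet> a = 1"
  proof (cases "inj ((*v) A)")
    case True
    then obtain b where b: "A *v b = v"
      using linear_injective_imp_surjective[OF matrix_vector_mul_linear[of A]] by (metis surjD)
    \<comment> \<open>For a = t b and c = t the requirement reads 2t + t^2 |b|^2 = 1. This is its
      positive root, in a form that stays valid for b = 0.\<close>
    define t where "t = 1 / (1 + sqrt (1 + b \<bullet> b))"
    have q: "sqrt (1 + b \<bullet> b) * sqrt (1 + b \<bullet> b) = 1 + b \<bullet> b" by simp
    have p: "1 + sqrt (1 + b \<bullet> b) \<noteq> 0"
      by (smt (verit) inner_ge_zero real_sqrt_ge_zero)
    have "2 * t + t * t * (b \<bullet> b) = 1"
    proof -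
      have "b \<bullet> b = sqrt (1 + b \<bullet> b) * sqrt (1 + b \<bullet> b) - 1" using q by simp
      hence "2 * t + t * t * (b \<bullet> b) = 2 * t + t * t * (sqrt (1 + b \<bullet> b) * sqrt (1 + b \<bullet> b) - 1)" by simp
      also have "\<dots> = 2 * t + (t * (1 + sqrt (1 + b \<bullet> b))) * (t * (1 + sqrt (1 + b \<bullet> b))) - 2 * t * (t * (1 + sqrt (1 + b \<bullet> b)))"
        by (simp add: algebra_simps)
      also have "t * (1 + sqrt (1 + b \<bullet> b)) = 1" using p by (simp add: t_def)
      also have "2 * t + 1 * 1 - 2 * t * 1 = (1::real)" by simp
      finally show ?thesis .
    qed
    thus ?thesis using b
      by (intro exI[of _ "t *\<^sub>R b"] exI[of _ t]) (auto simp: matrix_vector_mult_scaleR)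
  next
    case False
    then obtain a where a: "A *v a = 0" "a \<noteq> 0"
      using linear_injective_0[OF matrix_vector_mul_linear[of A]] by auto
    show ?thesis
      by (rule exI[of _ "(1 / norm a) *\<^sub>R a"], rule exI[of _ 0])
         (use a in \<open>simp add: matrix_vector_mult_scaleR power2_norm_eq_inner[symmetric] power2_eq_square\<close>)
  qed
  then obtain a c where a: "A *v a = c *\<^sub>R v" "2 * c + a \<bullet> a = 1" by blast
  have Aa: "(\<Sum>i\<in>UNIV. A $ j $ i * a $ i) = c * v $ j" for j
    using arg_cong[OF a(1), of "\<lambda>w. w $ j"] by (simp add: matrix_vector_mult_def)
  have aa: "(\<Sum>i\<in>UNIV. a $ i * a $ i) = 1 - 2 * c"
    using a(2) by (simp add: inner_vec_def)
  define A' :: "real^'d^'d" where "A' = (\<chi> j i. A $ j $ i + v $ j * a $ i)"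
  have "(A' ** transpose A') $ j $ k = (A ** transpose A + (\<chi> j k. v $ j * v $ k)) $ j $ k" for j k
  proof -
    have "(A' ** transpose A') $ j $ k = (\<Sum>i\<in>UNIV. (A $ j $ i + v $ j * a $ i) * (A $ k $ i + v $ k * a $ i))"
      by (simp add: A'_def matrix_matrix_mult_def transpose_def)
    also have "\<dots> = (\<Sum>i\<in>UNIV. A $ j $ i * A $ k $ i) + v $ k * (\<Sum>i\<in>UNIV. A $ j $ i * a $ i)
        + v $ j * (\<Sum>i\<in>UNIV. A $ k $ i * a $ i) + v $ j * v $ k * (\<Sum>i\<in>UNIV. a $ i * a $ i)"
      by (simp add: sum_distrib_left algebra_simps sum.distrib)
    also have "\<dots> = (\<Sum>i\<in>UNIV. A $ j $ i * A $ k $ i) + v $ j * v $ k"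
      unfolding Aa aa by (simp add: algebra_simps)
    finally show ?thesis by (simp add: matrix_matrix_mult_def transpose_def)
  qed
  thus ?thesis by (intro exI[of _ A']) (simp add: vec_eq_iff)
qed

text \<open>The covariance of a finitely supported vector is such a sum, so it gets a square root,
  possibly singular, without being diagonalised.\<close>

lemma sum_rank_one_factor:
  fixes v :: "'b \<Rightarrow> real^'d::finite"
  assumes "finite F"
  shows "\<exists>A::real^'d^'d. A ** transpose A = (\<Sum>i\<in>F. (\<chi> j k. v i $ j * v i $ k))"
  using assms
proof (induction F)
  case empty thus ?case by (intro exI[of _ 0]) simp
next
  case (insert x F)
  then obtain A :: "real^'d^'d" where A: "A ** transpose A = (\<Sum>i\<in>F. (\<chi> j k. v i $ j * v i $ k))" by blast
  obtain A' :: "real^'d^'d" where "A' ** transpose A' = A ** transpose A + (\<chi> j k. v x $ j * v x $ k)"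
    using rank_one_factor_update[of A "v x"] by blast
  thus ?case using insert A by (intro exI[of _ A']) (simp add: add.commute)
qed

text \<open>
  \<open>gauss Sig\<close> picks its square root by SOME, so it is a centred normal law with covariance Sig only
  if some root exists.
\<close>

abbreviation gauss_factorable :: "real^'d::finite^'d \<Rightarrow> bool" where
  "gauss_factorable Sig \<equiv> \<exists>A::real^'d^'d. A ** transpose A = Sig"

definition gdens :: "real^'d::finite \<Rightarrow> real" where
  "gdens x = (\<Prod>i\<in>UNIV. std_normal_density (x $ i))"

lemma std_gauss_eq: "std_gauss = density lborel (\<lambda>x. ennreal (gdens x))"
  by (simp add: std_gauss_def gdens_def)

lemma gdens_nonneg [simp]: "gdens x \<ge> 0"
  by (simp add: gdens_def prod_nonneg)

lemma gdens_measurable [measurable]: "gdens \<in> borel_measurable borel"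
  unfolding gdens_def by measurable

lemma space_std_gauss [simp]: "space std_gauss = UNIV"
  and sets_std_gauss [simp, measurable_cong]: "sets std_gauss = sets borel"
  by (simp_all add: std_gauss_eq)

lemma prob_space_std_gauss: "prob_space (std_gauss :: (real^'d::finite) measure)"
proof
  have inj: "inj (\<lambda>i. axis i (1::real) :: real^'d)" by (auto simp: inj_on_def axis_eq_axis)
  have B: "(Basis :: (real^'d) set) = range (\<lambda>i. axis i 1)" by (auto simp: Basis_vec_def)
  have d: "ennreal (gdens x) = (\<Prod>b\<in>Basis. ennreal (std_normal_density (x \<bullet> b)))" for x :: "real^'d"
    unfolding B gdens_def by (subst prod.reindex[OF inj]) (simp add: inner_axis prod_ennreal)
  have "emeasure (std_gauss :: (real^'d) measure) (space std_gauss) = (\<integral>\<^sup>+x. ennreal (gdens (x :: real^'d)) \<partial>lborel)"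
    unfolding std_gauss_eq by (subst emeasure_density) auto
  also have "\<dots> = (\<Prod>b\<in>(Basis::(real^'d) set). (\<integral>\<^sup>+x. ennreal (std_normal_density x) \<partial>lborel))"
    unfolding d by (rule nn_integral_lborel_prod) auto
  also have "\<dots> = 1"
    by (subst nn_integral_eq_integral) auto
  finally show "emeasure (std_gauss :: (real^'d) measure) (space std_gauss) = 1" .
qed

interpretation SG: prob_space "std_gauss :: (real^'d::finite) measure"
  by (rule prob_space_std_gauss)

lemma gdens_shift:
  fixes x :: "real^'d::finite"
  shows "gdens (x - t *\<^sub>R axis i 1) = gdens x * exp (t * x $ i - t\<^sup>2 / 2)"
proof -
  have *: "std_normal_density ((x - t *\<^sub>R axis i 1) $ k)
      = std_normal_density (x $ k) * (if k = i then exp (t * x $ i - t\<^sup>2 / 2) else 1)" for k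
    by (auto simp: axis_def std_normal_density_def power2_diff exp_add[symmetric] field_simps)
  show ?thesis unfolding gdens_def * prod.distrib by (simp add: prod.delta)
qed

text \<open>The Cameron-Martin identity for a shift along one axis. It comes from translation
  invariance of Lebesgue measure and includes integrability, so it also serves unbounded
  integrands.\<close>

lemma std_gauss_shift:
  fixes G :: "real^'d::finite \<Rightarrow> real"
  assumes [measurable]: "G \<in> borel_measurable borel"
  shows "integrable std_gauss (\<lambda>x. G (x + t *\<^sub>R axis i 1)) \<longleftrightarrow> integrable std_gauss (\<lambda>x. G x * exp (t * x $ i - t\<^sup>2 / 2))"
    and "(\<integral>x. G (x + t *\<^sub>R axis i 1) \<partial>std_gauss) = (\<integral>x. G x * exp (t * x $ i - t\<^sup>2 / 2) \<partial>std_gauss)"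
proof -
  let ?c = "t *\<^sub>R axis i 1 :: real^'d"
  let ?F = "\<lambda>x. gdens (x - ?c) * G x"
  have F: "?F \<in> borel_measurable borel" by measurable
  have pm: "(+) ?c \<in> measurable lborel borel" by simp
  have eq: "?F x = gdens x * (G x * exp (t * x $ i - t\<^sup>2 / 2))" for x
    by (simp add: gdens_shift)
  have eq': "?F (?c + x) = gdens x * G (x + ?c)" for x
    by (simp add: add.commute)
  have "integrable lborel (\<lambda>x. ?F (?c + x)) \<longleftrightarrow> integrable (distr lborel borel ((+) ?c)) ?F"
    using integrable_distr_eq[OF pm F] by simp
  hence 1: "integrable lborel (\<lambda>x. ?F (?c + x)) \<longleftrightarrow> integrable lborel ?F"
    by (simp add: lborel_distr_plus)
  have "(\<integral>x. ?F x \<partial>distr lborel borel ((+) ?c)) = (\<integral>x. ?F (?c + x) \<partial>lborel)"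
    by (rule integral_distr[OF pm F])
  hence 2: "(\<integral>x. ?F (?c + x) \<partial>lborel) = (\<integral>x. ?F x \<partial>lborel)"
    by (simp add: lborel_distr_plus)
  show "integrable std_gauss (\<lambda>x. G (x + ?c)) \<longleftrightarrow> integrable std_gauss (\<lambda>x. G x * exp (t * x $ i - t\<^sup>2 / 2))"
    unfolding std_gauss_eq by (subst (1 2) integrable_density) (use 1 in \<open>auto simp: add.commute simp flip: eq\<close>)
  show "(\<integral>x. G (x + ?c) \<partial>std_gauss) = (\<integral>x. G x * exp (t * x $ i - t\<^sup>2 / 2) \<partial>std_gauss)"
    unfolding std_gauss_eq by (subst (1 2) integral_density) (use 2 in \<open>auto simp: add.commute simp flip: eq\<close>)
qed

text \<open>Exponential moments are the case G = 1 of the shift identity: the left-hand integrand is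
  then constant.\<close>

lemma std_gauss_exp_integrable: "integrable std_gauss (\<lambda>x::real^'d::finite. exp (t * x $ i))"
proof -
  have "integrable std_gauss (\<lambda>x. 1 * exp (t * x $ i - t\<^sup>2 / 2))"
    using std_gauss_shift(1)[of "\<lambda>_. 1" t i] by auto
  hence "integrable std_gauss (\<lambda>x. exp (t\<^sup>2 / 2) * (1 * exp (t * x $ i - t\<^sup>2 / 2)))" by (rule integrable_mult_right)
  moreover have "exp (t\<^sup>2 / 2) * (1 * exp (t * x $ i - t\<^sup>2 / 2)) = exp (t * x $ i)" for x :: "real^'d"
    by (simp add: mult_exp_exp)
  ultimately show ?thesis by (simp only:)
qed

lemma std_gauss_coord_integrable: "integrable std_gauss (\<lambda>x. x $ i)"
proof (rule Bochner_Integration.integrable_bound)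
  show "integrable std_gauss (\<lambda>x. exp (1 * x $ i) + exp ((-1) * x $ i))"
    by (intro Bochner_Integration.integrable_add std_gauss_exp_integrable)
  show "AE x in std_gauss. norm (x $ i) \<le> norm (exp (1 * x $ i) + exp ((-1) * x $ i))"
  proof (rule AE_I2)
    fix x :: "real^'a"
    have "\<bar>x $ i\<bar> \<le> exp (x $ i) + exp (- (x $ i))"
      using exp_ge_add_one_self[of "x $ i"] exp_ge_add_one_self[of "- (x $ i)"]
        exp_gt_zero[of "x $ i"] exp_gt_zero[of "- (x $ i)"] by linarith
    thus "norm (x $ i) \<le> norm (exp (1 * x $ i) + exp ((-1) * x $ i))" by simp
  qed
qed simp

text \<open>
  Differentiating the shift identity at t = 0 gives integration by parts without Fubini.
\<close>

lemma std_gauss_ibp: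
  fixes G :: "real^'d::finite \<Rightarrow> real"
  assumes G: "\<And>x. \<bar>G x\<bar> \<le> B" "G \<in> borel_measurable borel"
    and G': "\<And>x t. ((\<lambda>t. G (x + t *\<^sub>R axis i 1)) has_field_derivative G' (x + t *\<^sub>R axis i 1)) (at t)"
    and B': "\<And>x. \<bar>G' x\<bar> \<le> B'"
  shows "(\<integral>x. x $ i * G x \<partial>std_gauss) = (\<integral>x. G' x \<partial>std_gauss)"
proof -
  note [measurable] = G(2)
  have B0: "B \<ge> 0" using G(1)[of 0] by linarith
  have 1: "((\<lambda>t. \<integral>x. G (x + t *\<^sub>R axis i 1) \<partial>std_gauss) has_field_derivative (\<integral>x. G' (x + 0 *\<^sub>R axis i 1) \<partial>std_gauss)) (at 0)"
  proof (rule leibniz_lebesgue(2)[where a="-1" and b=1 and w="\<lambda>_. B'"])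
    show "integrable std_gauss (\<lambda>x. G (x + t *\<^sub>R axis i 1))" for t
      by (rule SG.integrable_const_bound[of _ B]) (use G in auto)
  qed (use G' B' in auto)
  have 2: "((\<lambda>t. \<integral>x. G x * exp (t * x $ i - t\<^sup>2 / 2) \<partial>std_gauss) has_field_derivative
      (\<integral>x. G x * ((x $ i - 0) * exp (0 * x $ i - 0\<^sup>2 / 2)) \<partial>std_gauss)) (at 0)"
  proof (rule leibniz_lebesgue(2)[where a="-1" and b=1 and w="\<lambda>x. B * (exp (2 * x $ i) + exp ((-2) * x $ i))"
       and \<phi>'="\<lambda>t x. G x * ((x $ i - t) * exp (t * x $ i - t\<^sup>2 / 2))"])
    show "((\<lambda>t. G x * exp (t * x $ i - t\<^sup>2 / 2)) has_real_derivative G x * ((x $ i - t) * exp (t * x $ i - t\<^sup>2 / 2))) (at t)" for t x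
      by (auto intro!: derivative_eq_intros)
    show "integrable std_gauss (\<lambda>x. G x * exp (t * x $ i - t\<^sup>2 / 2))" for t
      by (subst std_gauss_shift(1)[symmetric]) (auto intro!: SG.integrable_const_bound[of _ B] G)
    show "integrable std_gauss (\<lambda>x. B * (exp (2 * x $ i) + exp ((-2) * x $ i)))"
      by (intro integrable_mult_right Bochner_Integration.integrable_add std_gauss_exp_integrable)
    \<comment> \<open>For |t| < 1 the linear factor and the tilt are each at most
      \<open>exp \<bar>x $ i\<bar>\<close>; their product explains the exponent 2 in the
      majorant.\<close>
    show "\<bar>G x * ((x $ i - t) * exp (t * x $ i - t\<^sup>2 / 2))\<bar> \<le> B * (exp (2 * x $ i) + exp ((-2) * x $ i))"
      if t: "-1 < t" "t < 1" for t and x :: "real^'d"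
    proof -
      have "\<bar>x $ i - t\<bar> \<le> \<bar>x $ i\<bar> + 1" using t by linarith
      also have "\<dots> \<le> exp \<bar>x $ i\<bar>" using exp_ge_add_one_self[of "\<bar>x $ i\<bar>"] by linarith
      finally have a: "\<bar>x $ i - t\<bar> \<le> exp \<bar>x $ i\<bar>" .
      have "t * x $ i \<le> \<bar>t\<bar> * \<bar>x $ i\<bar>" by (metis abs_ge_self abs_mult)
      also have "\<dots> \<le> 1 * \<bar>x $ i\<bar>" using t by (intro mult_right_mono) auto
      finally have b: "t * x $ i - t\<^sup>2 / 2 \<le> \<bar>x $ i\<bar>" using zero_le_power2[of t] by linarith
      have "\<bar>x $ i - t\<bar> * exp (t * x $ i - t\<^sup>2 / 2) \<le> exp \<bar>x $ i\<bar> * exp \<bar>x $ i\<bar>"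
        using a b by (intro mult_mono) auto
      also have "\<dots> = exp (2 * \<bar>x $ i\<bar>)" by (simp add: exp_add[symmetric])
      also have "\<dots> \<le> exp (2 * x $ i) + exp ((-2) * x $ i)"
        by (cases "x $ i \<ge> 0") auto
      finally have c: "\<bar>x $ i - t\<bar> * exp (t * x $ i - t\<^sup>2 / 2) \<le> exp (2 * x $ i) + exp ((-2) * x $ i)" .
      show ?thesis unfolding abs_mult abs_exp_cancel
        by (rule mult_mono[OF G(1) c]) (use B0 in auto)
    qed
  qed auto
  have "(\<integral>x. G' (x + 0 *\<^sub>R axis i 1) \<partial>std_gauss) = (\<integral>x. G x * ((x $ i - 0) * exp (0 * x $ i - 0\<^sup>2 / 2)) \<partial>std_gauss)"
    by (rule DERIV_unique[OF 1]) (use 2 in \<open>simp only: std_gauss_shift(2)[OF G(2)]\<close>)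
  thus ?thesis by (simp add: mult.commute)
qed

lemma space_gauss [simp]: "space (gauss Sig) = UNIV"
  and sets_gauss [simp, measurable_cong]: "sets (gauss Sig) = sets borel"
  by (simp_all add: gauss_def)

lemma matrix_vector_measurable [measurable]:
  "(\<lambda>x. (A :: real^'d::finite^'d) *v x) \<in> borel_measurable borel"
  by (intro borel_measurable_continuous_onI matrix_vector_mult_linear_continuous_on)

interpretation GS: prob_space "gauss Sig :: (real^'d::finite) measure" for Sig
  unfolding gauss_def by (rule SG.prob_space_distr) simp

lemma gauss_coord_integrable: "integrable (gauss Sig) (\<lambda>x. x $ i)"
  unfolding gauss_def
  by (subst integrable_distr_eq)
     (auto simp: matrix_vector_mult_def intro!: std_gauss_coord_integrable)

text \<open>The standard identity is applied to g composed with the root A. The chain rule produces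
  a factor A_ki, and summing A_ji A_ki over i rebuilds Sigma_jk. A need not be invertible, so
  degenerate covariances are covered.\<close>

lemma gauss_ibp:
  fixes g :: "real^'d::finite \<Rightarrow> real"
  assumes Sig: "gauss_factorable Sig" and g: "C1x g" "\<And>x. \<bar>g x\<bar> \<le> B" "\<And>k x. \<bar>xpartial k g x\<bar> \<le> B'"
  shows "(\<integral>x. x $ j * g x \<partial>gauss Sig) = (\<Sum>k\<in>UNIV. Sig $ j $ k * (\<integral>x. xpartial k g x \<partial>gauss Sig))"
proof -
  define A :: "real^'d^'d" where "A = (SOME A. A ** transpose A = Sig)"
  have A: "A ** transpose A = Sig" unfolding A_def using Sig by (rule someI_ex)
  have gs: "gauss Sig = distr std_gauss borel (\<lambda>x. A *v x)" by (simp add: gauss_def A_def)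
  have gm [measurable]: "g \<in> borel_measurable borel"
    using C1x_has_derivative[OF g(1)] 
    by (intro borel_measurable_continuous_onI has_derivative_continuous_on) (auto intro: has_derivative_at_withinI)
  have pm [measurable]: "xpartial k g \<in> borel_measurable borel" for k
    using g(1) by (intro borel_measurable_continuous_onI) (auto simp: C1x_def)
  have pint: "integrable std_gauss (\<lambda>x. xpartial k g (A *v x))" for k
    by (rule SG.integrable_const_bound[of _ B']) (use g in auto)
  have gint: "integrable std_gauss (\<lambda>x. x $ i * g (A *v x))" for i
  proof (rule Bochner_Integration.integrable_bound)
    show "integrable std_gauss (\<lambda>x. B * x $ i)" by (intro integrable_mult_right std_gauss_coord_integrable)
    show "AE x in std_gauss. norm (x $ i * g (A *v x)) \<le> norm (B * x $ i)"
    proof (rule AE_I2)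
      fix x :: "real^'d"
      have "\<bar>g (A *v x)\<bar> \<le> \<bar>B\<bar>" using g(2)[of "A *v x"] by linarith
      thus "norm (x $ i * g (A *v x)) \<le> norm (B * x $ i)"
        by (simp add: abs_mult mult.commute[of "\<bar>x $ i\<bar>"] mult_right_mono)
    qed
  qed simp
  have ib: "(\<integral>x. x $ i * g (A *v x) \<partial>std_gauss) = (\<integral>x. (\<Sum>k\<in>UNIV. A $ k $ i * xpartial k g (A *v x)) \<partial>std_gauss)" for i
  proof (rule std_gauss_ibp[where B=B and B'="\<Sum>k\<in>UNIV. \<bar>A $ k $ i\<bar> * B'"])
    fix x t
    have "A *v (x + t *\<^sub>R axis i 1) = A *v x + t *\<^sub>R column i A" for t
      by (simp add: matrix_vector_right_distrib matrix_vector_mult_scaleR matrix_vector_mult_basis)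
    thus "((\<lambda>t. g (A *v (x + t *\<^sub>R axis i 1))) has_real_derivative
         (\<Sum>k\<in>UNIV. A $ k $ i * xpartial k g (A *v (x + t *\<^sub>R axis i 1)))) (at t)"
      using C1x_line_DERIV[OF g(1), of "A *v x" "column i A" t] by (simp add: column_def)
    show "\<bar>\<Sum>k\<in>UNIV. A $ k $ i * xpartial k g (A *v x)\<bar> \<le> (\<Sum>k\<in>UNIV. \<bar>A $ k $ i\<bar> * B')"
      by (rule order_trans[OF sum_abs]) (auto simp: abs_mult intro!: sum_mono mult_left_mono g)
  qed (use g(2) in auto)
  have "(\<integral>x. x $ j * g x \<partial>gauss Sig) = (\<integral>x. (\<Sum>i\<in>UNIV. A $ j $ i * (x $ i * g (A *v x))) \<partial>std_gauss)"
    unfolding gs by (subst integral_distr) (auto simp: matrix_vector_mult_def sum_distrib_right ac_simps)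
  also have "\<dots> = (\<Sum>i\<in>UNIV. A $ j $ i * (\<Sum>k\<in>UNIV. A $ k $ i * (\<integral>x. xpartial k g (A *v x) \<partial>std_gauss)))"
    using gint pint by (simp add: ib)
  also have "\<dots> = (\<Sum>i\<in>UNIV. \<Sum>k\<in>UNIV. A $ j $ i * (A $ k $ i * (\<integral>x. xpartial k g (A *v x) \<partial>std_gauss)))"
    by (simp add: sum_distrib_left)
  also have "\<dots> = (\<Sum>k\<in>UNIV. (\<Sum>i\<in>UNIV. A $ j $ i * A $ k $ i) * (\<integral>x. xpartial k g (A *v x) \<partial>std_gauss))"
    by (subst sum.swap) (simp add: sum_distrib_right mult.assoc)
  also have "\<dots> = (\<Sum>k\<in>UNIV. Sig $ j $ k * (\<integral>x. xpartial k g x \<partial>gauss Sig))"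
    unfolding gs by (subst integral_distr) (auto simp: A[symmetric] matrix_matrix_mult_def transpose_def)
  finally show ?thesis .
qed

section \<open>The thinning-and-immigration kernel\<close>

text \<open>The law at z of one coordinate started from y: a Binomial(y, 1-s) number of survivors
  plus an independent Poisson(l s) number of immigrants.\<close>

definition qk :: "real \<Rightarrow> real \<Rightarrow> nat \<Rightarrow> nat \<Rightarrow> real" where
  "qk l s y z = (\<Sum>k\<le>min y z. real (y choose k) * (1 - s) ^ k * s ^ (y - k) * (l * s) ^ (z - k)
      * exp (- (l * s)) / fact (z - k))"

text \<open>The mass function after one more individual has been added.\<close>

definition nshift :: "(nat \<Rightarrow> real) \<Rightarrow> nat \<Rightarrow> real" where
  "nshift F z = (case z of 0 \<Rightarrow> 0 | Suc m \<Rightarrow> F m)"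

lemma nshift_simps [simp]: "nshift F 0 = 0" "nshift F (Suc m) = F m"
  by (simp_all add: nshift_def)

lemma pker_qk: "pker lam s y z = (\<Prod>j\<in>UNIV. qk (lam j) s (y j) (z j))"
  unfolding pker_def qk_def ..

lemma qk_0: "qk l s 0 z = (l * s) ^ z * exp (- (l * s)) / fact z"
  by (simp add: qk_def)

text \<open>Condition on the extra individual: it survives with probability 1-s and adds one,
  otherwise it leaves no trace. Algebraically this is Pascal's rule.\<close>

lemma qk_Suc: "qk l s (Suc y) z = (1 - s) * nshift (qk l s y) z + s * qk l s y z"
proof -
  define a where "a = (\<lambda>y k. real (y choose k) * (1 - s) ^ k * s ^ (y - k))"
  define c where "c = (\<lambda>m. (l * s) ^ m * exp (- (l * s)) / fact m)"
  \<comment> \<open>Binomial coefficients with k > y vanish, so the summation range can be freed of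
    y.\<close>
  have q: "qk l s y z = (\<Sum>k\<le>z. a y k * c (z - k))" for y z
    unfolding qk_def a_def c_def
    by (rule sum.mono_neutral_cong_left) (auto simp: binomial_eq_0)
  have a0: "a (Suc y) 0 = s * a y 0" by (simp add: a_def)
  have aS: "a (Suc y) (Suc k) = (1 - s) * a y k + s * a y (Suc k)" for k
  proof (cases "Suc k \<le> y")
    case True
    hence "s ^ (y - k) = s * s ^ (y - Suc k)" by (metis Suc_diff_le Suc_le_lessD diff_Suc_Suc power_Suc)
    thus ?thesis by (simp add: a_def algebra_simps)
  next
    case False thus ?thesis by (simp add: a_def binomial_eq_0)
  qed
  show ?thesis
  proof (cases z)
    case 0 thus ?thesis by (simp add: q a0)
  next
    case (Suc m)
    have "qk l s (Suc y) (Suc m) = a (Suc y) 0 * c (Suc m) + (\<Sum>k\<le>m. a (Suc y) (Suc k) * c (m - k))"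
      unfolding q by (subst sum.atMost_Suc_shift) simp
    also have "\<dots> = (1 - s) * (\<Sum>k\<le>m. a y k * c (m - k))
        + s * (a y 0 * c (Suc m) + (\<Sum>k\<le>m. a y (Suc k) * c (m - k)))"
      by (simp add: a0 aS distrib_left distrib_right sum_distrib_left sum.distrib mult.assoc)
    also have "a y 0 * c (Suc m) + (\<Sum>k\<le>m. a y (Suc k) * c (m - k)) = qk l s y (Suc m)"
      unfolding q by (subst sum.atMost_Suc_shift) simp
    finally show ?thesis using Suc by (simp add: q)
  qed
qed

lemma nshift_nonneg: "(\<And>z. F z \<ge> 0) \<Longrightarrow> nshift F z \<ge> 0"
  by (cases z) auto

lemma nshift_sums: "F sums x \<Longrightarrow> nshift F sums x"
  using sums_Suc[of "nshift F" x] by simp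

lemma qk_nonneg: "0 \<le> s \<Longrightarrow> s \<le> 1 \<Longrightarrow> 0 \<le> l \<Longrightarrow> qk l s y z \<ge> 0"
  by (induction y arbitrary: z) (auto simp: qk_0 qk_Suc intro!: add_nonneg_nonneg mult_nonneg_nonneg nshift_nonneg)

lemma qk_sums: "qk l s y sums 1"
proof (induction y)
  case 0
  have "(\<lambda>n. (l * s) ^ n / fact n * exp (- (l * s))) sums (exp (l * s) * exp (- (l * s)))"
    using exp_converges[of "l * s"] by (intro sums_mult2) (simp add: scaleR_conv_of_real divide_inverse mult.commute)
  thus ?case by (simp add: qk_0[abs_def] exp_minus)
next
  case (Suc y)
  have "(\<lambda>z. (1 - s) * nshift (qk l s y) z + s * qk l s y z) sums ((1 - s) * 1 + s * 1)"
    by (intro sums_add sums_mult nshift_sums Suc)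
  thus ?case by (simp add: qk_Suc[abs_def])
qed

text \<open>Read off from the generating function (s + (1-s)u)^y exp(ls(u-1)), where multiplication
  by u is the shift. At y = 0 the truncated predecessor is multiplied by 0.\<close>

definition qk' :: "real \<Rightarrow> real \<Rightarrow> nat \<Rightarrow> nat \<Rightarrow> real" where
  "qk' l s y z = l * (nshift (qk l s y) z - qk l s y z)
     - real y * (nshift (qk l s (y - 1)) z - qk l s (y - 1) z)"

lemma qk_DERIV: "((\<lambda>s. qk l s y z) has_field_derivative qk' l s y z) (at s)"
proof (induction y arbitrary: z)
  case 0
  show ?case
  proof (cases z)
    case 0 thus ?thesis by (auto simp: qk_0 qk'_def intro!: derivative_eq_intros)
  next
    case (Suc m)
    have "((\<lambda>s. (l * s) ^ Suc m * exp (- (l * s)) / fact (Suc m)) has_real_derivative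
        (real (Suc m) * (l * s) ^ m * l * exp (- (l * s)) + (l * s) ^ Suc m * (- l * exp (- (l * s)))) / fact (Suc m)) (at s)"
      by (rule DERIV_cdivide) (auto intro!: derivative_eq_intros simp del: power_Suc)
    also have "(real (Suc m) * (l * s) ^ m * l * exp (- (l * s)) + (l * s) ^ Suc m * (- l * exp (- (l * s)))) / fact (Suc m)
      = l * ((l * s) ^ m * exp (- (l * s)) / fact m - (l * s) ^ Suc m * exp (- (l * s)) / fact (Suc m))"
    proof -
      have "real (Suc m) / fact (Suc m) = 1 / fact m" by (simp add: divide_simps)
      hence "real (Suc m) * X / fact (Suc m) = X / fact m" for X :: real
        by (metis mult.commute mult_1 times_divide_eq_left times_divide_eq_right)
      from this[of "(l * s) ^ m * l * exp (- (l * s))"] show ?thesis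
        by (simp only: add_divide_distrib mult.assoc right_diff_distrib mult_minus_left mult_minus_right minus_divide_left[symmetric])
           (simp add: mult_ac del: power_Suc fact_Suc of_nat_Suc)
    qed
    finally show ?thesis unfolding Suc qk_0 qk'_def by (simp add: qk_0)
  qed
next
  case (Suc y)
  have nd: "((\<lambda>s. nshift (qk l s y) z) has_field_derivative nshift (qk' l s y) z) (at s)"
    by (cases z) (auto intro: Suc)
  have nq: "nshift (qk l s (Suc y)) z = (1 - s) * nshift (nshift (qk l s y)) z + s * nshift (qk l s y) z" for y
    by (cases z) (auto simp: qk_Suc)
  have nq': "nshift (qk' l s y) z = l * (nshift (nshift (qk l s y)) z - nshift (qk l s y) z)
     - real y * (nshift (nshift (qk l s (y - 1))) z - nshift (qk l s (y - 1)) z)" for y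
    by (cases z) (auto simp: qk'_def)
  have "((\<lambda>s. (1 - s) * nshift (qk l s y) z + s * qk l s y z) has_field_derivative
     (- nshift (qk l s y) z + (1 - s) * nshift (qk' l s y) z + (qk l s y z + s * qk' l s y z))) (at s)"
    by (auto intro!: derivative_eq_intros nd Suc)
  moreover have "- nshift (qk l s y) z + (1 - s) * nshift (qk' l s y) z + (qk l s y z + s * qk' l s y z)
     = qk' l s (Suc y) z"
  \<comment> \<open>The derivative at y refers to the kernel at y - 1, so for a positive y the
    recursion is needed once more to express the kernel at y through that predecessor.\<close>
  proof (cases y)
    case 0 thus ?thesis by (simp add: nq' nq qk'_def qk_Suc algebra_simps)
  next
    case (Suc m)
    show ?thesis unfolding Suc nq' qk'_def nq diff_Suc_1 qk_Suc[of l s "Suc m"]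
      by (simp add: qk_Suc[of l s m] nq[of m] algebra_simps)
  qed
  ultimately show ?case by (simp only: qk_Suc)
qed

text \<open>A majorant free of s: in the recursion for the kernel both probabilities s and 1-s are
  replaced by 1, and in the Poisson weight s and the exponential are replaced by 1 as well.\<close>

primrec qbd :: "real \<Rightarrow> nat \<Rightarrow> nat \<Rightarrow> real" where
  "qbd l 0 = (\<lambda>z. l ^ z / fact z)"
| "qbd l (Suc y) = (\<lambda>z. nshift (qbd l y) z + qbd l y z)"

lemma nshift_mono: "(\<And>z. F z \<le> G z) \<Longrightarrow> nshift F z \<le> nshift G z"
  by (cases z) auto

lemma qbd_nonneg: "0 \<le> l \<Longrightarrow> qbd l y z \<ge> 0"
  by (induction y arbitrary: z) (auto intro!: add_nonneg_nonneg nshift_nonneg)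

lemma nshift_summable: "summable F \<Longrightarrow> summable (nshift F)"
  using nshift_sums summable_def by blast

lemma qbd_summable: "summable (qbd l y)"
proof (induction y)
  case 0 thus ?case using summable_exp[of l] by (simp add: divide_inverse mult.commute)
next
  case (Suc y) thus ?case by (simp add: summable_add nshift_summable)
qed

lemma qk_le_qbd:
  assumes "0 \<le> s" "s \<le> 1" "0 \<le> l"
  shows "qk l s y z \<le> qbd l y z"
proof (induction y arbitrary: z)
  case 0
  have "(l * s) ^ z * exp (- (l * s)) \<le> l ^ z * 1"
    using assms by (intro mult_mono power_mono) (auto simp: mult_left_le)
  thus ?case by (simp add: qk_0 divide_right_mono)
next
  case (Suc y)
  have "(1 - s) * nshift (qk l s y) z \<le> 1 * nshift (qbd l y) z"
    using assms Suc qk_nonneg by (intro mult_mono nshift_mono nshift_nonneg) auto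
  moreover have "s * qk l s y z \<le> 1 * qbd l y z"
    using assms Suc qk_nonneg by (intro mult_mono) auto
  ultimately show ?case by (simp add: qk_Suc)
qed

text \<open>One summable function that dominates both the kernel and its s-derivative for all s in
  [0,1]: the majorant of the kernel plus the triangle inequality applied to
  \<open>qk'\<close>.\<close>

definition qdom :: "real \<Rightarrow> nat \<Rightarrow> nat \<Rightarrow> real" where
  "qdom l y z = qbd l y z + (l * (nshift (qbd l y) z + qbd l y z)
     + real y * (nshift (qbd l (y - 1)) z + qbd l (y - 1) z))"

lemma qdom_summable: "summable (qdom l y)"
  unfolding qdom_def by (intro summable_add summable_mult nshift_summable qbd_summable)

lemma qdom_rest_nonneg: "0 \<le> l \<Longrightarrow> 0 \<le> l * (nshift (qbd l y) z + qbd l y z)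
     + real y * (nshift (qbd l (y - 1)) z + qbd l (y - 1) z)"
  by (simp add: nshift_nonneg qbd_nonneg)

lemma qdom_bounds:
  assumes s: "0 \<le> s" "s \<le> 1" and l: "0 \<le> l"
  shows "0 \<le> qdom l y z" "\<bar>qk l s y z\<bar> \<le> qdom l y z" "\<bar>qk' l s y z\<bar> \<le> qdom l y z"
proof -
  note r = qdom_rest_nonneg[OF l, of y z] qbd_nonneg[OF l, of y z]
  show "0 \<le> qdom l y z" using r by (simp add: qdom_def)
  show "\<bar>qk l s y z\<bar> \<le> qdom l y z"
    using r qk_le_qbd[OF s l, of y z] qk_nonneg[OF s l, of y z] by (simp add: qdom_def)
  have n: "0 \<le> nshift (qk l s y) z" "nshift (qk l s y) z \<le> nshift (qbd l y) z" for y
    using qk_le_qbd[OF s l] qk_nonneg[OF s l] by (auto intro!: nshift_nonneg nshift_mono)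
  have "\<bar>nshift (qk l s y) z - qk l s y z\<bar> \<le> nshift (qbd l y) z + qbd l y z" for y
    using n[of y] qk_le_qbd[OF s l, of y z] qk_nonneg[OF s l, of y z] by linarith
  hence "\<bar>l * (nshift (qk l s y) z - qk l s y z)\<bar> \<le> l * (nshift (qbd l y) z + qbd l y z)"
    and "\<bar>real y * (nshift (qk l s (y - 1)) z - qk l s (y - 1) z)\<bar> \<le> real y * (nshift (qbd l (y - 1)) z + qbd l (y - 1) z)"
    using l by (simp_all only: abs_mult abs_of_nonneg abs_of_nat) (auto intro!: mult_left_mono)
  thus "\<bar>qk' l s y z\<bar> \<le> qdom l y z" using r unfolding qdom_def qk'_def by linarith
qed

section \<open>Lattice shifts and the product kernel\<close>

definition upd1 :: "'r \<Rightarrow> ('r \<Rightarrow> nat) \<Rightarrow> 'r \<Rightarrow> nat" where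
  "upd1 k z = z(k := Suc (z k))"

text \<open>
  At \<open>z k = 0\<close> truncation makes this the identity; the death terms carry the factor \<open>z k\<close>, so the junk
  value never contributes.
\<close>

definition dwn1 :: "'r \<Rightarrow> ('r \<Rightarrow> nat) \<Rightarrow> 'r \<Rightarrow> nat" where
  "dwn1 k z = z(k := z k - 1)"

definition mshift :: "'r \<Rightarrow> (('r \<Rightarrow> nat) \<Rightarrow> real) \<Rightarrow> ('r \<Rightarrow> nat) \<Rightarrow> real" where
  "mshift k F z = (if z k = 0 then 0 else F (dwn1 k z))"

text \<open>Raising the mass function in coordinate k is adjoint to raising the argument of the test
  function: reindex along the injection \<open>upd1 k\<close>, off whose range the shifted mass is
  zero. This moves differences from the kernel to h.\<close>

lemma integral_mshift:
  fixes F G :: "('r::finite \<Rightarrow> nat) \<Rightarrow> real"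
  shows "(\<integral>z. G z * mshift k F z \<partial>count_space UNIV) = (\<integral>z. G (upd1 k z) * F z \<partial>count_space UNIV)"
    and "integrable (count_space UNIV) (\<lambda>z. G (upd1 k z) * F z) \<Longrightarrow> integrable (count_space UNIV) (\<lambda>z. G z * mshift k F z)"
proof -
  have inj: "inj (upd1 k)" 
  proof (rule injI)
    fix a b :: "'r \<Rightarrow> nat" assume e: "upd1 k a = upd1 k b"
    show "a = b"
    proof
      fix i show "a i = b i" using fun_cong[OF e, of i] by (auto simp: upd1_def split: if_splits)
    qed
  qed
  have ms: "mshift k F (upd1 k z) = F z" for z by (simp add: mshift_def upd1_def dwn1_def)
  have z: "mshift k F z = 0" if "z \<notin> range (upd1 k)" for z
  proof (cases "z k")
    case (Suc n)
    hence "z = upd1 k (dwn1 k z)" by (auto simp: upd1_def dwn1_def)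
    thus ?thesis using that by blast
  qed (simp add: mshift_def)
  have "infsetsum (\<lambda>z. G z * mshift k F z) UNIV = infsetsum (\<lambda>z. G z * mshift k F z) (range (upd1 k))"
    by (rule infsetsum_cong_neutral) (auto simp: z)
  also have "\<dots> = infsetsum (\<lambda>z. G (upd1 k z) * F z) UNIV"
    by (subst infsetsum_reindex[OF inj]) (simp add: ms)
  finally show "(\<integral>z. G z * mshift k F z \<partial>count_space UNIV) = (\<integral>z. G (upd1 k z) * F z \<partial>count_space UNIV)"
    by (simp add: infsetsum_def)
  assume "integrable (count_space UNIV) (\<lambda>z. G (upd1 k z) * F z)"
  hence "Infinite_Set_Sum.abs_summable_on (\<lambda>z. G (upd1 k z) * mshift k F (upd1 k z)) (UNIV)" by (simp add: ms Infinite_Set_Sum.abs_summable_on_def)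
  hence "Infinite_Set_Sum.abs_summable_on (\<lambda>z. G z * mshift k F z) (range (upd1 k))"
    using abs_summable_on_reindex_iff[OF inj, of "\<lambda>z. G z * mshift k F z"] by simp
  hence "Infinite_Set_Sum.abs_summable_on (\<lambda>z. G z * mshift k F z) (UNIV)"
    by (subst abs_summable_on_cong_neutral[where B="range (upd1 k)"]) (auto simp: z)
  thus "integrable (count_space UNIV) (\<lambda>z. G z * mshift k F z)" by (simp add: Infinite_Set_Sum.abs_summable_on_def)
qed

definition pdom :: "('r::finite \<Rightarrow> real) \<Rightarrow> ('r \<Rightarrow> nat) \<Rightarrow> ('r \<Rightarrow> nat) \<Rightarrow> real" where
  "pdom lam y z = (\<Prod>j\<in>UNIV. qdom (lam j) (y j) (z j))"

definition pker' :: "('r::finite \<Rightarrow> real) \<Rightarrow> real \<Rightarrow> ('r \<Rightarrow> nat) \<Rightarrow> ('r \<Rightarrow> nat) \<Rightarrow> real" where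
  "pker' lam s y z = (\<Sum>k\<in>UNIV. lam k * (mshift k (pker lam s y) z - pker lam s y z)
     - real (y k) * (mshift k (pker lam s (dwn1 k y)) z - pker lam s (dwn1 k y) z))"

lemma pker_update:
  "pker lam s (y(k := m)) z = qk (lam k) s m (z k) * (\<Prod>i\<in>UNIV-{k}. qk (lam i) s (y i) (z i))"
  "mshift k (pker lam s (y(k := m))) z = nshift (qk (lam k) s m) (z k) * (\<Prod>i\<in>UNIV-{k}. qk (lam i) s (y i) (z i))"
proof -
  show 1: "pker lam s (y(k := m)) z = qk (lam k) s m (z k) * (\<Prod>i\<in>UNIV-{k}. qk (lam i) s (y i) (z i))" for z
    unfolding pker_qk by (subst prod.remove[of _ k]) auto
  show "mshift k (pker lam s (y(k := m))) z = nshift (qk (lam k) s m) (z k) * (\<Prod>i\<in>UNIV-{k}. qk (lam i) s (y i) (z i))"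
    unfolding mshift_def 1 by (cases "z k") (auto simp: dwn1_def intro!: prod.cong)
qed

lemma pker_Suc: "pker lam s (upd1 k y) z = (1 - s) * mshift k (pker lam s y) z + s * pker lam s y z"
  using pker_update(1)[of lam s y k "y k" z] pker_update(2)[of k lam s y "y k" z] pker_update(1)[of lam s y k "Suc (y k)" z]
  by (simp add: upd1_def qk_Suc algebra_simps)

lemma pker'_eq: "pker' lam s y z = (\<Sum>k\<in>UNIV. qk' (lam k) s (y k) (z k) * (\<Prod>i\<in>UNIV-{k}. qk (lam i) s (y i) (z i)))"
  unfolding pker'_def
proof (rule sum.cong[OF refl])
  fix k
  show "lam k * (mshift k (pker lam s y) z - pker lam s y z)
     - real (y k) * (mshift k (pker lam s (dwn1 k y)) z - pker lam s (dwn1 k y) z)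
     = qk' (lam k) s (y k) (z k) * (\<Prod>i\<in>UNIV-{k}. qk (lam i) s (y i) (z i))"
    using pker_update(1)[of lam s y k "y k" z] pker_update(1)[of lam s y k "y k - 1" z]
      pker_update(2)[of k lam s y "y k" z] pker_update(2)[of k lam s y "y k - 1" z]
    by (simp add: dwn1_def qk'_def algebra_simps)
qed

lemma pker_DERIV: "((\<lambda>s. pker lam s y z) has_field_derivative pker' lam s y z) (at s)"
  unfolding pker_qk pker'_eq by (intro has_field_derivative_prod qk_DERIV)

lemma pker_pdom:
  fixes y z :: "'r::finite \<Rightarrow> nat"
  assumes s: "0 \<le> s" "s \<le> 1" and l: "\<forall>k. 0 \<le> lam k"
  shows "0 \<le> pdom lam y z" "0 \<le> pker lam s y z" "pker lam s y z \<le> pdom lam y z"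
    "\<bar>pker' lam s y z\<bar> \<le> real CARD('r) * pdom lam y z"
proof -
  note q = qdom_bounds[OF s l[rule_format]] qk_nonneg[OF s l[rule_format]]
  show "0 \<le> pdom lam y z" unfolding pdom_def by (intro prod_nonneg ballI q)
  show "0 \<le> pker lam s y z" unfolding pker_qk by (intro prod_nonneg ballI q)
  show "pker lam s y z \<le> pdom lam y z" unfolding pker_qk pdom_def
    by (intro prod_mono conjI q) (use q(2) q(4) in \<open>metis abs_of_nonneg\<close>)
  have "\<bar>pker' lam s y z\<bar> \<le> (\<Sum>k\<in>UNIV. \<bar>qk' (lam k) s (y k) (z k) * (\<Prod>i\<in>UNIV-{k}. qk (lam i) s (y i) (z i))\<bar>)"
    unfolding pker'_eq by (rule sum_abs)
  \<comment> \<open>The product rule gives one term per coordinate, each below the full product of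
    majorants; hence the factor \<open>CARD('r)\<close>.\<close>
  also have "\<dots> \<le> (\<Sum>k\<in>(UNIV::'r set). pdom lam y z)"
  proof (rule sum_mono)
    fix k
    have "\<bar>qk' (lam k) s (y k) (z k) * (\<Prod>i\<in>UNIV-{k}. qk (lam i) s (y i) (z i))\<bar>
      \<le> qdom (lam k) (y k) (z k) * (\<Prod>i\<in>UNIV-{k}. qdom (lam i) (y i) (z i))"
      unfolding abs_mult abs_prod
      by (intro mult_mono q prod_mono conjI) (auto intro: prod_nonneg)
    also have "\<dots> = pdom lam y z" unfolding pdom_def by (subst prod.remove[of UNIV k]) auto
    finally show "\<bar>qk' (lam k) s (y k) (z k) * (\<Prod>i\<in>UNIV-{k}. qk (lam i) s (y i) (z i))\<bar> \<le> pdom lam y z" .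
  qed
  finally show "\<bar>pker' lam s y z\<bar> \<le> real CARD('r) * pdom lam y z" by simp
qed

lemma pdom_integrable:
  fixes y :: "'r::finite \<Rightarrow> nat"
  assumes l: "\<forall>k. 0 \<le> lam k"
  shows "integrable (count_space UNIV) (pdom lam y)"
proof -
  have "Infinite_Set_Sum.abs_summable_on (\<lambda>z. \<Prod>j\<in>UNIV. qdom (lam j) (y j) (z j)) (PiE UNIV (\<lambda>_. UNIV))"
  proof (rule abs_summable_on_prod_PiE)
    show "Infinite_Set_Sum.abs_summable_on (qdom (lam j) (y j)) UNIV" for j
      using qdom_summable[of "lam j" "y j"] qdom_bounds(1)[of 0, OF _ _ l[rule_format, of j]]
      by (simp add: abs_summable_on_nat_iff')
  qed auto
  thus ?thesis by (simp add: Infinite_Set_Sum.abs_summable_on_def pdom_def[abs_def])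
qed

lemma pker_integrable:
  fixes y :: "'r::finite \<Rightarrow> nat"
  assumes s: "0 \<le> s" "s \<le> 1" and l: "\<forall>k. 0 \<le> lam k" and G: "\<And>z. \<bar>G z\<bar> \<le> B"
  shows "integrable (count_space UNIV) (\<lambda>z. G z * pker lam s y z)"
proof (rule Bochner_Integration.integrable_bound)
  show "integrable (count_space UNIV) (\<lambda>z. B * pdom lam y z)"
    using pdom_integrable[OF l] by (rule integrable_mult_right)
  show "AE z in count_space UNIV. norm (G z * pker lam s y z) \<le> norm (B * pdom lam y z)"
  proof (rule AE_I2)
    fix z
    have B: "0 \<le> B" using G[of z] by linarith
    have "\<bar>G z\<bar> * pker lam s y z \<le> B * pdom lam y z"
      by (rule mult_mono[OF G]) (use B pker_pdom[OF s l] in auto)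
    thus "norm (G z * pker lam s y z) \<le> norm (B * pdom lam y z)"
      using pker_pdom[OF s l] B by (simp add: abs_mult)
  qed
qed auto

lemma pker_integral_1:
  fixes y :: "'r::finite \<Rightarrow> nat"
  assumes s: "0 \<le> s" "s \<le> 1" and l: "\<forall>k. 0 \<le> lam k"
  shows "(\<integral>z. pker lam s y z \<partial>count_space UNIV) = 1"
proof -
  have ab: "Infinite_Set_Sum.abs_summable_on (qk (lam j) s (y j)) UNIV" for j
    using qk_sums[of "lam j" s "y j"] qk_nonneg[OF s l[rule_format]] by (simp add: abs_summable_on_nat_iff' sums_iff)
  have "infsetsum (\<lambda>z. \<Prod>j\<in>UNIV. qk (lam j) s (y j) (z j)) (PiE UNIV (\<lambda>_. UNIV))
     = (\<Prod>j\<in>UNIV. infsetsum (qk (lam j) s (y j)) UNIV)"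
    by (rule infsetsum_prod_PiE) (auto intro: ab)
  also have "\<dots> = 1"
    using qk_sums by (intro prod.neutral) (auto simp: infsetsum_nat'[OF ab] sums_iff)
  finally show ?thesis by (simp add: infsetsum_def pker_qk)
qed

text \<open>The expectation of G under the kernel, written as an integral over counting measure so
  that the dominated convergence lemmas for integrals apply to lattice sums too.\<close>

definition Kop :: "('r::finite \<Rightarrow> real) \<Rightarrow> real \<Rightarrow> ('r \<Rightarrow> nat) \<Rightarrow> (('r \<Rightarrow> nat) \<Rightarrow> real) \<Rightarrow> real" where
  "Kop lam s y G = (\<integral>z. G z * pker lam s y z \<partial>count_space UNIV)"

context
  fixes lam :: "'r::finite \<Rightarrow> real"
  assumes lam: "\<forall>k. 0 < lam k"
begin

lemma lam0: "\<forall>k. 0 \<le> lam k" using lam by (simp add: less_imp_le)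

lemma Kop_bound:
  assumes s: "0 \<le> s" "s \<le> 1" and G: "\<And>z. \<bar>G z\<bar> \<le> B"
  shows "\<bar>Kop lam s y G\<bar> \<le> B"
proof -
  have i: "integrable (count_space UNIV) (\<lambda>z. B * pker lam s y z)"
    by (rule pker_integrable[OF s lam0, of "\<lambda>_. B" "\<bar>B\<bar>"]) auto
  have "\<bar>Kop lam s y G\<bar> \<le> (\<integral>z. \<bar>G z * pker lam s y z\<bar> \<partial>count_space UNIV)"
    unfolding Kop_def by (rule integral_abs_bound)
  also have "\<dots> \<le> (\<integral>z. B * pker lam s y z \<partial>count_space UNIV)"
    by (intro integral_mono integrable_abs i pker_integrable[OF s lam0 G])
       (use pker_pdom(2)[OF s lam0] G in \<open>simp add: abs_mult mult_right_mono\<close>)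
  also have "\<dots> = B" using pker_integral_1[OF s lam0] by simp
  finally show ?thesis .
qed

lemma Kop_diff:
  assumes s: "0 \<le> s" "s \<le> 1" and G: "\<And>z. \<bar>G z\<bar> \<le> B" "\<And>z. \<bar>H z\<bar> \<le> B'"
  shows "Kop lam s y (\<lambda>z. G z - H z) = Kop lam s y G - Kop lam s y H"
  unfolding Kop_def left_diff_distrib
  by (rule Bochner_Integration.integral_diff) (rule pker_integrable[OF s lam0 G(1)] pker_integrable[OF s lam0 G(2)])+

lemma Kop_sum:
  assumes s: "0 \<le> s" "s \<le> 1" and G: "\<And>i z. i \<in> A \<Longrightarrow> \<bar>G i z\<bar> \<le> B i"
  shows "Kop lam s y (\<lambda>z. \<Sum>i\<in>A. G i z) = (\<Sum>i\<in>A. Kop lam s y (G i))"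
  unfolding Kop_def sum_distrib_right
  by (rule Bochner_Integration.integral_sum) (rule pker_integrable[OF s lam0 G])

lemma Kop_cmult: "Kop lam s y (\<lambda>z. c * G z) = c * Kop lam s y G"
  unfolding Kop_def by (simp add: mult.assoc)

lemma Kop_Suc:
  assumes s: "0 \<le> s" "s \<le> 1" and G: "\<And>z. \<bar>G z\<bar> \<le> B"
  shows "Kop lam s (upd1 k y) G = (1 - s) * Kop lam s y (\<lambda>z. G (upd1 k z)) + s * Kop lam s y G"
proof -
  have i1: "integrable (count_space UNIV) (\<lambda>z. G z * mshift k (pker lam s y) z)"
    by (intro integral_mshift(2) pker_integrable[OF s lam0, of _ B] G)
  have i2: "integrable (count_space UNIV) (\<lambda>z. G z * pker lam s y z)"
    by (intro pker_integrable[OF s lam0, of _ B] G)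
  have "Kop lam s (upd1 k y) G = (\<integral>z. (1 - s) * (G z * mshift k (pker lam s y) z) + s * (G z * pker lam s y z) \<partial>count_space UNIV)"
    unfolding Kop_def pker_Suc by (simp add: algebra_simps)
  also have "\<dots> = (1 - s) * (\<integral>z. G z * mshift k (pker lam s y) z \<partial>count_space UNIV) + s * Kop lam s y G"
    using i1 i2 by (simp add: Kop_def)
  finally show ?thesis by (simp add: integral_mshift Kop_def)
qed

text \<open>Starting with one more individual matters only if that individual survives. This is
  where a difference in y gains its factor 1-s.\<close>

lemma Kop_ydiff:
  assumes s: "0 \<le> s" "s \<le> 1" and G: "\<And>z. \<bar>G z\<bar> \<le> B"
  shows "Kop lam s (upd1 k y) G - Kop lam s y G = (1 - s) * Kop lam s y (\<lambda>z. G (upd1 k z) - G z)"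
  unfolding Kop_Suc[OF s G] by (subst Kop_diff[OF s G G]) (simp add: algebra_simps)

text \<open>At time 0 everyone survives and nobody has immigrated: the kernel is a point mass at
  y.\<close>

lemma Kop_0: "Kop lam 0 y G = G y"
proof -
  have q: "qk l 0 y z = (if z = y then 1 else 0)" for l y z
  proof (induction y arbitrary: z)
    case 0 thus ?case by (simp add: qk_0 power_0_left)
  next
    case (Suc y) thus ?case by (cases z) (auto simp: qk_Suc)
  qed
  have "pker lam 0 y z = indicator {y} z" for z
    unfolding pker_qk q by (auto simp: indicator_def fun_eq_iff)
  hence "Kop lam 0 y G = infsetsum (\<lambda>z. G z * indicator {y} z) UNIV"
    by (simp add: Kop_def infsetsum_def)
  also have "\<dots> = infsetsum (\<lambda>z. G z) {y}"
    by (rule infsetsum_cong_neutral) auto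
  finally show ?thesis by simp
qed

text \<open>At s = 1 no initial individual is left, so y is forgotten and only the Poisson
  immigrants remain.\<close>

lemma Kop_1: "Kop lam 1 y G = (\<integral>z. G z \<partial>poissons lam)"
proof -
  have q: "qk l 1 y z = l ^ z * exp (- l) / fact z" for l y z
    by (induction y) (auto simp: qk_0 qk_Suc)
  have "pker lam 1 y z = pmf (Pi_pmf UNIV 0 (\<lambda>j. poisson_pmf (lam j))) z" for z
    unfolding pker_qk q by (subst pmf_Pi) (use lam in \<open>auto simp: field_simps\<close>)
  thus ?thesis unfolding Kop_def poissons_def measure_pmf_eq_density
    by (subst integral_density) (auto simp: mult.commute)
qed

text \<open>The test function depends on s as well, because the Gaussian smoothing of h runs on the
  same clock. The interval stays away from 0 and 1, where bounds for the derivative of that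
  smoothing may degenerate.\<close>

lemma Kop_DERIV:
  assumes ab: "0 < a" "a < s0" "s0 < b" "b < 1"
    and \<phi>: "\<And>s z. a < s \<Longrightarrow> s < b \<Longrightarrow> ((\<lambda>s. \<phi> s z) has_field_derivative \<phi>' s z) (at s)"
    and B: "\<And>s z. a < s \<Longrightarrow> s < b \<Longrightarrow> \<bar>\<phi> s z\<bar> \<le> B"
    and B': "\<And>s z. a < s \<Longrightarrow> s < b \<Longrightarrow> \<bar>\<phi>' s z\<bar> \<le> B'"
  shows "((\<lambda>s. Kop lam s y (\<phi> s)) has_field_derivative
     Kop lam s0 y (\<phi>' s0) + (\<Sum>k\<in>UNIV. lam k * Kop lam s0 y (\<lambda>z. \<phi> s0 (upd1 k z) - \<phi> s0 z)
        - real (y k) * Kop lam s0 (dwn1 k y) (\<lambda>z. \<phi> s0 (upd1 k z) - \<phi> s0 z))) (at s0)"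
proof -
  have B0: "0 \<le> B" "0 \<le> B'" using B[of s0 undefined] B'[of s0 undefined] ab by linarith+
  have s0: "0 \<le> s0" "s0 \<le> 1" using ab by auto
  note Bs = B[OF ab(2,3)] note Bs' = B'[OF ab(2,3)]
  have "((\<lambda>s. Kop lam s y (\<phi> s)) has_field_derivative
     (\<integral>z. \<phi> s0 z * pker' lam s0 y z + \<phi>' s0 z * pker lam s0 y z \<partial>count_space UNIV)) (at s0)"
    unfolding Kop_def
  proof (rule leibniz_lebesgue(2)[where a=a and b=b and w="\<lambda>z. (B * real CARD('r) + B') * pdom lam y z"
      and \<phi>'="\<lambda>s z. \<phi> s z * pker' lam s y z + \<phi>' s z * pker lam s y z"])
    show "((\<lambda>s. \<phi> s z * pker lam s y z) has_real_derivative \<phi> s z * pker' lam s y z + \<phi>' s z * pker lam s y z) (at s)"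
      if "a < s" "s < b" for s z
      by (auto intro!: derivative_eq_intros \<phi> that pker_DERIV)
    show "integrable (count_space UNIV) (\<lambda>z. \<phi> s z * pker lam s y z)" if "a < s" "s < b" for s
      by (rule pker_integrable[OF _ _ lam0, where B=B]) (use that ab B in auto)
    show "integrable (count_space UNIV) (\<lambda>z. (B * real CARD('r) + B') * pdom lam y z)"
      by (intro integrable_mult_right pdom_integrable lam0)
    show "\<bar>\<phi> s z * pker' lam s y z + \<phi>' s z * pker lam s y z\<bar> \<le> (B * real CARD('r) + B') * pdom lam y z"
      if s: "a < s" "s < b" for s z
    proof -
      have s': "0 \<le> s" "s \<le> 1" using s ab by auto
      note p = pker_pdom[OF s' lam0, of y z]
      have "\<bar>\<phi> s z * pker' lam s y z\<bar> \<le> B * (real CARD('r) * pdom lam y z)"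
        unfolding abs_mult by (rule mult_mono[OF B[OF s] p(4)]) (use B0 in auto)
      moreover have "\<bar>\<phi>' s z * pker lam s y z\<bar> \<le> B' * pdom lam y z"
        unfolding abs_mult by (rule mult_mono[OF B'[OF s]]) (use B0 p in auto)
      moreover have "(B * real CARD('r) + B') * pdom lam y z = B * (real CARD('r) * pdom lam y z) + B' * pdom lam y z"
        by (simp add: algebra_simps)
      ultimately show ?thesis by linarith
    qed
  qed (use ab in auto)
  \<comment> \<open>Summation by parts: the shifts in the kernel derivative become differences of
    the test function.\<close>
  also have "(\<integral>z. \<phi> s0 z * pker' lam s0 y z + \<phi>' s0 z * pker lam s0 y z \<partial>count_space UNIV)
     = Kop lam s0 y (\<phi>' s0) + (\<Sum>k\<in>UNIV. lam k * Kop lam s0 y (\<lambda>z. \<phi> s0 (upd1 k z) - \<phi> s0 z)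
        - real (y k) * Kop lam s0 (dwn1 k y) (\<lambda>z. \<phi> s0 (upd1 k z) - \<phi> s0 z))"
  proof -
    have i1: "integrable (count_space UNIV) (\<lambda>z. \<phi> s0 z * mshift k (pker lam s0 y) z)" for k y
      by (intro integral_mshift(2) pker_integrable[OF s0 lam0, of _ B] Bs)
    have i2: "integrable (count_space UNIV) (\<lambda>z. \<phi> s0 z * pker lam s0 y z)" for y
      by (intro pker_integrable[OF s0 lam0, of _ B] Bs)
    have i3: "integrable (count_space UNIV) (\<lambda>z. \<phi>' s0 z * pker lam s0 y z)"
      by (intro pker_integrable[OF s0 lam0, of _ B'] Bs')
    have d: "(\<integral>z. \<phi> s0 z * mshift k (pker lam s0 y) z \<partial>count_space UNIV) - (\<integral>z. \<phi> s0 z * pker lam s0 y z \<partial>count_space UNIV)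
       = Kop lam s0 y (\<lambda>z. \<phi> s0 (upd1 k z) - \<phi> s0 z)" for k y
      unfolding integral_mshift by (subst Kop_diff[OF s0 Bs Bs]) (simp add: Kop_def)
    have "(\<integral>z. \<phi> s0 z * pker' lam s0 y z + \<phi>' s0 z * pker lam s0 y z \<partial>count_space UNIV)
      = (\<integral>z. \<phi>' s0 z * pker lam s0 y z + (\<Sum>k\<in>UNIV. lam k * (\<phi> s0 z * mshift k (pker lam s0 y) z - \<phi> s0 z * pker lam s0 y z)
     - real (y k) * (\<phi> s0 z * mshift k (pker lam s0 (dwn1 k y)) z - \<phi> s0 z * pker lam s0 (dwn1 k y) z)) \<partial>count_space UNIV)"
      unfolding pker'_def sum_distrib_left by (simp add: algebra_simps)
    also have "\<dots> = Kop lam s0 y (\<phi>' s0) + (\<Sum>k\<in>UNIV.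
        lam k * ((\<integral>z. \<phi> s0 z * mshift k (pker lam s0 y) z \<partial>count_space UNIV) - (\<integral>z. \<phi> s0 z * pker lam s0 y z \<partial>count_space UNIV))
      - real (y k) * ((\<integral>z. \<phi> s0 z * mshift k (pker lam s0 (dwn1 k y)) z \<partial>count_space UNIV) - (\<integral>z. \<phi> s0 z * pker lam s0 (dwn1 k y) z \<partial>count_space UNIV)))"
      using i1 i2 i3 by (simp add: Kop_def)
    finally show ?thesis unfolding d .
  qed
  finally show ?thesis .
qed

text \<open>The parameter ranges over any metric space so that one statement gives continuity in the
  time s and in the point x.\<close>

lemma Kop_continuous:
  fixes \<phi> :: "'b::metric_space \<Rightarrow> ('r \<Rightarrow> nat) \<Rightarrow> real" and \<sigma> :: "'b \<Rightarrow> real"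
  assumes \<sigma>: "continuous_on S \<sigma>" "\<And>t. t \<in> S \<Longrightarrow> 0 \<le> \<sigma> t \<and> \<sigma> t \<le> 1"
    and c: "\<And>z. continuous_on S (\<lambda>t. \<phi> t z)" and B: "\<And>t z. t \<in> S \<Longrightarrow> \<bar>\<phi> t z\<bar> \<le> B"
  shows "continuous_on S (\<lambda>t. Kop lam (\<sigma> t) y (\<phi> t))"
  unfolding Kop_def
proof (rule continuous_on_integral_dominated[where w="\<lambda>z. B * pdom lam y z"])
  have "continuous_on UNIV (\<lambda>s. pker lam s y z)" for z
    by (intro continuous_at_imp_continuous_on ballI DERIV_isCont[OF pker_DERIV])
  hence "continuous_on S (\<lambda>t. pker lam (\<sigma> t) y z)" for z
    by (rule continuous_on_compose2[OF _ \<sigma>(1)]) auto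
  thus "continuous_on S (\<lambda>t. \<phi> t z * pker lam (\<sigma> t) y z)" for z
    by (intro continuous_intros c)
  show "integrable (count_space UNIV) (\<lambda>z. B * pdom lam y z)"
    by (intro integrable_mult_right pdom_integrable lam0)
  show "\<bar>\<phi> t z * pker lam (\<sigma> t) y z\<bar> \<le> B * pdom lam y z" if "t \<in> S" for t z
  proof -
    have "0 \<le> B" using B[OF that, of z] by linarith
    thus ?thesis unfolding abs_mult
      using pker_pdom[OF _ _ lam0] \<sigma>(2)[OF that] by (intro mult_mono B that) auto
  qed
qed auto

end

section \<open>The Ornstein--Uhlenbeck component\<close>

text \<open>The bound is uniform in y as well as in x, since lattice sums run over all y. Continuity
  is asked in x only, y being discrete.\<close>

definition CB :: "(real^'d::finite \<Rightarrow> 'y \<Rightarrow> real) \<Rightarrow> bool" where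
  "CB g \<longleftrightarrow> (\<forall>y. continuous_on UNIV (\<lambda>x. g x y)) \<and> (\<exists>B. \<forall>x y. \<bar>g x y\<bar> \<le> B)"

definition smooth1 :: "(real^'d::finite \<Rightarrow> 'y \<Rightarrow> real) \<Rightarrow> bool" where
  "smooth1 g \<longleftrightarrow> CB g \<and> (\<forall>j. (\<forall>y. xdiffble j (\<lambda>x. g x y)) \<and> CB (pdx j g))"

lemma pdx_xpartial: "(\<lambda>x. pdx j g x y) = xpartial j (\<lambda>x. g x y)"
  by (simp add: pdx_def fun_eq_iff)

lemma CB_bound: "CB g \<Longrightarrow> \<exists>B\<ge>0. \<forall>x y. \<bar>g x y\<bar> \<le> B"
  unfolding CB_def by (metis abs_ge_zero order_trans)

lemma CB_measurable [measurable]: "CB g \<Longrightarrow> (\<lambda>x. g x y) \<in> borel_measurable borel"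
  by (simp add: CB_def borel_measurable_continuous_onI)

lemma CB_comp: "CB g \<Longrightarrow> continuous_on S f \<Longrightarrow> continuous_on S (\<lambda>x. g (f x) y)"
  unfolding CB_def using continuous_on_compose2[of UNIV "\<lambda>x. g x y" S f] by auto

lemma smooth1_C1x: "smooth1 g \<Longrightarrow> C1x (\<lambda>x. g x y)"
  by (simp add: smooth1_def C1x_def CB_def pdx_xpartial[symmetric])

lemma CB_ydiff: "CB g \<Longrightarrow> CB (ydiff k g)"
proof -
  assume g: "CB g"
  then obtain B where B: "\<And>x y. \<bar>g x y\<bar> \<le> B" by (auto simp: CB_def)
  have "\<bar>ydiff k g x y\<bar> \<le> B + B" for x y
    using B[of x y] B[of x "y(k := Suc (y k))"] by (simp add: ydiff_def)
  thus ?thesis using g by (auto simp: CB_def ydiff_def intro!: continuous_intros)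
qed

lemma ydiff_upd1: "ydiff k g x y = g x (upd1 k y) - g x y"
  by (simp add: ydiff_def upd1_def)

lemma smooth1_ydiff:
  assumes g: "smooth1 g"
  shows "smooth1 (ydiff k g)" "pdx j (ydiff k g) = ydiff k (pdx j g)"
proof -
  have d: "((\<lambda>t. ydiff k g (x + t *\<^sub>R axis j 1) y) has_field_derivative ydiff k (pdx j g) x y) (at 0)" for x y j
  proof -
    have *: "((\<lambda>t. g (x + t *\<^sub>R axis j 1) y) has_field_derivative pdx j g x y) (at 0)" for y
      using xpartial_DERIV[of j "\<lambda>x. g x y" x 0] g by (simp add: smooth1_def pdx_def)
    show ?thesis unfolding ydiff_def by (intro DERIV_diff *)
  qed
  note x = xpartialI[of "\<lambda>x. ydiff k g x y" j "\<lambda>x. ydiff k (pdx j g) x y" for y j, OF d]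
  show e: "pdx j (ydiff k g) = ydiff k (pdx j g)" for j
    using x(2) by (simp add: pdx_def[of j "ydiff k g", abs_def] fun_eq_iff)
  show "smooth1 (ydiff k g)"
    using g x(1) by (auto simp: smooth1_def e CB_ydiff)
qed

lemma C1x_affine:
  fixes g :: "real^'d::finite \<Rightarrow> real"
  assumes "C1x g"
  shows "C1x (\<lambda>u. g (a + c *\<^sub>R u))" "xpartial k (\<lambda>u. g (a + c *\<^sub>R u)) = (\<lambda>u. c * xpartial k g (a + c *\<^sub>R u))"
proof -
  have d: "((\<lambda>t. g (a + c *\<^sub>R (x + t *\<^sub>R axis k 1))) has_field_derivative c * xpartial k g (a + c *\<^sub>R x)) (at 0)" for x k
  proof -
    have k: "xdiffble k g" using assms by (simp add: C1x_def)
    have c: "((\<lambda>t. c * t) has_field_derivative c) (at 0)" using DERIV_cmult_Id by blast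
    have "((\<lambda>t. g ((a + c *\<^sub>R x) + (c * t) *\<^sub>R axis k 1)) has_field_derivative
       xpartial k g ((a + c *\<^sub>R x) + (c * 0) *\<^sub>R axis k 1) * c) (at 0)"
      by (rule DERIV_chain2[OF xpartial_DERIV[OF k] c])
    moreover have "a + c *\<^sub>R (x + t *\<^sub>R axis k 1) = (a + c *\<^sub>R x) + (c * t) *\<^sub>R axis k 1" for t
      by (simp add: scaleR_add_right add.assoc)
    ultimately show ?thesis by (simp add: mult.commute add.assoc)
  qed
  note x = xpartialI[of "\<lambda>u. g (a + c *\<^sub>R u)" k "\<lambda>u. c * xpartial k g (a + c *\<^sub>R u)" for k, OF d]
  show "xpartial k (\<lambda>u. g (a + c *\<^sub>R u)) = (\<lambda>u. c * xpartial k g (a + c *\<^sub>R u))" by (rule x(2))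
  have "continuous_on UNIV (\<lambda>u. c * xpartial k g (a + c *\<^sub>R u))" for k
  proof -
    have "continuous_on UNIV (xpartial k g)" using assms by (simp add: C1x_def)
    moreover have "continuous_on UNIV (\<lambda>u. a + c *\<^sub>R u)" by (intro continuous_intros)
    ultimately have "continuous_on UNIV (\<lambda>u. xpartial k g (a + c *\<^sub>R u))"
      by (rule continuous_on_compose2) simp
    thus ?thesis by (rule continuous_on_mult_left)
  qed
  thus "C1x (\<lambda>u. g (a + c *\<^sub>R u))"
    unfolding C1x_def x(2) using x(1) by blast
qed

text \<open>
  Differentiating \<open>T\<^sub>s\<close> in x produces one factor sqrt(1-s), a difference in y two of them; n counts
  these factors. The weight is integrable on (0,1) only for n > 0, so n = 0 needs a centred integrand.
\<close>

definition wt :: "nat \<Rightarrow> real \<Rightarrow> real" where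
  "wt n s = sqrt (1 - s) ^ n / (2 * (1 - s))"

lemma wt_Suc: "wt (Suc n) s = sqrt (1 - s) * wt n s"
  by (simp add: wt_def)

lemma wt_Suc_Suc: "s < 1 \<Longrightarrow> wt (Suc (Suc n)) s = (1 - s) * wt n s"
  by (simp add: wt_def)

lemma wt_nonneg: "s < 1 \<Longrightarrow> 0 \<le> wt n s"
  by (simp add: wt_def)

lemma wt_measurable [measurable]: "wt n \<in> borel_measurable borel"
  unfolding wt_def[abs_def] by measurable

lemma wt_le: "0 < s \<Longrightarrow> s < 1 \<Longrightarrow> m \<le> n \<Longrightarrow> wt n s \<le> wt m s"
  unfolding wt_def by (intro divide_right_mono power_decreasing) auto

text \<open>Lebesgue measure on the open unit interval as a measure of its own, so that time
  integrals fall under the same dominated convergence lemmas. The singular endpoint s = 1 lies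
  outside.\<close>

definition U01 :: "real measure" where
  "U01 = restrict_space lborel {0<..<1}"

lemma space_U01 [simp]: "space U01 = {0<..<1}"
  by (simp add: U01_def space_restrict_space)

lemma U01_measurable: "f \<in> borel_measurable borel \<Longrightarrow> f \<in> borel_measurable U01"
  unfolding U01_def by (rule measurable_restrict_space1) simp

lemma U01_measurable_cont:
  fixes f :: "real \<Rightarrow> real"
  assumes "continuous_on {0<..<1} f"
  shows "f \<in> borel_measurable U01"
proof -
  have "f \<in> borel_measurable (restrict_space borel {0<..<1})"
    by (rule borel_measurable_continuous_on_restrict[OF assms])
  moreover have "sets U01 = sets (restrict_space borel {0<..<1})"
    by (simp add: U01_def sets_restrict_space)
  ultimately show ?thesis using measurable_cong_sets by blast
qed

lemma U01_set_integrable: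
  fixes f :: "real \<Rightarrow> real"
  shows "set_integrable lborel {0<..<1} f \<longleftrightarrow> integrable U01 f"
  unfolding U01_def set_integrable_def by (subst integrable_restrict_space) auto

lemma U01_interval_integral:
  fixes f :: "real \<Rightarrow> real"
  shows "(LBINT s=0..1. f s) = (\<integral>s. f s \<partial>U01)"
proof -
  have "einterval 0 1 = {0<..<1::real}" by (auto simp: einterval_def zero_ereal_def one_ereal_def)
  thus ?thesis
    by (simp add: interval_lebesgue_integral_def set_lebesgue_integral_def U01_def integral_restrict_space)
qed

text \<open>The derivatives in question may blow up at s = 1, so only the primitive has to be
  continuous up to the endpoints. Integrability of the derivative is either supplied or extracted
  from its sign.\<close>

lemma U01_FTC:
  fixes \<psi> :: "real \<Rightarrow> real"
  assumes d: "\<And>s. 0 < s \<Longrightarrow> s < 1 \<Longrightarrow> (\<psi> has_field_derivative \<psi>' s) (at s)"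
    and c': "continuous_on {0<..<1} \<psi>'" and c: "continuous_on {0..1} \<psi>"
  shows "integrable U01 \<psi>' \<Longrightarrow> (\<integral>s. \<psi>' s \<partial>U01) = \<psi> 1 - \<psi> 0"
    and "(\<And>s. 0 < s \<Longrightarrow> s < 1 \<Longrightarrow> 0 \<le> \<psi>' s) \<Longrightarrow> integrable U01 \<psi>'"
proof -
  have ei: "einterval 0 1 = {0<..<1::real}" by (auto simp: einterval_def zero_ereal_def one_ereal_def)
  have l0: "((\<psi> \<circ> real_of_ereal) \<longlongrightarrow> \<psi> 0) (at_right 0)"
    using continuous_on_Icc_at_rightD[OF c] by (simp add: zero_ereal_def ereal_tendsto_simps)
  have l1: "((\<psi> \<circ> real_of_ereal) \<longlongrightarrow> \<psi> 1) (at_left 1)"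
    using continuous_on_Icc_at_leftD[OF c] by (simp add: one_ereal_def ereal_tendsto_simps)
  have ic: "isCont \<psi>' x" if "0 < ereal x" "ereal x < 1" for x
    using c' that by (simp add: continuous_on_eq_continuous_at zero_ereal_def one_ereal_def)
  have d': "(\<psi> has_field_derivative \<psi>' x) (at x)" if "0 < ereal x" "ereal x < 1" for x
    using d that by (simp add: zero_ereal_def one_ereal_def)
  show "(\<integral>s. \<psi>' s \<partial>U01) = \<psi> 1 - \<psi> 0" if "integrable U01 \<psi>'"
    using interval_integral_FTC_integrable[of 0 1 \<psi> \<psi>', OF _ _ ic _ l0 l1] that d'
    by (simp add: U01_interval_integral ei U01_set_integrable has_real_derivative_iff_has_vector_derivative)
  show "integrable U01 \<psi>'" if "\<And>s. 0 < s \<Longrightarrow> s < 1 \<Longrightarrow> 0 \<le> \<psi>' s"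
    using interval_integral_FTC_nonneg(1)[of 0 1 \<psi> \<psi>', OF _ d' ic _ l0 l1] that
    by (simp add: ei U01_set_integrable)
qed

lemma neg_sqrt_DERIV: "s < 1 \<Longrightarrow> ((\<lambda>s. - sqrt (1 - s)) has_field_derivative wt 1 s) (at s)"
  by (auto intro!: derivative_eq_intros simp: wt_def field_simps real_sqrt_eq_iff)

text \<open>For n = 1 the weight is 1/(2 sqrt(1-s)), whose primitive -sqrt(1-s) is bounded. Larger n
  only make the weight smaller.\<close>

lemma wt_integrable:
  assumes "n \<ge> 1" shows "integrable U01 (wt n)"
proof -
  have "continuous_on {0<..<1} (wt 1)" unfolding wt_def by (intro continuous_intros) auto
  hence 1: "integrable U01 (wt 1)"
    by (intro U01_FTC(2)[where \<psi>="\<lambda>s. - sqrt (1 - s)"] neg_sqrt_DERIV wt_nonneg continuous_intros) auto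
  show ?thesis
    by (rule Bochner_Integration.integrable_bound[OF 1 U01_measurable[OF wt_measurable]])
       (use assms wt_le wt_nonneg in \<open>auto intro!: AE_I2\<close>)
qed

section \<open>Gaussian smoothing in the first variable\<close>

lemma Ssemi_bound:
  assumes g: "CB g" and B: "\<And>x y. \<bar>g x y\<bar> \<le> B"
  shows "\<bar>Ssemi Sig g s x y\<bar> \<le> B"
proof -
  have [measurable]: "(\<lambda>x. g x y) \<in> borel_measurable borel" using g by (rule CB_measurable)
  have i: "integrable (gauss Sig) (\<lambda>u. g (sqrt (1 - s) *\<^sub>R x + sqrt s *\<^sub>R u) y)"
    by (rule GS.integrable_const_bound[where B=B]) (use B in auto)
  have "\<bar>Ssemi Sig g s x y\<bar> \<le> (\<integral>u. \<bar>g (sqrt (1 - s) *\<^sub>R x + sqrt s *\<^sub>R u) y\<bar> \<partial>gauss Sig)"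
    unfolding Ssemi_def by (rule integral_abs_bound)
  also have "\<dots> \<le> (\<integral>u. B \<partial>gauss Sig)"
    by (intro integral_mono integrable_abs i) (use B in auto)
  also have "\<dots> = B" using GS.prob_space[of Sig] by simp
  finally show ?thesis .
qed

lemma Ssemi_integrable:
  assumes g: "CB g"
  shows "integrable (gauss Sig) (\<lambda>u. g (a + c *\<^sub>R u) y)"
proof -
  obtain B where B: "\<And>x y. \<bar>g x y\<bar> \<le> B" using g by (auto simp: CB_def)
  have [measurable]: "(\<lambda>x. g x y) \<in> borel_measurable borel" using g by (rule CB_measurable)
  show ?thesis by (rule GS.integrable_const_bound[where B=B]) (use B in auto)
qed

lemma Ssemi_continuous:
  fixes g :: "real^'d::finite \<Rightarrow> 'y \<Rightarrow> real" and \<sigma> :: "'b::metric_space \<Rightarrow> real"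
  assumes g: "CB g" and c: "continuous_on A \<sigma>" "continuous_on A \<xi>"
  shows "continuous_on A (\<lambda>t. Ssemi Sig g (\<sigma> t) (\<xi> t) y)"
proof -
  obtain B where B: "\<And>x y. \<bar>g x y\<bar> \<le> B" using g by (auto simp: CB_def)
  show ?thesis unfolding Ssemi_def
    by (rule continuous_on_integral_dominated[where w="\<lambda>_. B"])
       (use B in \<open>auto intro!: CB_comp[OF g] continuous_intros c borel_measurable_integrable Ssemi_integrable[OF g]\<close>)
qed

lemma Ssemi_DERIV_x:
  assumes g: "smooth1 g"
  shows "((\<lambda>t. Ssemi Sig g s (x + t *\<^sub>R axis j 1) y) has_field_derivative
    sqrt (1 - s) * Ssemi Sig (pdx j g) s (x + t *\<^sub>R axis j 1) y) (at t)"
proof -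
  have "CB (pdx j g)" using g by (simp add: smooth1_def)
  from CB_bound[OF this] obtain B where B: "\<And>x y. \<bar>pdx j g x y\<bar> \<le> B" by blast
  let ?c = "sqrt (1 - s)"
  have cg: "CB g" using g by (simp add: smooth1_def)
  have "((\<lambda>t. Ssemi Sig g s (x + t *\<^sub>R axis j 1) y) has_field_derivative
    (\<integral>u. ?c * pdx j g (?c *\<^sub>R (x + t *\<^sub>R axis j 1) + sqrt s *\<^sub>R u) y \<partial>gauss Sig)) (at t)"
    unfolding Ssemi_def
  proof (rule leibniz_lebesgue(2)[where a="t-1" and b="t+1" and w="\<lambda>_. \<bar>?c\<bar> * B"])
    show "((\<lambda>t. g (?c *\<^sub>R (x + t *\<^sub>R axis j 1) + sqrt s *\<^sub>R u) y) has_field_derivative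
       ?c * pdx j g (?c *\<^sub>R (x + t *\<^sub>R axis j 1) + sqrt s *\<^sub>R u) y) (at t)" for t u
    proof -
      have j: "xdiffble j (\<lambda>x. g x y)" using g by (simp add: smooth1_def)
      have c: "((\<lambda>t. ?c * t) has_field_derivative ?c) (at t)" using DERIV_cmult_Id by blast
      have "((\<lambda>t. g ((?c *\<^sub>R x + sqrt s *\<^sub>R u) + (?c * t) *\<^sub>R axis j 1) y) has_field_derivative
         xpartial j (\<lambda>x. g x y) ((?c *\<^sub>R x + sqrt s *\<^sub>R u) + (?c * t) *\<^sub>R axis j 1) * ?c) (at t)"
        by (rule DERIV_chain2[OF xpartial_DERIV[OF j] c])
      moreover have "?c *\<^sub>R (x + t *\<^sub>R axis j 1) + sqrt s *\<^sub>R u = (?c *\<^sub>R x + sqrt s *\<^sub>R u) + (?c * t) *\<^sub>R axis j 1" for t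
        by (simp add: scaleR_add_right)
      ultimately show ?thesis by (simp only: pdx_def mult.commute[of ?c])
    qed
    show "\<bar>?c * pdx j g (?c *\<^sub>R (x + t *\<^sub>R axis j 1) + sqrt s *\<^sub>R u) y\<bar> \<le> \<bar>?c\<bar> * B" for t u
      unfolding abs_mult by (intro mult_left_mono B) auto
  qed (auto intro!: Ssemi_integrable[OF cg])
  thus ?thesis by (simp add: Ssemi_def)
qed

lemma Ssemi_ydiff:
  assumes g: "CB g"
  shows "Ssemi Sig g s x (upd1 k y) - Ssemi Sig g s x y = Ssemi Sig (ydiff k g) s x y"
  unfolding Ssemi_def ydiff_upd1
  by (subst Bochner_Integration.integral_diff[symmetric]) (auto intro!: Ssemi_integrable[OF g])

lemma sqrt_one_minus_DERIV: assumes "0 < s" "s < 1" shows "((\<lambda>s. sqrt (1 - s)) has_field_derivative - (1 / (2 * sqrt (1 - s)))) (at s)"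
  by (rule DERIV_cong[OF DERIV_chain2[OF DERIV_real_sqrt DERIV_diff[OF DERIV_const DERIV_ident]]]) (use assms in \<open>auto simp: field_simps\<close>)
lemma sqrt_DERIV: assumes "0 < s" shows "(sqrt has_field_derivative 1 / (2 * sqrt s)) (at s)"
  by (rule DERIV_cong[OF DERIV_real_sqrt[OF assms]]) (simp add: field_simps)
lemma ou_path_has_derivative: fixes x u :: "real^'d::finite"
 assumes "0 < s" "s < 1" shows "((\<lambda>s. sqrt (1 - s) *\<^sub>R x + sqrt s *\<^sub>R u) has_derivative (\<lambda>t. t *\<^sub>R (- (1 / (2 * sqrt (1 - s))) *\<^sub>R x + (1 / (2 * sqrt s)) *\<^sub>R u))) (at s)"
proof -
 have "((\<lambda>s. sqrt (1 - s) *\<^sub>R x + sqrt s *\<^sub>R u) has_derivative (\<lambda>t. (- (1 / (2 * sqrt (1 - s))) * t) *\<^sub>R x + ((1 / (2 * sqrt s)) * t) *\<^sub>R u)) (at s)"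
  by (intro has_derivative_add has_derivative_scaleR_left sqrt_one_minus_DERIV[unfolded has_field_derivative_def] sqrt_DERIV[unfolded has_field_derivative_def] assms)
 thus ?thesis by (simp only: scaleR_add_right scaleR_scaleR mult.commute)
qed

definition smooth2 :: "(real^'d::finite \<Rightarrow> 'y \<Rightarrow> real) \<Rightarrow> bool" where
  "smooth2 h \<longleftrightarrow> smooth1 h \<and> (\<forall>j. smooth1 (pdx j h))"

text \<open>Differentiating the path sqrt(1-s) x + sqrt(s) u gives a drift in x and a term linear in
  u. Gaussian integration by parts turns the latter into second derivatives.\<close>

lemma Ssemi_DERIV_s:
  fixes h :: "real^'d::finite \<Rightarrow> 'y \<Rightarrow> real"
  assumes fac: "gauss_factorable Sig" and h: "smooth2 h" and s0: "0 < s0" "s0 < 1"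
  shows "((\<lambda>s. Ssemi Sig h s x y) has_field_derivative
     - (\<Sum>j\<in>UNIV. x $ j * Ssemi Sig (pdx j h) s0 x y) / (2 * sqrt (1 - s0))
     + (\<Sum>j\<in>UNIV. \<Sum>k\<in>UNIV. Sig $ j $ k * Ssemi Sig (pdx k (pdx j h)) s0 x y) / 2) (at s0)"
proof -
  \<comment> \<open>On a subinterval [a, b] inside (0, 1) the factors 1/sqrt(s) and 1/sqrt(1-s) of
    the path derivative are bounded, which yields a majorant linear in |u|.\<close>
  obtain a where a: "0 < a" "a < s0" using dense[OF s0(1)] by blast
  obtain b where b: "s0 < b" "b < 1" using dense[OF s0(2)] by blast
  have h1: "smooth1 h" "CB h" "\<And>j. CB (pdx j h)" "\<And>j. smooth1 (pdx j h)" "\<And>j k. CB (pdx k (pdx j h))"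
    using h by (auto simp: smooth2_def smooth1_def)
  have "\<forall>j. \<exists>B. 0 \<le> B \<and> (\<forall>x y. \<bar>pdx j h x y\<bar> \<le> B)" using CB_bound[OF h1(3)] by blast
  from choice[OF this] obtain B where "\<forall>j. 0 \<le> B j \<and> (\<forall>x y. \<bar>pdx j h x y\<bar> \<le> B j)" by blast
  hence B: "\<And>j. 0 \<le> B j" "\<And>j x y. \<bar>pdx j h x y\<bar> \<le> B j" by simp_all
  let ?p = "\<lambda>s u. sqrt (1 - s) *\<^sub>R x + sqrt s *\<^sub>R u"
  let ?r = "\<lambda>s u. - (1 / (2 * sqrt (1 - s))) *\<^sub>R x + (1 / (2 * sqrt s)) *\<^sub>R u"
  have "((\<lambda>s. Ssemi Sig h s x y) has_field_derivative
      (\<integral>u. (\<Sum>j\<in>UNIV. ?r s0 u $ j * pdx j h (?p s0 u) y) \<partial>gauss Sig)) (at s0)"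
    unfolding Ssemi_def
  proof (rule leibniz_lebesgue(2)[of a s0 b "gauss Sig" "\<lambda>s u. h (?p s u) y"
        "\<lambda>s u. \<Sum>j\<in>UNIV. ?r s u $ j * pdx j h (?p s u) y"
        "\<lambda>u. \<Sum>j\<in>UNIV. (1 / (2 * sqrt (1 - b)) * \<bar>x $ j\<bar> + 1 / (2 * sqrt a) * \<bar>u $ j\<bar>) * B j"])
    fix s u assume s: "a < s" "s < b"
    have d: "((\<lambda>s. ?p s u) has_derivative (\<lambda>t. t *\<^sub>R ?r s u)) (at s)"
      by (rule ou_path_has_derivative) (use s a b in auto)
    have "((\<lambda>s. h (?p s u) y) has_derivative (\<lambda>t. \<Sum>j\<in>UNIV. (t *\<^sub>R ?r s u) $ j * xpartial j (\<lambda>x. h x y) (?p s u))) (at s)"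
      using has_derivative_compose[OF d C1x_has_derivative[OF smooth1_C1x[OF h1(1), of y]]] .
    thus "((\<lambda>s. h (?p s u) y) has_real_derivative (\<Sum>j\<in>UNIV. ?r s u $ j * pdx j h (?p s u) y)) (at s)"
      unfolding has_field_derivative_def pdx_def
      by (rule has_derivative_eq_rhs)
         (rule ext, simp only: vector_scaleR_component real_scaleR_def mult.assoc sum_distrib_left[symmetric], rule mult.commute)
    show "\<bar>\<Sum>j\<in>UNIV. ?r s u $ j * pdx j h (?p s u) y\<bar>
       \<le> (\<Sum>j\<in>UNIV. (1 / (2 * sqrt (1 - b)) * \<bar>x $ j\<bar> + 1 / (2 * sqrt a) * \<bar>u $ j\<bar>) * B j)"
    proof (rule order_trans[OF sum_abs sum_mono])
      fix j
      have 1: "1 / (2 * sqrt (1 - s)) * \<bar>x $ j\<bar> \<le> 1 / (2 * sqrt (1 - b)) * \<bar>x $ j\<bar>"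
        using s a b by (intro mult_right_mono) (auto intro!: divide_left_mono)
      have 2: "1 / (2 * sqrt s) * \<bar>u $ j\<bar> \<le> 1 / (2 * sqrt a) * \<bar>u $ j\<bar>"
        using s a b by (intro mult_right_mono) (auto intro!: divide_left_mono)
      have "?r s u $ j = - (1 / (2 * sqrt (1 - s)) * (x $ j)) + 1 / (2 * sqrt s) * (u $ j)" by simp
      hence "\<bar>?r s u $ j\<bar> \<le> \<bar>1 / (2 * sqrt (1 - s)) * (x $ j)\<bar> + \<bar>1 / (2 * sqrt s) * (u $ j)\<bar>"
        by linarith
      also have "\<dots> = 1 / (2 * sqrt (1 - s)) * \<bar>x $ j\<bar> + 1 / (2 * sqrt s) * \<bar>u $ j\<bar>"
        using s a b by (simp add: abs_mult)
      also have "\<dots> \<le> 1 / (2 * sqrt (1 - b)) * \<bar>x $ j\<bar> + 1 / (2 * sqrt a) * \<bar>u $ j\<bar>" using 1 2 by linarith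
      finally show "\<bar>?r s u $ j * pdx j h (?p s u) y\<bar> \<le> (1 / (2 * sqrt (1 - b)) * \<bar>x $ j\<bar> + 1 / (2 * sqrt a) * \<bar>u $ j\<bar>) * B j"
        unfolding abs_mult using B(2)[of j "?p s u" y] by (intro mult_mono) auto
    qed
  next
    show "integrable (gauss Sig) (\<lambda>u. \<Sum>j\<in>UNIV. (1 / (2 * sqrt (1 - b)) * \<bar>x $ j\<bar> + 1 / (2 * sqrt a) * \<bar>u $ j\<bar>) * B j)"
      by (intro Bochner_Integration.integrable_sum integrable_mult_left Bochner_Integration.integrable_add
            integrable_mult_right integrable_abs gauss_coord_integrable) simp
  qed (use a b in \<open>auto intro!: Ssemi_integrable[OF h1(2)]\<close>)
  also have "(\<integral>u. (\<Sum>j\<in>UNIV. ?r s0 u $ j * pdx j h (?p s0 u) y) \<partial>gauss Sig) =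
     - (\<Sum>j\<in>UNIV. x $ j * Ssemi Sig (pdx j h) s0 x y) / (2 * sqrt (1 - s0))
     + (\<Sum>j\<in>UNIV. \<Sum>k\<in>UNIV. Sig $ j $ k * Ssemi Sig (pdx k (pdx j h)) s0 x y) / 2"
  proof -
    have i1: "integrable (gauss Sig) (\<lambda>u. pdx j h (?p s0 u) y)" for j
      by (rule Ssemi_integrable[OF h1(3)])
    have i2: "integrable (gauss Sig) (\<lambda>u. u $ j * pdx j h (?p s0 u) y)" for j
    proof (rule Bochner_Integration.integrable_bound)
      show "integrable (gauss Sig) (\<lambda>u. B j * u $ j)" by (intro integrable_mult_right gauss_coord_integrable)
      show "(\<lambda>u. u $ j * pdx j h (?p s0 u) y) \<in> borel_measurable (gauss Sig)"
        by (intro borel_measurable_times borel_measurable_integrable[OF i1]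
              borel_measurable_integrable[OF gauss_coord_integrable])
      show "AE u in gauss Sig. norm (u $ j * pdx j h (?p s0 u) y) \<le> norm (B j * u $ j)"
        using B by (intro AE_I2) (auto simp: abs_mult mult.commute[of "B j"] intro!: mult_left_mono)
    qed
    \<comment> \<open>The inner scaling of u contributes sqrt(s0), which later cancels the factor
      1/sqrt(s0) of the path derivative.\<close>
    have ibp: "(\<integral>u. u $ j * pdx j h (?p s0 u) y \<partial>gauss Sig)
        = sqrt s0 * (\<Sum>k\<in>UNIV. Sig $ j $ k * Ssemi Sig (pdx k (pdx j h)) s0 x y)" for j
    proof -
      note C = smooth1_C1x[OF h1(4), of j y]
      have "\<forall>k. \<exists>B. 0 \<le> B \<and> (\<forall>x y. \<bar>pdx k (pdx j h) x y\<bar> \<le> B)" using CB_bound[OF h1(5)] by blast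
      from choice[OF this] obtain B2 where "\<forall>k. 0 \<le> B2 k \<and> (\<forall>x y. \<bar>pdx k (pdx j h) x y\<bar> \<le> B2 k)" by blast
      hence B2: "\<And>k. 0 \<le> B2 k" "\<And>k x y. \<bar>pdx k (pdx j h) x y\<bar> \<le> B2 k" by simp_all
      have xp: "xpartial k (\<lambda>x. pdx j h x y) z = pdx k (pdx j h) z y" for k z by (simp add: pdx_def)
      have "(\<integral>u. u $ j * pdx j h (?p s0 u) y \<partial>gauss Sig) =
        (\<Sum>k\<in>UNIV. Sig $ j $ k * (\<integral>u. xpartial k (\<lambda>u. pdx j h (?p s0 u) y) u \<partial>gauss Sig))"
      proof (rule gauss_ibp[OF fac C1x_affine(1)[OF C], where B="B j" and B'="sqrt s0 * (\<Sum>k\<in>UNIV. B2 k)"])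
        show "\<bar>xpartial k (\<lambda>u. pdx j h (?p s0 u) y) u\<bar> \<le> sqrt s0 * (\<Sum>k\<in>UNIV. B2 k)" for k u
        proof -
          have "B2 k \<le> (\<Sum>k\<in>UNIV. B2 k)" using B2(1) by (intro member_le_sum) auto
          hence "\<bar>pdx k (pdx j h) z y\<bar> \<le> (\<Sum>k\<in>UNIV. B2 k)" for z using B2(2)[of k z y] by linarith
          thus ?thesis unfolding C1x_affine(2)[OF C] abs_mult xp using s0 by (intro mult_mono) auto
        qed
      qed (rule B)
      also have "\<dots> = sqrt s0 * (\<Sum>k\<in>UNIV. Sig $ j $ k * Ssemi Sig (pdx k (pdx j h)) s0 x y)"
        unfolding C1x_affine(2)[OF C] xp by (simp add: Ssemi_def sum_distrib_left ac_simps)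
      finally show ?thesis .
    qed
    have "(\<integral>u. (\<Sum>j\<in>UNIV. ?r s0 u $ j * pdx j h (?p s0 u) y) \<partial>gauss Sig)
       = (\<integral>u. (\<Sum>j\<in>UNIV. (- x $ j / (2 * sqrt (1 - s0))) * pdx j h (?p s0 u) y
            + 1 / (2 * sqrt s0) * (u $ j * pdx j h (?p s0 u) y)) \<partial>gauss Sig)"
      by (intro Bochner_Integration.integral_cong refl sum.cong) (simp add: algebra_simps)
    also have "\<dots> = (\<Sum>j\<in>UNIV. (- x $ j / (2 * sqrt (1 - s0))) * Ssemi Sig (pdx j h) s0 x y
            + 1 / (2 * sqrt s0) * (\<integral>u. u $ j * pdx j h (?p s0 u) y \<partial>gauss Sig))"
      using i1 i2 by (simp add: Ssemi_def)
    also have "\<dots> = (\<Sum>j\<in>UNIV. (- x $ j / (2 * sqrt (1 - s0))) * Ssemi Sig (pdx j h) s0 x y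
            + (\<Sum>k\<in>UNIV. Sig $ j $ k * Ssemi Sig (pdx k (pdx j h)) s0 x y) / 2)"
      unfolding ibp using s0 by simp
    also have "\<dots> = - (\<Sum>j\<in>UNIV. x $ j * Ssemi Sig (pdx j h) s0 x y) / (2 * sqrt (1 - s0))
     + (\<Sum>j\<in>UNIV. \<Sum>k\<in>UNIV. Sig $ j $ k * Ssemi Sig (pdx k (pdx j h)) s0 x y) / 2"
      by (simp add: sum.distrib sum_divide_distrib sum_negf sum_subtractf)
    finally show ?thesis .
  qed
  finally show ?thesis .
qed

section \<open>The Stein equation\<close>

definition Tk :: "real^'d^'d \<Rightarrow> ('r::finite \<Rightarrow> real) \<Rightarrow> (real^'d::finite \<Rightarrow> ('r \<Rightarrow> nat) \<Rightarrow> real)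
     \<Rightarrow> real \<Rightarrow> real^'d \<Rightarrow> ('r \<Rightarrow> nat) \<Rightarrow> real" where
  "Tk Sig lam g s x y = Kop lam s y (Ssemi Sig g s x)"

text \<open>A family closed under derivatives and differences. The solution f has n = 0 and c = E
  h(Z,N); after one differentiation or difference c is 0 and the weight is integrable by
  itself.\<close>

definition Fsol :: "real^'d^'d \<Rightarrow> ('r::finite \<Rightarrow> real) \<Rightarrow> nat \<Rightarrow> real \<Rightarrow> (real^'d::finite \<Rightarrow> ('r \<Rightarrow> nat) \<Rightarrow> real)
     \<Rightarrow> real^'d \<Rightarrow> ('r \<Rightarrow> nat) \<Rightarrow> real" where
  "Fsol Sig lam n c g x y = - (\<integral>s. wt n s * (Tk Sig lam g s x y - c) \<partial>U01)"

context
  fixes Sig :: "real^'d::finite^'d" and lam :: "'r::finite \<Rightarrow> real"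
  assumes fac: "gauss_factorable Sig" and lam: "\<forall>k. 0 < lam k"
begin

private abbreviation "T \<equiv> Tk Sig lam"
private abbreviation "F \<equiv> Fsol Sig lam"
private abbreviation "S \<equiv> Ssemi Sig"
private abbreviation "K \<equiv> Kop lam"

section \<open>The joint semigroup and its time integrals\<close>

lemma Tk_bound:
  assumes s: "0 \<le> s" "s \<le> 1" and g: "CB g" and B: "\<And>x y. \<bar>g x y\<bar> \<le> B"
  shows "\<bar>T g s x y\<bar> \<le> B"
  unfolding Tk_def by (rule Kop_bound[OF lam s Ssemi_bound[OF g B]])

lemma Tk_continuous:
  fixes \<sigma> :: "'b::metric_space \<Rightarrow> real"
  assumes g: "CB g" and c: "continuous_on A \<sigma>" "\<And>t. t \<in> A \<Longrightarrow> 0 \<le> \<sigma> t \<and> \<sigma> t \<le> 1" "continuous_on A \<xi>"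
  shows "continuous_on A (\<lambda>t. T g (\<sigma> t) (\<xi> t) y)"
proof -
  obtain B where B: "\<And>x y. \<bar>g x y\<bar> \<le> B" using g by (auto simp: CB_def)
  show ?thesis unfolding Tk_def
    by (rule Kop_continuous[OF lam c(1,2), where B=B]) (rule Ssemi_continuous[OF g c(1,3)] Ssemi_bound[OF g B] | assumption)+
qed

lemma Tk_measurable:
  assumes g: "CB g"
  shows "(\<lambda>s. T g s x y) \<in> borel_measurable U01"
  by (rule U01_measurable_cont, rule Tk_continuous[OF g]) (auto intro!: continuous_intros)

lemma Tsemi_eq_Tk:
  assumes s: "0 \<le> s" "s \<le> 1" and g: "CB g"
  shows "Tsemi Sig lam g s x y = T g s x y"
proof -
  obtain B where B: "\<And>x y. \<bar>g x y\<bar> \<le> B" using g by (auto simp: CB_def)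
  have i: "Infinite_Set_Sum.abs_summable_on (\<lambda>z. S g s x z * pker lam s y z) UNIV"
    unfolding Infinite_Set_Sum.abs_summable_on_def
    by (rule pker_integrable[OF s lam0[OF lam] Ssemi_bound[OF g B]])
  show ?thesis
    unfolding Tsemi_def infsetsum_infsum[OF i, symmetric] by (simp add: Tk_def Kop_def infsetsum_def)
qed

lemma Tk_0: "T g 0 x y = g x y"
  using GS.prob_space[of Sig] by (simp add: Tk_def Kop_0[OF lam] Ssemi_def)

text \<open>At s = 1 the point x enters with factor 0 and the kernel has forgotten y, so the value
  is the same for every start. Fubini joins the two averages into one over the product law.\<close>

lemma Tk_1:
  assumes g: "CB g"
  shows "T g 1 x y = EhZN Sig lam g"
proof -
  obtain B where B: "\<And>x y. \<bar>g x y\<bar> \<le> B" using g by (auto simp: CB_def)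
  interpret Pois: prob_space "poissons lam" unfolding poissons_def by (rule prob_space_measure_pmf)
  interpret pair_prob_space "gauss Sig" "poissons lam" ..
  have [measurable]: "(\<lambda>p. g (fst p) z) \<in> borel_measurable (gauss Sig \<Otimes>\<^sub>M poissons lam)" for z
    by (rule measurable_compose[OF measurable_fst], subst measurable_cong_sets[OF sets_gauss refl])
       (rule CB_measurable[OF g])
  have sp: "sets (poissons lam) = sets (count_space UNIV)" by (simp add: poissons_def)
  have "snd \<in> measurable (gauss Sig \<Otimes>\<^sub>M poissons lam) (count_space UNIV)"
    using measurable_snd measurable_cong_sets[OF refl sp] by blast
  hence m: "(\<lambda>p. g (fst p) (snd p)) \<in> borel_measurable (gauss Sig \<Otimes>\<^sub>M poissons lam)"
    by (intro measurable_compose_countable[of "\<lambda>z p. g (fst p) z" _ _ snd]) auto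
  have i: "integrable (gauss Sig \<Otimes>\<^sub>M poissons lam) (\<lambda>p. g (fst p) (snd p))"
    by (rule integrable_const_bound[where B=B]) (use B m in auto)
  have "EhZN Sig lam g = (\<integral>z. (\<integral>u. g u z \<partial>gauss Sig) \<partial>poissons lam)"
    unfolding EhZN_def using integral_snd[of "\<lambda>u z. g u z"] i by (simp add: case_prod_unfold)
  thus ?thesis by (simp add: Tk_def Kop_1[OF lam] Ssemi_def)
qed

lemma Kop_Ssemi_sum:
  fixes c :: "'i \<Rightarrow> real"
  assumes s: "0 \<le> s" "s \<le> 1" and g: "\<And>i. CB (g i)"
  shows "K s y (\<lambda>z. \<Sum>i\<in>A. c i * S (g i) s x z) = (\<Sum>i\<in>A. c i * T (g i) s x y)"
    and "\<exists>C. \<forall>z. \<bar>\<Sum>i\<in>A. c i * S (g i) s x z\<bar> \<le> C"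
proof -
  have "\<forall>i. \<exists>B. \<forall>x y. \<bar>g i x y\<bar> \<le> B" using CB_bound[OF g] by blast
  from choice[OF this] obtain B where B: "\<And>i x y. \<bar>g i x y\<bar> \<le> B i" by blast
  have b: "\<bar>c i * S (g i) s x z\<bar> \<le> \<bar>c i\<bar> * B i" for i z
    unfolding abs_mult by (intro mult_left_mono Ssemi_bound[OF g] B) simp
  have "K s y (\<lambda>z. \<Sum>i\<in>A. (\<lambda>i z. c i * S (g i) s x z) i z)
      = (\<Sum>i\<in>A. K s y ((\<lambda>i z. c i * S (g i) s x z) i))"
    by (rule Kop_sum[OF lam s, where B="\<lambda>i. \<bar>c i\<bar> * B i"]) (rule b)
  thus "K s y (\<lambda>z. \<Sum>i\<in>A. c i * S (g i) s x z) = (\<Sum>i\<in>A. c i * T (g i) s x y)"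
    by (simp add: Kop_cmult[OF lam] Tk_def)
  show "\<exists>C. \<forall>z. \<bar>\<Sum>i\<in>A. c i * S (g i) s x z\<bar> \<le> C"
  proof (intro exI allI)
    fix z show "\<bar>\<Sum>i\<in>A. c i * S (g i) s x z\<bar> \<le> (\<Sum>i\<in>A. \<bar>c i\<bar> * B i)"
      by (rule order_trans[OF sum_abs sum_mono]) (rule b)
  qed
qed

lemma Tk_DERIV_x:
  assumes s: "0 \<le> s" "s \<le> 1" and g: "smooth1 g"
  shows "((\<lambda>t. T g s (x + t *\<^sub>R axis j 1) y) has_field_derivative
     sqrt (1 - s) * T (pdx j g) s (x + t *\<^sub>R axis j 1) y) (at t)"
proof -
  have cg: "CB g" "CB (pdx j g)" using g by (auto simp: smooth1_def)
  obtain B where B: "\<And>x y. \<bar>g x y\<bar> \<le> B" using CB_bound[OF cg(1)] by blast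
  obtain B' where B': "\<And>x y. \<bar>pdx j g x y\<bar> \<le> B'" using CB_bound[OF cg(2)] by blast
  have B0: "0 \<le> B'" using B'[of 0 undefined] by linarith
  have "((\<lambda>t. T g s (x + t *\<^sub>R axis j 1) y) has_field_derivative
     (\<integral>z. sqrt (1 - s) * S (pdx j g) s (x + t *\<^sub>R axis j 1) z * pker lam s y z \<partial>count_space UNIV)) (at t)"
    unfolding Tk_def Kop_def
  proof (rule leibniz_lebesgue(2)[of "t-1" t "t+1" "count_space UNIV"
      "\<lambda>t z. S g s (x + t *\<^sub>R axis j 1) z * pker lam s y z"
      "\<lambda>t z. sqrt (1 - s) * S (pdx j g) s (x + t *\<^sub>R axis j 1) z * pker lam s y z"
      "\<lambda>z. B' * pdom lam y z"])
    show "integrable (count_space UNIV) (\<lambda>z. S g s (x + t *\<^sub>R axis j 1) z * pker lam s y z)" for t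
      by (rule pker_integrable[OF s lam0[OF lam] Ssemi_bound[OF cg(1) B]])
    show "integrable (count_space UNIV) (\<lambda>z. B' * pdom lam y z)"
      by (intro integrable_mult_right pdom_integrable lam0[OF lam])
    show "\<bar>sqrt (1 - s) * S (pdx j g) s (x + t *\<^sub>R axis j 1) z * pker lam s y z\<bar> \<le> B' * pdom lam y z" for t z
    proof -
      have "\<bar>sqrt (1 - s)\<bar> * \<bar>S (pdx j g) s (x + t *\<^sub>R axis j 1) z\<bar> \<le> 1 * B'"
        using s B0 Ssemi_bound[OF cg(2) B'] by (intro mult_mono) auto
      thus ?thesis unfolding abs_mult using pker_pdom[OF s lam0[OF lam], of y z] B0
        by (intro mult_mono) auto
    qed
    show "((\<lambda>t. S g s (x + t *\<^sub>R axis j 1) z * pker lam s y z) has_real_derivative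
        sqrt (1 - s) * S (pdx j g) s (x + t *\<^sub>R axis j 1) z * pker lam s y z) (at t)" for t z
      by (rule DERIV_cmult_right[OF Ssemi_DERIV_x[OF g]])
  qed auto
  thus ?thesis by (simp add: Tk_def Kop_def mult.assoc)
qed

lemma Tk_ydiff:
  assumes s: "0 \<le> s" "s \<le> 1" and g: "CB g"
  shows "T g s x (upd1 k y) - T g s x y = (1 - s) * T (ydiff k g) s x y"
proof -
  obtain B where B: "\<And>x y. \<bar>g x y\<bar> \<le> B" using CB_bound[OF g] by blast
  show ?thesis
    unfolding Tk_def Kop_ydiff[OF lam s Ssemi_bound[OF g B]] Ssemi_ydiff[OF g] ..
qed

lemma wt_Tk_bound:
  assumes s: "s \<in> space U01" and g: "CB g" and B: "\<And>x y. \<bar>g x y\<bar> \<le> B"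
  shows "\<bar>wt n s * T g s x y\<bar> \<le> B * wt n s"
proof -
  have s': "0 \<le> s" "s \<le> 1" "s < 1" using s by auto
  show ?thesis
    using Tk_bound[OF s'(1,2) g B, of x y] wt_nonneg[OF s'(3), of n]
    by (simp add: abs_mult mult.commute[of B] mult_left_mono)
qed

lemma wt_Tk_integrable:
  assumes n: "n \<ge> 1" and g: "CB g"
  shows "integrable U01 (\<lambda>s. wt n s * T g s x y)"
proof -
  obtain B where B: "\<And>x y. \<bar>g x y\<bar> \<le> B" using CB_bound[OF g] by blast
  show ?thesis
  proof (rule Bochner_Integration.integrable_bound)
    show "integrable U01 (\<lambda>s. B * wt n s)" by (intro integrable_mult_right wt_integrable n)
    show "(\<lambda>s. wt n s * T g s x y) \<in> borel_measurable U01"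
      by (intro borel_measurable_times U01_measurable[OF wt_measurable] Tk_measurable g)
    show "AE s in U01. norm (wt n s * T g s x y) \<le> norm (B * wt n s)"
      using order_trans[OF wt_Tk_bound[OF _ g B] abs_ge_self] by (intro AE_I2) simp
  qed
qed

lemma Fsol_bound:
  assumes n: "n \<ge> 1" and g: "CB g" and B: "\<And>x y. \<bar>g x y\<bar> \<le> B"
  shows "\<bar>F n 0 g x y\<bar> \<le> (\<integral>s. B * wt n s \<partial>U01)"
proof -
  have "\<bar>F n 0 g x y\<bar> \<le> (\<integral>s. \<bar>wt n s * T g s x y\<bar> \<partial>U01)"
    unfolding Fsol_def abs_minus_cancel diff_0_right by (rule integral_abs_bound)
  also have "\<dots> \<le> (\<integral>s. B * wt n s \<partial>U01)"
    by (intro integral_mono integrable_abs wt_Tk_integrable n g integrable_mult_right wt_integrable wt_Tk_bound B)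
  finally show ?thesis .
qed

lemma CB_Fsol:
  assumes n: "n \<ge> 1" and g: "CB g"
  shows "CB (F n 0 g)"
proof -
  obtain B where B: "\<And>x y. \<bar>g x y\<bar> \<le> B" using CB_bound[OF g] by blast
  have "continuous_on UNIV (\<lambda>x. F n 0 g x y)" for y
    unfolding Fsol_def diff_0_right
  proof (intro continuous_on_minus continuous_on_integral_dominated[where w="\<lambda>s. B * wt n s"])
    show "continuous_on UNIV (\<lambda>x. wt n s * T g s x y)" if "s \<in> space U01" for s
      using that by (intro continuous_on_mult_left Tk_continuous[OF g]) (auto intro!: continuous_intros)
    show "(\<lambda>s. wt n s * T g s x y) \<in> borel_measurable U01" for x
      by (rule borel_measurable_integrable[OF wt_Tk_integrable[OF n g]])
    show "integrable U01 (\<lambda>s. B * wt n s)" by (intro integrable_mult_right wt_integrable n)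
  qed (rule wt_Tk_bound[OF _ g B])
  thus ?thesis using Fsol_bound[OF n g B] unfolding CB_def by blast
qed

text \<open>The constant c differentiates away and the chain rule adds sqrt(1-s) to the weight.
  Integrability is assumed only before differentiation, since the weight \<open>wt (Suc n)\<close>
  of the derivative is always integrable.\<close>

lemma Fsol_pdx:
  assumes i: "\<And>x y. integrable U01 (\<lambda>s. wt n s * (T g s x y - c))" and g: "smooth1 g"
  shows "xdiffble j (\<lambda>x. F n c g x y)" "pdx j (F n c g) = F (Suc n) 0 (pdx j g)"
proof -
  have cg: "CB g" "CB (pdx j g)" using g by (auto simp: smooth1_def)
  obtain B where B: "\<And>x y. \<bar>pdx j g x y\<bar> \<le> B" using CB_bound[OF cg(2)] by blast
  have d: "((\<lambda>t. F n c g (x + t *\<^sub>R axis j 1) y) has_field_derivative F (Suc n) 0 (pdx j g) x y) (at 0)" for x y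
  proof -
    have "((\<lambda>t. \<integral>s. wt n s * (T g s (x + t *\<^sub>R axis j 1) y - c) \<partial>U01) has_field_derivative
      (\<integral>s. wt (Suc n) s * T (pdx j g) s (x + 0 *\<^sub>R axis j 1) y \<partial>U01)) (at 0)"
    proof (rule leibniz_lebesgue(2)[of "-1" 0 1 U01 "\<lambda>t s. wt n s * (T g s (x + t *\<^sub>R axis j 1) y - c)"
        "\<lambda>t s. wt (Suc n) s * T (pdx j g) s (x + t *\<^sub>R axis j 1) y" "\<lambda>s. B * wt (Suc n) s"])
      fix t s :: real assume "s \<in> space U01"
      hence s: "0 \<le> s" "s \<le> 1" "s < 1" by auto
      have "((\<lambda>t. wt n s * (T g s (x + t *\<^sub>R axis j 1) y - c)) has_real_derivative
         wt n s * (sqrt (1 - s) * T (pdx j g) s (x + t *\<^sub>R axis j 1) y - 0)) (at t)"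
        by (intro DERIV_cmult DERIV_diff Tk_DERIV_x[OF s(1,2) g] DERIV_const)
      thus "((\<lambda>t. wt n s * (T g s (x + t *\<^sub>R axis j 1) y - c)) has_real_derivative
         wt (Suc n) s * T (pdx j g) s (x + t *\<^sub>R axis j 1) y) (at t)"
        by (simp only: wt_Suc diff_0_right mult.assoc mult.left_commute[of "sqrt (1 - s)"])
      show "\<bar>wt (Suc n) s * T (pdx j g) s (x + t *\<^sub>R axis j 1) y\<bar> \<le> B * wt (Suc n) s"
        using \<open>s \<in> space U01\<close> by (rule wt_Tk_bound[OF _ cg(2) B])
    qed (auto intro!: i integrable_mult_right wt_integrable)
    from DERIV_minus[OF this] show ?thesis by (simp add: Fsol_def)
  qed
  show "xdiffble j (\<lambda>x. F n c g x y)"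
    by (rule xpartialI(1)[OF d])
  show "pdx j (F n c g) = F (Suc n) 0 (pdx j g)"
  proof (intro ext)
    fix x y show "pdx j (F n c g) x y = F (Suc n) 0 (pdx j g) x y"
      unfolding pdx_def[of j "F n c g"] by (rule fun_cong[OF xpartialI(2)[OF d]])
  qed
qed

text \<open>The constant c cancels in the difference, and the survival probability 1-s amounts to
  two factors sqrt(1-s).\<close>

lemma Fsol_ydiff:
  assumes i: "\<And>x y. integrable U01 (\<lambda>s. wt n s * (T g s x y - c))" and g: "CB g"
  shows "ydiff k (F n c g) = F (Suc (Suc n)) 0 (ydiff k g)"
proof (intro ext)
  fix x y
  have "ydiff k (F n c g) x y =
     - (\<integral>s. wt n s * (T g s x (upd1 k y) - c) - wt n s * (T g s x y - c) \<partial>U01)"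
    unfolding ydiff_upd1 Fsol_def by (subst Bochner_Integration.integral_diff) (auto intro!: i)
  also have "(\<integral>s. wt n s * (T g s x (upd1 k y) - c) - wt n s * (T g s x y - c) \<partial>U01)
      = (\<integral>s. wt (Suc (Suc n)) s * (T (ydiff k g) s x y - 0) \<partial>U01)"
  proof (rule Bochner_Integration.integral_cong[OF refl])
    fix s assume "s \<in> space U01"
    hence s: "0 \<le> s" "s \<le> 1" "s < 1" by auto
    have "wt n s * (T g s x (upd1 k y) - c) - wt n s * (T g s x y - c)
      = wt n s * (T g s x (upd1 k y) - T g s x y)" by (simp add: algebra_simps)
    also have "\<dots> = wt (Suc (Suc n)) s * (T (ydiff k g) s x y - 0)"
      unfolding Tk_ydiff[OF s(1,2) g] wt_Suc_Suc[OF s(3)] by simp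
    finally show "wt n s * (T g s x (upd1 k y) - c) - wt n s * (T g s x y - c)
      = wt (Suc (Suc n)) s * (T (ydiff k g) s x y - 0)" .
  qed
  finally show "ydiff k (F n c g) x y = F (Suc (Suc n)) 0 (ydiff k g) x y"
    unfolding Fsol_def[of Sig lam "Suc (Suc n)"] .
qed

text \<open>The Stein operator applied to \<open>T h s\<close>, times 1/(2(1-s)), after each
  derivative and difference has been moved onto h. With the powers of 1-s absorbed into the weights,
  integrating over s gives derivatives of f term by term.\<close>

definition Tk' :: "(real^'d::finite \<Rightarrow> ('r \<Rightarrow> nat) \<Rightarrow> real) \<Rightarrow> real^'d \<Rightarrow> ('r \<Rightarrow> nat) \<Rightarrow> real \<Rightarrow> real" where
  "Tk' h x y s = (\<Sum>j\<in>UNIV. \<Sum>k\<in>UNIV. Sig $ j $ k * (wt 2 s * T (pdx k (pdx j h)) s x y))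
     - (\<Sum>j\<in>UNIV. x $ j * (wt 1 s * T (pdx j h) s x y))
     + 2 * (\<Sum>k\<in>UNIV. lam k * (wt 2 s * T (ydiff k h) s x y)
         - real (y k) * (wt 2 s * T (ydiff k h) s x (dwn1 k y)))"

lemma smooth2D:
  assumes "smooth2 h"
  shows "smooth1 h" "CB h" "CB (pdx j h)" "smooth1 (pdx j h)" "CB (pdx k (pdx j h))" "CB (ydiff i h)"
  using assms by (auto simp: smooth2_def smooth1_def CB_ydiff)

lemma sum_UNIV_pair:
  fixes F :: "'i::finite \<Rightarrow> 'j::finite \<Rightarrow> 'z::comm_monoid_add"
  shows "(\<Sum>p\<in>UNIV. F (fst p) (snd p)) = (\<Sum>j\<in>UNIV. \<Sum>k\<in>UNIV. F j k)"
  unfolding sum.cartesian_product UNIV_Times_UNIV case_prod_unfold ..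

text \<open>Both ingredients move with s: the change of the smoothed function gives the
  Ornstein-Uhlenbeck part, the change of the kernel the immigration-death part.\<close>

lemma Tk_DERIV_s:
  assumes h: "smooth2 h" and s0: "0 < s0" "s0 < 1"
  shows "((\<lambda>s. T h s x y) has_field_derivative Tk' h x y s0) (at s0)"
proof -
  obtain a where a: "0 < a" "a < s0" using dense[OF s0(1)] by blast
  obtain b where b: "s0 < b" "b < 1" using dense[OF s0(2)] by blast
  note hs = smooth2D[OF h]
  have s01: "0 \<le> s0" "s0 \<le> 1" using s0 by auto
  obtain B where B: "\<And>x y. \<bar>h x y\<bar> \<le> B" using CB_bound[OF hs(2)] by blast
  have "\<forall>j. \<exists>B. 0 \<le> B \<and> (\<forall>x y. \<bar>pdx j h x y\<bar> \<le> B)" using CB_bound[OF hs(3)] by blast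
  from choice[OF this] obtain B1 where "\<forall>j. 0 \<le> B1 j \<and> (\<forall>x y. \<bar>pdx j h x y\<bar> \<le> B1 j)" by blast
  hence B1: "\<And>j. 0 \<le> B1 j" "\<And>j x y. \<bar>pdx j h x y\<bar> \<le> B1 j" by simp_all
  have "\<forall>p. \<exists>B. 0 \<le> B \<and> (\<forall>x y. \<bar>pdx (snd p) (pdx (fst p) h) x y\<bar> \<le> B)" using CB_bound[OF hs(5)] by blast
  from choice[OF this] obtain B2' where B2': "\<forall>p. 0 \<le> B2' p \<and> (\<forall>x y. \<bar>pdx (snd p) (pdx (fst p) h) x y\<bar> \<le> B2' p)" by blast
  define B2 where "B2 = (\<lambda>j k. B2' (j, k))"
  have B2: "\<And>j k. 0 \<le> B2 j k" "\<And>j k x y. \<bar>pdx k (pdx j h) x y\<bar> \<le> B2 j k"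
    using B2' by (auto simp: B2_def)
  define S' where "S' = (\<lambda>s z. - (\<Sum>j\<in>UNIV. x $ j * S (pdx j h) s x z) / (2 * sqrt (1 - s))
     + (\<Sum>j\<in>UNIV. \<Sum>k\<in>UNIV. Sig $ j $ k * S (pdx k (pdx j h)) s x z) / 2)"
  have w1: "wt 1 s = 1 / (2 * sqrt (1 - s))" and w2: "wt 2 s = 1 / 2" if "s < 1" for s
    using that by (auto simp: wt_def field_simps power2_eq_square)
  define C where "C = (\<Sum>j\<in>UNIV. \<bar>x $ j\<bar> * B1 j) / (2 * sqrt (1 - b)) + (\<Sum>j\<in>UNIV. \<Sum>k\<in>UNIV. \<bar>Sig $ j $ k\<bar> * B2 j k) / 2"
  have S'b: "\<bar>S' s z\<bar> \<le> C" if s: "a < s" "s < b" for s z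
  proof -
    have 1: "\<bar>\<Sum>j\<in>UNIV. x $ j * S (pdx j h) s x z\<bar> \<le> (\<Sum>j\<in>UNIV. \<bar>x $ j\<bar> * B1 j)"
      by (rule order_trans[OF sum_abs sum_mono]) (auto simp: abs_mult intro!: mult_left_mono Ssemi_bound hs B1)
    have 2: "\<bar>\<Sum>j\<in>UNIV. \<Sum>k\<in>UNIV. Sig $ j $ k * S (pdx k (pdx j h)) s x z\<bar> \<le> (\<Sum>j\<in>UNIV. \<Sum>k\<in>UNIV. \<bar>Sig $ j $ k\<bar> * B2 j k)"
      by (intro order_trans[OF sum_abs sum_mono]) (auto simp: abs_mult intro!: mult_left_mono Ssemi_bound hs B2)
    have "\<bar>- (\<Sum>j\<in>UNIV. x $ j * S (pdx j h) s x z) / (2 * sqrt (1 - s))\<bar> \<le> (\<Sum>j\<in>UNIV. \<bar>x $ j\<bar> * B1 j) / (2 * sqrt (1 - b))"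
      unfolding abs_divide abs_minus_cancel using s b B1(1)
      by (intro frac_le) (auto intro!: 1 sum_nonneg)
    thus ?thesis using 2 unfolding S'_def C_def by linarith
  qed
  have "((\<lambda>s. K s y (S h s x)) has_field_derivative
     K s0 y (S' s0) + (\<Sum>k\<in>UNIV. lam k * K s0 y (\<lambda>z. S h s0 x (upd1 k z) - S h s0 x z)
        - real (y k) * K s0 (dwn1 k y) (\<lambda>z. S h s0 x (upd1 k z) - S h s0 x z))) (at s0)"
  proof (rule Kop_DERIV[OF lam a b])
    show "((\<lambda>s. S h s x z) has_real_derivative S' s z) (at s)" if "a < s" "s < b" for s z
      unfolding S'_def by (rule Ssemi_DERIV_s[OF fac h]) (use that a b in auto)
  qed (rule Ssemi_bound[OF hs(2) B] S'b | assumption)+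
  moreover have "K s0 y (S' s0) = (\<Sum>j\<in>UNIV. \<Sum>k\<in>UNIV. Sig $ j $ k * (wt 2 s0 * T (pdx k (pdx j h)) s0 x y))
     - (\<Sum>j\<in>UNIV. x $ j * (wt 1 s0 * T (pdx j h) s0 x y))"
  proof -
    \<comment> \<open>The double sum is indexed by pairs so that linearity over a single finite
      index applies.\<close>
    let ?c = "\<lambda>p. Sig $ fst p $ snd p * wt 2 s0" and ?g = "\<lambda>p. pdx (snd p) (pdx (fst p) h)"
    have "S' s0 = (\<lambda>z. (\<Sum>j\<in>UNIV. \<Sum>k\<in>UNIV. Sig $ j $ k * wt 2 s0 * S (pdx k (pdx j h)) s0 x z)
       - (\<Sum>j\<in>UNIV. x $ j * wt 1 s0 * S (pdx j h) s0 x z))"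
      unfolding S'_def w1[OF s0(2)] w2[OF s0(2)] by (simp add: fun_eq_iff sum_divide_distrib)
    hence e: "S' s0 = (\<lambda>z. (\<Sum>p\<in>UNIV. ?c p * S (?g p) s0 x z) - (\<Sum>j\<in>UNIV. x $ j * wt 1 s0 * S (pdx j h) s0 x z))"
      unfolding sum.cartesian_product UNIV_Times_UNIV case_prod_unfold .
    have k: "K s0 y (S' s0) = (\<Sum>p\<in>UNIV. ?c p * T (?g p) s0 x y)
       - (\<Sum>j\<in>UNIV. x $ j * wt 1 s0 * T (pdx j h) s0 x y)"
    proof -
      note L1 = Kop_Ssemi_sum(1)[OF s01, where A=UNIV and g="?g" and c="?c" and x=x and y=y, OF hs(5)]
        Kop_Ssemi_sum(2)[OF s01, where A=UNIV and g="?g" and c="?c" and x=x, OF hs(5)]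
      note L2 = Kop_Ssemi_sum(1)[OF s01, where A=UNIV and g="\<lambda>j. pdx j h" and c="\<lambda>j. x $ j * wt 1 s0" and x=x and y=y, OF hs(3)]
        Kop_Ssemi_sum(2)[OF s01, where A=UNIV and g="\<lambda>j. pdx j h" and c="\<lambda>j. x $ j * wt 1 s0" and x=x, OF hs(3)]
      obtain C1 C2 where "\<And>z. \<bar>\<Sum>p\<in>UNIV. ?c p * S (?g p) s0 x z\<bar> \<le> C1"
        "\<And>z. \<bar>\<Sum>j\<in>UNIV. x $ j * wt 1 s0 * S (pdx j h) s0 x z\<bar> \<le> C2"
        using L1(2) L2(2) by blast
      from Kop_diff[OF lam s01 this, of y] show ?thesis by (simp only: e L1(1) L2(1))
    qed
    have p: "(\<Sum>p\<in>UNIV. ?c p * T (?g p) s0 x y) = (\<Sum>j\<in>UNIV. \<Sum>k\<in>UNIV. Sig $ j $ k * wt 2 s0 * T (pdx k (pdx j h)) s0 x y)"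
      by (rule sum_UNIV_pair[of "\<lambda>j k. Sig $ j $ k * wt 2 s0 * T (pdx k (pdx j h)) s0 x y"])
    show ?thesis unfolding k p by (simp only: mult.assoc)
  qed
  moreover have "(\<Sum>k\<in>UNIV. lam k * K s0 y (\<lambda>z. S h s0 x (upd1 k z) - S h s0 x z)
        - real (y k) * K s0 (dwn1 k y) (\<lambda>z. S h s0 x (upd1 k z) - S h s0 x z))
     = 2 * (\<Sum>k\<in>UNIV. lam k * (wt 2 s0 * T (ydiff k h) s0 x y)
         - real (y k) * (wt 2 s0 * T (ydiff k h) s0 x (dwn1 k y)))"
    unfolding Ssemi_ydiff[OF hs(2)] w2[OF s0(2)] sum_distrib_left
    by (intro sum.cong refl) (simp add: Tk_def)
  ultimately show ?thesis by (simp only: Tk_def Tk'_def)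
qed

lemma Tk'_integrable:
  assumes h: "smooth2 h"
  shows "integrable U01 (Tk' h x y)"
  unfolding Tk'_def
  by (intro Bochner_Integration.integrable_add Bochner_Integration.integrable_diff integrable_mult_right
        Bochner_Integration.integrable_sum wt_Tk_integrable smooth2D[OF h]) simp_all

lemma Tk'_continuous:
  assumes h: "smooth2 h"
  shows "continuous_on {0<..<1} (Tk' h x y)"
proof -
  have "continuous_on {0<..<1} (wt n)" for n unfolding wt_def by (intro continuous_intros) auto
  moreover have "continuous_on {0<..<1} (\<lambda>s. T g s x y)" if "CB g" for g y
    by (rule Tk_continuous[OF that]) (auto intro!: continuous_intros)
  ultimately have "continuous_on {0<..<1} (\<lambda>s. wt n s * T g s x y)" if "CB g" for n g y
    using that by (intro continuous_on_mult) auto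
  thus ?thesis unfolding Tk'_def
    by (intro continuous_on_add continuous_on_diff continuous_on_sum continuous_on_mult_left)
       (simp_all add: smooth2D[OF h])
qed

lemma Tk_continuous_s:
  assumes g: "CB g" shows "continuous_on {0..1} (\<lambda>s. T g s x y)"
  by (rule Tk_continuous[OF g]) (auto intro!: continuous_intros)

text \<open>
  The derivative in s is of order (1-s)^(-1/2), hence \<open>T\<^sub>s h - T\<^sub>1 h\<close> is of order (1-s)^(1/2), which makes
  the integral defining the solution converge at s = 1.
\<close>

lemma Tk_near_1:
  assumes h: "smooth2 h"
  obtains C where "\<And>s. 0 < s \<Longrightarrow> s < 1 \<Longrightarrow> \<bar>T h s x y - T h 1 x y\<bar> \<le> C * sqrt (1 - s)"
proof -
  note hs = smooth2D[OF h]
  \<comment> \<open>G is the s-derivative with the factor \<open>wt 1 s\<close> removed. It is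
    continuous on the closed interval, hence bounded there.\<close>
  define G where "G = (\<lambda>s. (\<Sum>j\<in>UNIV. \<Sum>k\<in>UNIV. Sig $ j $ k * (sqrt (1 - s) * T (pdx k (pdx j h)) s x y))
     - (\<Sum>j\<in>UNIV. x $ j * T (pdx j h) s x y)
     + 2 * (\<Sum>k\<in>UNIV. lam k * (sqrt (1 - s) * T (ydiff k h) s x y)
         - real (y k) * (sqrt (1 - s) * T (ydiff k h) s x (dwn1 k y))))"
  have "continuous_on {0..1} G" unfolding G_def
    by (intro continuous_on_add continuous_on_diff continuous_on_sum continuous_on_mult Tk_continuous_s hs)
       (intro continuous_intros)+
  hence "bounded (G ` {0..1})" by (intro compact_imp_bounded compact_continuous_image compact_Icc)
  then obtain C where GC: "\<And>s. 0 \<le> s \<Longrightarrow> s \<le> 1 \<Longrightarrow> \<bar>G s\<bar> \<le> C" by (force simp: bounded_iff)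
  have TG: "Tk' h x y s = wt 1 s * G s" for s
  proof -
    have w2: "wt 2 s = wt 1 s * sqrt (1 - s)" using wt_Suc[of 1 s] by (simp add: numeral_2_eq_2 mult.commute)
    show ?thesis unfolding Tk'_def G_def w2
      by (simp add: sum_distrib_left right_diff_distrib distrib_left mult_ac)
  qed
  have C: "\<bar>Tk' h x y s\<bar> \<le> C * wt 1 s" if "0 < s" "s < 1" for s
    using GC[of s] that wt_nonneg[of s 1] unfolding TG abs_mult
    by (simp add: mult.commute[of C] mult_left_mono del: One_nat_def)
  have "\<bar>T h s x y - T h 1 x y\<bar> \<le> C * sqrt (1 - s)" if s: "0 < s" "s < 1" for s
  proof -
    \<comment> \<open>Both signs of T h, added to -C sqrt(1-s), have nonnegative derivative and so
      increase up to s = 1. Comparing the values at s and at 1 bounds the difference on both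
      sides.\<close>
    have mono: "C * (- sqrt (1 - s)) + c * T h s x y \<le> C * (- sqrt (1 - 1)) + c * T h 1 x y"
      if c: "c = 1 \<or> c = -1" for c
    proof (rule DERIV_nonneg_imp_increasing_open[where f="\<lambda>s. C * (- sqrt (1 - s)) + c * T h s x y"])
      show "s \<le> 1" using s by simp
      show "\<exists>d. ((\<lambda>s. C * (- sqrt (1 - s)) + c * T h s x y) has_real_derivative d) (at t) \<and> 0 \<le> d"
        if t: "s < t" "t < 1" for t
      proof (intro exI conjI)
        have t0: "0 < t" using s t by simp
        show "((\<lambda>s. C * (- sqrt (1 - s)) + c * T h s x y) has_real_derivative C * wt 1 t + c * Tk' h x y t) (at t)"
          by (intro DERIV_add DERIV_cmult neg_sqrt_DERIV Tk_DERIV_s h t t0)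
        show "0 \<le> C * wt 1 t + c * Tk' h x y t" using C[OF t0 t(2)] c by auto
      qed
      show "continuous_on {s..1} (\<lambda>s. C * (- sqrt (1 - s)) + c * T h s x y)"
        using s by (intro continuous_intros continuous_on_subset[OF Tk_continuous_s[OF hs(2)]]) auto
    qed
    show ?thesis using mono[of 1] mono[of "-1"] by (simp add: abs_le_iff)
  qed
  thus ?thesis using that by blast
qed

text \<open>The factor sqrt(1-s) gained by centring turns the singular weight \<open>wt 0\<close>
  into the integrable \<open>wt 1\<close>.\<close>

lemma wt_0_integrable:
  assumes h: "smooth2 h"
  shows "integrable U01 (\<lambda>s. wt 0 s * (T h s x y - EhZN Sig lam h))"
proof -
  note hs = smooth2D[OF h]
  obtain C where C: "\<And>s. 0 < s \<Longrightarrow> s < 1 \<Longrightarrow> \<bar>T h s x y - EhZN Sig lam h\<bar> \<le> C * sqrt (1 - s)"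
    using Tk_near_1[OF h, of x y] unfolding Tk_1[OF hs(2)] by blast
  show ?thesis
  proof (rule Bochner_Integration.integrable_bound)
    show "integrable U01 (\<lambda>s. C * wt 1 s)" by (intro integrable_mult_right wt_integrable) simp
    show "(\<lambda>s. wt 0 s * (T h s x y - EhZN Sig lam h)) \<in> borel_measurable U01"
      by (intro borel_measurable_times borel_measurable_diff U01_measurable[OF wt_measurable] Tk_measurable hs) simp
    show "AE s in U01. norm (wt 0 s * (T h s x y - EhZN Sig lam h)) \<le> norm (C * wt 1 s)"
    proof (rule AE_I2)
      fix s assume "s \<in> space U01"
      hence s: "0 < s" "s < 1" by auto
      have "wt 0 s * \<bar>T h s x y - EhZN Sig lam h\<bar> \<le> wt 0 s * (C * sqrt (1 - s))"
        by (intro mult_left_mono C s wt_nonneg)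
      also have "\<dots> = C * wt 1 s" by (simp add: wt_Suc[of 0, simplified])
      also have "\<dots> \<le> \<bar>C * wt 1 s\<bar>" by simp
      finally show "norm (wt 0 s * (T h s x y - EhZN Sig lam h)) \<le> norm (C * wt 1 s)"
        using wt_nonneg[OF s(2), of 0] by (simp add: abs_mult)
    qed
  qed
qed

lemma fsol_eq_Fsol:
  assumes h: "CB h"
  shows "fsol Sig lam h = F 0 (EhZN Sig lam h) h"
proof (intro ext)
  fix x y
  have "(\<integral>s. 1 / (2 * (1 - s)) * (Tsemi Sig lam h s x y - EhZN Sig lam h) \<partial>U01)
     = (\<integral>s. wt 0 s * (T h s x y - EhZN Sig lam h) \<partial>U01)"
    by (rule Bochner_Integration.integral_cong) (auto simp: wt_def Tsemi_eq_Tk[OF _ _ h])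
  thus "fsol Sig lam h x y = F 0 (EhZN Sig lam h) h x y"
    by (simp add: fsol_def Fsol_def U01_interval_integral)
qed

lemma wt_Tk_integrable': "n \<ge> 1 \<Longrightarrow> CB g \<Longrightarrow> integrable U01 (\<lambda>s. wt n s * (T g s x y - 0))"
  using wt_Tk_integrable by simp

lemma smooth1_Fsol:
  assumes "n \<ge> 1" "smooth1 g"
  shows "smooth1 (F n 0 g)" "pdx j (F n 0 g) = F (Suc n) 0 (pdx j g)"
    "ydiff k (F n 0 g) = F (Suc (Suc n)) 0 (ydiff k g)"
proof -
  have cg: "CB g" "\<And>j. CB (pdx j g)" using assms by (auto simp: smooth1_def)
  note F = Fsol_pdx[OF wt_Tk_integrable'[OF assms(1) cg(1)] assms(2)]
  show "pdx j (F n 0 g) = F (Suc n) 0 (pdx j g)" by (rule F)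
  show "smooth1 (F n 0 g)"
    unfolding smooth1_def F(2) using CB_Fsol[OF assms(1) cg(1)] F(1) CB_Fsol[OF _ cg(2)] by simp
  show "ydiff k (F n 0 g) = F (Suc (Suc n)) 0 (ydiff k g)"
    by (rule Fsol_ydiff[OF wt_Tk_integrable'[OF assms(1) cg(1)] cg(1)])
qed

lemma fsol_derivs:
  assumes h: "smooth2 h"
  shows "xdiffble j (\<lambda>x. fsol Sig lam h x y)" "pdx j (fsol Sig lam h) = F 1 0 (pdx j h)"
    "ydiff k (fsol Sig lam h) = F 2 0 (ydiff k h)"
  using Fsol_pdx[OF wt_0_integrable[OF h] smooth2D(1)[OF h]] Fsol_ydiff[OF wt_0_integrable[OF h] smooth2D(2)[OF h], of k]
  by (simp_all add: fsol_eq_Fsol[OF smooth2D(2)[OF h]] numeral_2_eq_2)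

text \<open>The fundamental theorem of calculus for s -> T_s h: the endpoint values are h(x,y) and E
  h(Z,N), and the minus sign in f reverses their difference.\<close>

lemma stein_equation:
  assumes h: "smooth2 h"
  shows "(\<Sum>j\<in>UNIV. \<Sum>k\<in>UNIV. Sig $ j $ k * pdx k (pdx j (fsol Sig lam h)) x y)
     - (\<Sum>j\<in>UNIV. x $ j * pdx j (fsol Sig lam h) x y)
     + 2 * (\<Sum>k\<in>UNIV. lam k * ydiff k (fsol Sig lam h) x y - real (y k) * ydiff k (fsol Sig lam h) x (dwn1 k y))
     = h x y - EhZN Sig lam h"
proof -
  note hs = smooth2D[OF h]
  have "(\<integral>s. Tk' h x y s \<partial>U01) = EhZN Sig lam h - h x y"
    using U01_FTC(1)[OF Tk_DERIV_s[OF h] Tk'_continuous[OF h] Tk_continuous_s[OF hs(2)] Tk'_integrable[OF h]]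
    by (simp add: Tk_0 Tk_1[OF hs(2)])
  moreover have "(\<integral>s. Tk' h x y s \<partial>U01) =
     (\<Sum>j\<in>UNIV. \<Sum>k\<in>UNIV. Sig $ j $ k * (\<integral>s. wt 2 s * T (pdx k (pdx j h)) s x y \<partial>U01))
     - (\<Sum>j\<in>UNIV. x $ j * (\<integral>s. wt 1 s * T (pdx j h) s x y \<partial>U01))
     + 2 * (\<Sum>k\<in>UNIV. lam k * (\<integral>s. wt 2 s * T (ydiff k h) s x y \<partial>U01)
         - real (y k) * (\<integral>s. wt 2 s * T (ydiff k h) s x (dwn1 k y) \<partial>U01))"
  proof -
    have i: "integrable U01 (\<lambda>s. wt 2 s * T (pdx k (pdx j h)) s x y)"
      "integrable U01 (\<lambda>s. wt 1 s * T (pdx j h) s x y)"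
      "integrable U01 (\<lambda>s. wt 2 s * T (ydiff k' h) s x y)" for j k k' x y
      by (rule wt_Tk_integrable; simp add: hs)+
    show ?thesis unfolding Tk'_def by (simp add: i del: One_nat_def)
  qed
  moreover have "F n 0 g x y = - (\<integral>s. wt n s * T g s x y \<partial>U01)" for n g y
    by (simp add: Fsol_def)
  moreover have "pdx k (pdx j (fsol Sig lam h)) = F 2 0 (pdx k (pdx j h))" for j k
    using smooth1_Fsol(2)[of 1, OF _ hs(4)] by (simp add: fsol_derivs[OF h] numeral_2_eq_2)
  ultimately show ?thesis by (simp add: fsol_derivs[OF h] sum_negf sum_subtractf)
qed

end

section \<open>Regularity of the solution\<close>

text \<open>
  Boundedness is essential here: the real supremum of an unbounded set is a junk value.
\<close>

lemma supnorm_bound: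
  assumes "CB f" shows "\<bar>f x y\<bar> \<le> supnorm f"
proof -
  obtain B where "\<And>x y. \<bar>f x y\<bar> \<le> B" using assms by (auto simp: CB_def)
  hence "bdd_above (range (\<lambda>p. \<bar>f (fst p) (snd p)\<bar>))" by (intro bdd_aboveI2)
  from cSUP_upper[OF UNIV_I this, of "(x, y)"] show ?thesis by (simp add: supnorm_def)
qed

lemma pdx_commute:
  assumes "smooth2 g" shows "pdx k (pdx j g) = pdx j (pdx k g)"
proof (intro ext)
  fix x y
  have c: "continuous_on UNIV (xpartial k (xpartial j (\<lambda>x. g x y)))" "xdiffble j (\<lambda>x. g x y)"
    "xdiffble k (xpartial j (\<lambda>x. g x y))" for j k
    using assms unfolding smooth2_def smooth1_def CB_def by (simp_all add: pdx_xpartial[symmetric])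
  have "xpartial k (xpartial j (\<lambda>x. g x y)) = xpartial j (xpartial k (\<lambda>x. g x y))"
    by (intro xpartial_commute c)
  thus "pdx k (pdx j g) x y = pdx j (pdx k g) x y"
    by (simp add: pdx_def[of k "pdx j g"] pdx_def[of j "pdx k g"] pdx_xpartial)
qed

text \<open>\<open>C3\<close> controls first partials only through the Lipschitz condition; the
  bound on difference quotients passes to the limit.\<close>

lemma lipschitz_xpartial_bound:
  fixes g :: "real^'d::finite \<Rightarrow> real"
  assumes d: "xdiffble j g" and l: "\<And>x y. \<bar>g x - g y\<bar> \<le> dist x y"
  shows "\<bar>xpartial j g x\<bar> \<le> 1"
proof -
  have "((\<lambda>t. g (x + t *\<^sub>R axis j 1)) has_field_derivative xpartial j g x) (at 0)"
    using xpartial_DERIV[OF d, of x 0] by simp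
  hence "((\<lambda>t. (g (x + t *\<^sub>R axis j 1) - g x) / t) \<longlongrightarrow> xpartial j g x) (at 0)"
    by (simp add: DERIV_def)
  hence "((\<lambda>t. \<bar>(g (x + t *\<^sub>R axis j 1) - g x) / t\<bar>) \<longlongrightarrow> \<bar>xpartial j g x\<bar>) (at 0)"
    by (rule tendsto_rabs)
  moreover have "\<bar>(g (x + t *\<^sub>R axis j 1) - g x) / t\<bar> \<le> 1" if "t \<noteq> 0" for t
  proof -
    have "dist (x + t *\<^sub>R axis j 1) x = \<bar>t\<bar>" by (simp add: dist_norm norm_axis_1)
    hence "\<bar>g (x + t *\<^sub>R axis j 1) - g x\<bar> \<le> \<bar>t\<bar>" using l[of "x + t *\<^sub>R axis j 1" x] by simp
    thus ?thesis using that by (simp add: abs_divide)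
  qed
  hence "\<forall>\<^sub>F t in at 0. \<bar>(g (x + t *\<^sub>R axis j 1) - g x) / t\<bar> \<le> 1"
    by (auto simp: eventually_at_filter)
  ultimately show ?thesis by (rule tendsto_upperbound) simp
qed

lemma H3_smooth:
  fixes h :: "real^'d::finite \<Rightarrow> ('r \<Rightarrow> nat) \<Rightarrow> real"
  assumes "h \<in> H3"
  shows "smooth2 h" "smooth2 (pdx j h)"
proof -
  have b: "\<And>x y. \<bar>h x y\<bar> \<le> 1" and c: "\<And>y. C3 (\<lambda>x. h x y)" using assms by (auto simp: H3_def)
  have pp: "(\<lambda>x. pdx j h x y) = xpartial j (\<lambda>x. h x y)"
    "(\<lambda>x. pdx k (pdx j h) x y) = xpartial k (xpartial j (\<lambda>x. h x y))"
    "(\<lambda>x. pdx l (pdx k (pdx j h)) x y) = xpartial l (xpartial k (xpartial j (\<lambda>x. h x y)))" for j k l y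
    by (simp_all add: pdx_xpartial)
  note C = c[unfolded C3_def]
  have 0: "CB h" unfolding CB_def using b C by blast
  have b1: "\<bar>pdx j h x y\<bar> \<le> 1" for j x y
    unfolding pdx_def by (rule lipschitz_xpartial_bound) (use C in blast)+
  have b2: "\<bar>pdx k (pdx j h) x y\<bar> \<le> 1" for j k x y
    unfolding pdx_def[of k] pp using C[of y] by blast
  have b3: "\<bar>pdx l (pdx k (pdx j h)) x y\<bar> \<le> 1" for j k l x y
    unfolding pdx_def[of l] pp using C[of y] by blast
  have 1: "CB (pdx j h)" for j unfolding CB_def pp using b1 C by blast
  have 2: "CB (pdx k (pdx j h))" for j k unfolding CB_def pp using b2 C by blast
  have 3: "CB (pdx l (pdx k (pdx j h)))" for j k l unfolding CB_def pp using b3 C by blast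
  have s0: "smooth1 h" unfolding smooth1_def using 0 1 C by blast
  have s1: "smooth1 (pdx j h)" for j unfolding smooth1_def pp using 1 2 C by blast
  have s2: "smooth1 (pdx k (pdx j h))" for j k unfolding smooth1_def pp using 2 3 C by blast
  show "smooth2 h" "smooth2 (pdx j h)" unfolding smooth2_def using s0 s1 s2 by blast+
qed

text \<open>Each first derivative or difference is an \<open>Fsol\<close> with n >= 1, whence the
  bounds; f itself, with n = 0, is not claimed bounded. Mixed derivatives are exchanged at the level
  of h, because the expansion produces them in the reverse of the order in the final bound.\<close>

lemma fsol_regular:
  fixes Sig :: "real^'d::finite^'d" and lam :: "'r::finite \<Rightarrow> real"
  assumes fac: "gauss_factorable Sig" and lam: "\<forall>k. 0 < lam k" and h: "h \<in> H3"
  defines "f \<equiv> fsol Sig lam h"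
  shows "smooth1 (pdx j f)" "smooth1 (pdx k (pdx j f))" "CB (pdx l (pdx k (pdx j f)))"
    "smooth1 (ydiff m f)" "CB (ydiff m (pdx j f))" "CB (ydiff i (ydiff m f))"
    "pdx j (ydiff m f) = ydiff m (pdx j f)"
    "pdx k (pdx j f) = pdx j (pdx k f)" "pdx l (pdx k (pdx j f)) = pdx j (pdx k (pdx l f))"
proof -
  have h2: "smooth2 h" "\<And>j. smooth2 (pdx j h)" using H3_smooth[OF h] by auto
  have h1: "\<And>j. smooth1 (pdx j h)" "\<And>j k. smooth1 (pdx k (pdx j h))" "smooth1 h"
    using h2 by (auto simp: smooth2_def)
  note F = smooth1_Fsol[OF fac lam]
  note f = fsol_derivs[OF fac lam h2(1)]
  have p1: "pdx j f = Fsol Sig lam 1 0 (pdx j h)" for j by (simp add: f_def f)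
  have p2: "pdx k (pdx j f) = Fsol Sig lam 2 0 (pdx k (pdx j h))" for j k
    using F(2)[of 1, OF _ h1(1)] by (simp add: p1 numeral_2_eq_2)
  have p3: "pdx l (pdx k (pdx j f)) = Fsol Sig lam 3 0 (pdx l (pdx k (pdx j h)))" for j k l
    using F(2)[of 2, OF _ h1(2)] by (simp add: p2 numeral_3_eq_3 numeral_2_eq_2)
  have y1: "ydiff m f = Fsol Sig lam 2 0 (ydiff m h)" for m by (simp add: f_def f)
  have sy: "smooth1 (ydiff m h)" for m by (rule smooth1_ydiff(1)[OF h1(3)])
  show "smooth1 (pdx j f)" unfolding p1 by (rule F(1)) (simp_all add: h1)
  show s2: "smooth1 (pdx k (pdx j f))" unfolding p2 by (rule F(1)) (simp_all add: h1)
  show "CB (pdx l (pdx k (pdx j f)))" using s2 by (simp add: smooth1_def)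
  show sf: "smooth1 (ydiff m f)" unfolding y1 by (rule F(1)) (simp_all add: sy)
  show "CB (ydiff m (pdx j f))" unfolding p1
    by (rule CB_ydiff, rule CB_Fsol[OF fac lam]) (use h1(1) in \<open>auto simp: smooth1_def\<close>)
  show "CB (ydiff i (ydiff m f))" using sf CB_ydiff[of "ydiff m f"] by (simp add: smooth1_def)
  show "pdx j (ydiff m f) = ydiff m (pdx j f)"
    unfolding y1 p1 using F(2)[of 2, OF _ sy] F(3)[of 1, OF _ h1(1)] smooth1_ydiff(2)[OF h1(3)]
    by (simp add: numeral_3_eq_3 numeral_2_eq_2)
  show "pdx k (pdx j f) = pdx j (pdx k f)"
    unfolding p2 by (simp add: pdx_commute[OF h2(1), of k j])
  \<comment> \<open>The order is reversed by three adjacent transpositions; the second one acts on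
    the derivatives of \<open>pdx k h\<close>.\<close>
  have "pdx l (pdx k (pdx j h)) = pdx l (pdx j (pdx k h))" by (simp add: pdx_commute[OF h2(1), of k j])
  also have "\<dots> = pdx j (pdx l (pdx k h))" by (rule pdx_commute[OF h2(2)])
  also have "\<dots> = pdx j (pdx k (pdx l h))" by (simp add: pdx_commute[OF h2(1), of k l])
  finally show "pdx l (pdx k (pdx j f)) = pdx j (pdx k (pdx l f))" unfolding p3 by simp
qed

section \<open>Simple random variables and the coupling\<close>

lemma (in prob_space) integrable_simple:
  assumes "simple_function M (f :: 'a \<Rightarrow> real)"
  shows "integrable M f"
proof -
  have fin: "finite ((\<lambda>x. \<bar>f x\<bar>) ` space M)"
    using simple_functionD(1)[OF simple_function_compose1[OF assms, of abs]] .
  show ?thesis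
  proof (rule integrable_const_bound[where B="Max ((\<lambda>x. \<bar>f x\<bar>) ` space M)"])
    show "AE x in M. norm (f x) \<le> Max ((\<lambda>x. \<bar>f x\<bar>) ` space M)"
      using fin by (intro AE_I2) auto
  qed (rule borel_measurable_simple_function[OF assms])
qed

lemma sets_all_eq:
  fixes X :: "'i \<Rightarrow> 'a \<Rightarrow> real"
  assumes fin: "finite A" and X: "\<And>i. i \<in> A \<Longrightarrow> X i \<in> borel_measurable M"
  shows "{w\<in>space M. \<forall>i\<in>A. X i w = v i} \<in> sets M"
proof (rule sets.sets_Collect_finite_All[OF _ fin])
  fix i assume "i \<in> A"
  hence [measurable]: "X i \<in> borel_measurable M" by (rule X)
  show "{w\<in>space M. X i w = v i} \<in> sets M" by measurable
qed

text \<open>Restricting to A makes the indicator vectors extensional, so only finitely many occur.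
  All variables of the proof then become simple, being functions of such vectors.\<close>

lemma simple_function_restrict:
  assumes fin: "finite A" and X: "\<And>i. i \<in> A \<Longrightarrow> X i \<in> borel_measurable M"
    and X01: "\<And>i w. i \<in> A \<Longrightarrow> w \<in> space M \<Longrightarrow> X i w \<in> {0, 1::real}"
  shows "simple_function M (\<lambda>w. restrict (\<lambda>i. X i w) A)"
  unfolding simple_function_def
proof (intro conjI ballI)
  have "(\<lambda>w. restrict (\<lambda>i. X i w) A) ` space M \<subseteq> PiE A (\<lambda>_. {0, 1})"
    using X01 by fastforce
  thus "finite ((\<lambda>w. restrict (\<lambda>i. X i w) A) ` space M)"
    by (rule finite_subset) (intro finite_PiE fin, simp)
  fix v assume "v \<in> (\<lambda>w. restrict (\<lambda>i. X i w) A) ` space M"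
  hence v: "v \<in> extensional A" by auto
  have "(\<lambda>w. restrict (\<lambda>i. X i w) A) -` {v} \<inter> space M = {w\<in>space M. \<forall>i\<in>A. X i w = v i}"
    using v by (auto simp: fun_eq_iff restrict_def extensional_def)
  moreover have "{w\<in>space M. \<forall>i\<in>A. X i w = v i} \<in> sets M"
    by (rule sets_all_eq[OF fin X])
  ultimately show "(\<lambda>w. restrict (\<lambda>i. X i w) A) -` {v} \<inter> space M \<in> sets M" by simp
qed

section \<open>Conditional expectation given a finite-valued variable\<close>

context prob_space
begin

lemma integral_sum_indicator:
  fixes c :: "'b \<Rightarrow> real"
  assumes A: "\<And>v. A v \<in> sets M"
  shows "(\<integral>w. (\<Sum>v\<in>S. c v * indicator (A v) w) \<partial>M) = (\<Sum>v\<in>S. c v * measure M (A v))"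
proof -
  have "integrable M (indicat_real (A v))" for v
    by (rule integrable_real_indicator[OF A]) (simp add: emeasure_eq_measure)
  hence "(\<integral>w. (\<Sum>v\<in>S. c v * indicator (A v) w) \<partial>M) = (\<Sum>v\<in>S. c v * (\<integral>w. indicator (A v) w \<partial>M))"
    by (subst Bochner_Integration.integral_sum) auto
  thus ?thesis using sets.Int_space_eq2[OF A] by simp
qed

lemma cexp_disc_simple:
  assumes V: "simple_function M V"
  shows "simple_function M (cexp_disc M V X)"
proof -
  have "cexp_disc M V X = (\<lambda>w. (\<lambda>v. let A = {w'\<in>space M. V w' = v} in
     if measure M A = 0 then 0 else (\<integral>w'. indicator A w' * X w' \<partial>M) / measure M A) (V w))"
    unfolding cexp_disc_def ..
  thus ?thesis using simple_function_compose1[OF V] by simp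
qed

text \<open>The characteristic property of conditional expectation, checked on each level set of
  V.\<close>

lemma cexp_disc_integral:
  fixes u :: "'b \<Rightarrow> real"
  assumes V: "simple_function M V" and X: "simple_function M X"
  shows "(\<integral>w. cexp_disc M V X w * u (V w) \<partial>M) = (\<integral>w. X w * u (V w) \<partial>M)"
proof -
  define S where "S = (\<lambda>v. {w\<in>space M. V w = v})"
  define c where "c = (\<lambda>v. if measure M (S v) = 0 then 0 else (\<integral>w'. indicator (S v) w' * X w' \<partial>M) / measure M (S v))"
  have cV: "cexp_disc M V X w = c (V w)" for w by (simp add: cexp_disc_def c_def S_def Let_def)
  have finV: "finite (V ` space M)" using V by (rule simple_functionD(1))
  have Sm: "S v \<in> sets M" for v
  proof -
    have "S v = V -` {v} \<inter> space M" by (auto simp: S_def)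
    thus ?thesis using simple_functionD(2)[OF V, of "{v}"] by simp
  qed
  have iX: "integrable M (\<lambda>w. indicator (S v) w * X w)" for v
    using integrable_real_mult_indicator[OF Sm integrable_simple[OF X], of v] by (simp add: mult.commute)
  have dec: "(\<integral>w. Y w * u (V w) \<partial>M) = (\<Sum>v\<in>V ` space M. u v * (\<integral>w. indicator (S v) w * Y w \<partial>M))"
    if Y: "integrable M Y" for Y
  proof -
    have iY: "integrable M (\<lambda>w. indicator (S v) w * Y w)" for v
      using integrable_real_mult_indicator[OF Sm Y, of v] by (simp add: mult.commute)
    have "(\<integral>w. Y w * u (V w) \<partial>M) = (\<integral>w. (\<Sum>v\<in>V ` space M. u v * (indicator (S v) w * Y w)) \<partial>M)"
    proof (rule Bochner_Integration.integral_cong[OF refl])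
      fix w assume w: "w \<in> space M"
      have "(\<Sum>v\<in>V ` space M. u v * (indicator (S v) w * Y w)) = (\<Sum>v\<in>V ` space M. if v = V w then u v * Y w else 0)"
        using w by (intro sum.cong) (auto simp: S_def)
      also have "\<dots> = Y w * u (V w)" using w finV by (simp add: sum.delta)
      finally show "Y w * u (V w) = (\<Sum>v\<in>V ` space M. u v * (indicator (S v) w * Y w))" by simp
    qed
    thus ?thesis using iY by simp
  qed
  have "(\<integral>w. indicator (S v) w * cexp_disc M V X w \<partial>M) = (\<integral>w. indicator (S v) w * X w \<partial>M)" for v
  proof -
    have "(\<integral>w. indicator (S v) w * cexp_disc M V X w \<partial>M) = (\<integral>w. c v * indicator (S v) w \<partial>M)"
      by (rule Bochner_Integration.integral_cong) (auto simp: cV S_def indicator_def)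
    also have "\<dots> = c v * measure M (S v)" using Sm[of v] by simp
    also have "\<dots> = (\<integral>w. indicator (S v) w * X w \<partial>M)"
    proof (cases "measure M (S v) = 0")
      \<comment> \<open>On a null level set the default value 0 is right, because the integral over
        that set vanishes.\<close>
      case True
      hence "AE w in M. w \<notin> S v" using Sm[of v] by (intro AE_not_in) (simp add: null_sets_def emeasure_eq_measure)
      hence "(\<integral>w. indicator (S v) w * X w \<partial>M) = (\<integral>w. 0 \<partial>M)"
        by (intro integral_cong_AE borel_measurable_integrable[OF iX]) auto
      thus ?thesis using True by simp
    qed (simp add: c_def)
    finally show ?thesis .
  qed
  thus ?thesis
    by (simp add: dec integrable_simple[OF X] integrable_simple[OF cexp_disc_simple[OF V]])
qed

text \<open>The difference is minus the covariance of X and u(V). There X may be replaced by its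
  conditional expectation given V, whose mean absolute deviation is at most its standard
  deviation.\<close>

lemma cexp_disc_var_bound:
  fixes u :: "'b \<Rightarrow> real"
  assumes V: "simple_function M V" and X: "simple_function M X" and u: "\<And>v. \<bar>u v\<bar> \<le> B"
  shows "\<bar>expectation X * (\<integral>w. u (V w) \<partial>M) - (\<integral>w. X w * u (V w) \<partial>M)\<bar> \<le> B * sqrt (varM M (cexp_disc M V X))"
proof -
  let ?c = "cexp_disc M V X"
  have sc: "simple_function M ?c" by (rule cexp_disc_simple[OF V])
  have su: "simple_function M (\<lambda>w. u (V w))" by (rule simple_function_compose1[OF V])
  have Ec: "expectation ?c = expectation X" using cexp_disc_integral[OF V X, of "\<lambda>_. 1"] by simp
  have B: "0 \<le> B" using u[of undefined] by linarith
  let ?Y = "\<lambda>w. \<bar>expectation X - ?c w\<bar>"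
  have sY: "simple_function M ?Y" by (intro simple_function_compose1[OF sc, of "\<lambda>c. \<bar>expectation X - c\<bar>"])
  have iY: "integrable M ?Y" by (rule integrable_simple[OF sY])
  have iY2: "integrable M (\<lambda>w. (?Y w)\<^sup>2)" by (intro integrable_simple simple_function_compose1[OF sY, of "\<lambda>y. y\<^sup>2"])
  have "expectation X * (\<integral>w. u (V w) \<partial>M) - (\<integral>w. X w * u (V w) \<partial>M)
     = (\<integral>w. (expectation X - ?c w) * u (V w) \<partial>M)"
    unfolding cexp_disc_integral[OF V X, of u, symmetric] left_diff_distrib
    by (subst Bochner_Integration.integral_diff)
       (auto intro!: integrable_simple simple_function_mult sc su)
  also have "\<bar>\<dots>\<bar> \<le> (\<integral>w. \<bar>(expectation X - ?c w) * u (V w)\<bar> \<partial>M)"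
    by (rule integral_abs_bound)
  also have "\<dots> \<le> (\<integral>w. B * ?Y w \<partial>M)"
  proof (rule integral_mono)
    show "integrable M (\<lambda>w. \<bar>(expectation X - ?c w) * u (V w)\<bar>)"
      by (intro integrable_simple simple_function_compose2[OF sc su, of "\<lambda>c u. \<bar>(expectation X - c) * u\<bar>"])
    show "integrable M (\<lambda>w. B * ?Y w)" using iY by simp
    show "\<bar>(expectation X - ?c w) * u (V w)\<bar> \<le> B * ?Y w" for w
      unfolding abs_mult mult.commute[of B] by (intro mult_left_mono u abs_ge_zero)
  qed
  also have "\<dots> = B * expectation ?Y" by simp
  also have "\<dots> \<le> B * sqrt (varM M ?c)"
  proof (rule mult_left_mono[OF real_le_rsqrt B])
    \<comment> \<open>Nonnegativity of the variance of the absolute deviation supplies the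
      Cauchy-Schwarz inequality needed here.\<close>
    have "0 \<le> variance ?Y" by (rule variance_positive)
    hence "(expectation ?Y)\<^sup>2 \<le> expectation (\<lambda>w. (?Y w)\<^sup>2)" using variance_eq[OF iY iY2] by simp
    also have "\<dots> = varM M ?c" unfolding varM_def Ec
      by (intro Bochner_Integration.integral_cong refl) (simp add: power2_commute)
    finally show "(expectation ?Y)\<^sup>2 \<le> varM M ?c" .
  qed
  finally show ?thesis .
qed

end

text \<open>The conditional law is multiplied through by P(I_a = 1), so nothing is divided by zero
  when p_a = 0. Equality on single configurations suffices because there are finitely many.\<close>

locale size_bias_coupling = prob_space M for M :: "'a measure" +
  fixes Gam :: "'i set" and I :: "'i \<Rightarrow> 'a \<Rightarrow> real" and J :: "'i \<Rightarrow> 'i \<Rightarrow> 'a \<Rightarrow> real"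
    and p :: "'i \<Rightarrow> real"
  assumes fin: "finite Gam"
    and I_rv: "\<And>a. a \<in> Gam \<Longrightarrow> I a \<in> borel_measurable M"
    and I_01: "\<And>a w. a \<in> Gam \<Longrightarrow> w \<in> space M \<Longrightarrow> I a w \<in> {0, 1}"
    and J_rv: "\<And>a b. a \<in> Gam \<Longrightarrow> b \<in> Gam \<Longrightarrow> J b a \<in> borel_measurable M"
    and J_01: "\<And>a b w. a \<in> Gam \<Longrightarrow> b \<in> Gam \<Longrightarrow> w \<in> space M \<Longrightarrow> J b a w \<in> {0, 1}"
    and coupling: "\<And>a x. a \<in> Gam \<Longrightarrow>
        measure M {w\<in>space M. I a w = 1 \<and> (\<forall>b\<in>Gam. J b a w = x b)}
        = measure M {w\<in>space M. I a w = 1} * measure M {w\<in>space M. \<forall>b\<in>Gam. I b w = x b}"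
    and p_def: "\<And>a. a \<in> Gam \<Longrightarrow> p a = (\<integral>w. I a w \<partial>M)"
begin

definition RI :: "'a \<Rightarrow> 'i \<Rightarrow> real" where
  "RI w = restrict (\<lambda>b. I b w) Gam"

definition RJ :: "'i \<Rightarrow> 'a \<Rightarrow> 'i \<Rightarrow> real" where
  "RJ a w = restrict (\<lambda>b. J b a w) Gam"

lemma RI_simple: "simple_function M RI"
  unfolding RI_def[abs_def] by (rule simple_function_restrict[OF fin I_rv I_01])

lemma RJ_simple: "a \<in> Gam \<Longrightarrow> simple_function M (RJ a)"
  unfolding RJ_def[abs_def] by (rule simple_function_restrict[OF fin J_rv J_01])

lemma I_simple: "a \<in> Gam \<Longrightarrow> simple_function M (I a)"
  using simple_function_compose1[OF RI_simple, of "\<lambda>v. v a"] by (simp add: RI_def)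

lemma J_simple: "a \<in> Gam \<Longrightarrow> b \<in> Gam \<Longrightarrow> simple_function M (J b a)"
  using simple_function_compose1[OF RJ_simple, of a "\<lambda>v. v b"] by (simp add: RJ_def)

lemma p_measure: "a \<in> Gam \<Longrightarrow> p a = measure M {w\<in>space M. I a w = 1}"
proof -
  assume a: "a \<in> Gam"
  have m: "{w\<in>space M. I a w = 1} \<in> sets M" using I_rv[OF a] by measurable
  have "p a = (\<integral>w. indicator {w\<in>space M. I a w = 1} w \<partial>M)"
    unfolding p_def[OF a] by (rule Bochner_Integration.integral_cong) (use I_01[OF a] in \<open>auto simp: indicator_def\<close>)
  thus ?thesis using m by simp
qed

text \<open>Both sides are expanded over the finitely many 0-1 configurations on Gam, where the
  coupling hypothesis matches the coefficients one by one.\<close>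

lemma coupling_expectation:
  fixes \<phi> :: "('i \<Rightarrow> real) \<Rightarrow> real"
  assumes a: "a \<in> Gam"
  shows "(\<integral>w. I a w * \<phi> (RJ a w) \<partial>M) = p a * (\<integral>w. \<phi> (RI w) \<partial>M)"
proof -
  define V where "V = PiE Gam (\<lambda>_. {0, 1::real})"
  have finV: "finite V" unfolding V_def by (intro finite_PiE fin) simp
  define AJ where "AJ = (\<lambda>v. {w\<in>space M. I a w = 1 \<and> (\<forall>b\<in>Gam. J b a w = v b)})"
  define AI where "AI = (\<lambda>v. {w\<in>space M. \<forall>b\<in>Gam. I b w = v b})"
  have eqI: "RI w = v \<longleftrightarrow> (\<forall>b\<in>Gam. I b w = v b)" if "v \<in> V" for v w
    using that by (auto simp: RI_def V_def PiE_def extensional_def fun_eq_iff restrict_def)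
  have eqJ: "RJ a w = v \<longleftrightarrow> (\<forall>b\<in>Gam. J b a w = v b)" if "v \<in> V" for v w
    using that by (auto simp: RJ_def V_def PiE_def extensional_def fun_eq_iff restrict_def)
  have inI: "RI w \<in> V" and inJ: "RJ a w \<in> V" if "w \<in> space M" for w
    using I_01 J_01[OF a] that by (auto simp: V_def RI_def RJ_def)
  have mI: "AI v \<in> sets M" for v
    unfolding AI_def by (rule sets_all_eq[OF fin I_rv])
  have mJ: "AJ v \<in> sets M" for v
  proof -
    have "{w\<in>space M. I a w = 1} \<in> sets M" using I_rv[OF a] by measurable
    moreover have "{w\<in>space M. \<forall>b\<in>Gam. J b a w = v b} \<in> sets M"
      by (rule sets_all_eq[OF fin J_rv[OF a]])
    moreover have "AJ v = {w\<in>space M. I a w = 1} \<inter> {w\<in>space M. \<forall>b\<in>Gam. J b a w = v b}"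
      by (auto simp: AJ_def)
    ultimately show ?thesis by simp
  qed
  have "(\<integral>w. I a w * \<phi> (RJ a w) \<partial>M) = (\<integral>w. (\<Sum>v\<in>V. \<phi> v * indicator (AJ v) w) \<partial>M)"
  proof (rule Bochner_Integration.integral_cong[OF refl])
    fix w assume w: "w \<in> space M"
    have "(\<Sum>v\<in>V. \<phi> v * indicator (AJ v) w) = (\<Sum>v\<in>V. if v = RJ a w then I a w * \<phi> v else 0)"
    proof (rule sum.cong[OF refl])
      fix v assume v: "v \<in> V"
      have "w \<in> AJ v \<longleftrightarrow> I a w = 1 \<and> v = RJ a w" using w eqJ[OF v, of w] by (auto simp: AJ_def)
      thus "\<phi> v * indicator (AJ v) w = (if v = RJ a w then I a w * \<phi> v else 0)"
        using I_01[OF a w] by (auto simp: indicator_def)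
    qed
    also have "\<dots> = I a w * \<phi> (RJ a w)" using inJ[OF w] finV by (simp add: sum.delta)
    finally show "I a w * \<phi> (RJ a w) = (\<Sum>v\<in>V. \<phi> v * indicator (AJ v) w)" by simp
  qed
  also have "\<dots> = (\<Sum>v\<in>V. \<phi> v * measure M (AJ v))" by (rule integral_sum_indicator[OF mJ])
  also have "\<dots> = (\<Sum>v\<in>V. \<phi> v * (p a * measure M (AI v)))"
    unfolding AJ_def AI_def coupling[OF a] p_measure[OF a] ..
  also have "\<dots> = p a * (\<Sum>v\<in>V. \<phi> v * measure M (AI v))" by (simp add: sum_distrib_left ac_simps)
  also have "(\<Sum>v\<in>V. \<phi> v * measure M (AI v)) = (\<integral>w. (\<Sum>v\<in>V. \<phi> v * indicator (AI v) w) \<partial>M)"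
    by (rule integral_sum_indicator[OF mI, symmetric])
  also have "\<dots> = (\<integral>w. \<phi> (RI w) \<partial>M)"
  proof (rule Bochner_Integration.integral_cong[OF refl])
    fix w assume w: "w \<in> space M"
    have "(\<Sum>v\<in>V. \<phi> v * indicator (AI v) w) = (\<Sum>v\<in>V. if v = RI w then \<phi> v else 0)"
    proof (rule sum.cong[OF refl])
      fix v assume v: "v \<in> V"
      have "w \<in> AI v \<longleftrightarrow> v = RI w" using w eqI[OF v, of w] by (auto simp: AI_def)
      thus "\<phi> v * indicator (AI v) w = (if v = RI w then \<phi> v else 0)" by (auto simp: indicator_def)
    qed
    also have "\<dots> = \<phi> (RI w)" using inI[OF w] finV by (simp add: sum.delta)
    finally show "(\<Sum>v\<in>V. \<phi> v * indicator (AI v) w) = \<phi> (RI w)" .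
  qed
  finally show ?thesis .
qed

end

section \<open>Expansion of the two parts of the Stein operator\<close>

text \<open>A sum of 0-1 values is a natural number, so rounding it to \<open>nat\<close> loses
  nothing and the counts can be handled as reals.\<close>

lemma real_nat_floor_sum_01:
  assumes "\<And>i. i \<in> A \<Longrightarrow> v i \<in> {0, 1::real}"
  shows "real (nat \<lfloor>\<Sum>i\<in>A. v i\<rfloor>) = (\<Sum>i\<in>A. v i)"
proof -
  have "(\<Sum>i\<in>A. v i) = (\<Sum>i\<in>A. real (if v i = 1 then 1 else 0))"
    using assms by (intro sum.cong) auto
  hence "(\<Sum>i\<in>A. v i) = real (\<Sum>i\<in>A. if v i = 1 then 1 else 0)" by simp
  thus ?thesis by (simp only: floor_of_nat nat_int)
qed

locale normal_poisson_coupling = size_bias_coupling M Gam I J p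
  for M :: "'a measure" and Gam :: "'i set" and I J p +
  fixes G1 :: "'d::finite \<Rightarrow> 'i set" and G2 :: "'r::finite \<Rightarrow> 'i set" and s :: "'d \<Rightarrow> real"
  assumes disj2: "disjoint_family G2"
    and Gam_eq: "Gam = (\<Union>j. G1 j) \<union> (\<Union>k. G2 k)"
    and s_pos: "\<And>j. s j > 0"
begin

text \<open>A map on configurations: the same map gives W at \<open>RI w\<close> and the coupled
  vector V_a at \<open>RJ a w\<close>, which is what the coupling identity needs.\<close>

definition w1 :: "('i \<Rightarrow> real) \<Rightarrow> real^'d" where
  "w1 v = (\<chi> j. (\<Sum>a\<in>G1 j. v a - p a) / s j)"

definition w2 :: "('i \<Rightarrow> real) \<Rightarrow> 'r \<Rightarrow> nat" where
  "w2 v k = nat \<lfloor>\<Sum>a\<in>G2 k. v a\<rfloor>"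

abbreviation "W1 w \<equiv> w1 (RI w)"
abbreviation "W2 w \<equiv> w2 (RI w)"
abbreviation "V1 a w \<equiv> w1 (RJ a w)"
abbreviation "V2 a w \<equiv> w2 (RJ a w)"

definition dif :: "'i \<Rightarrow> 'i set \<Rightarrow> 'a \<Rightarrow> real" where
  "dif a A w = (\<Sum>b\<in>A. I b w - J b a w)"

abbreviation "m2 a A \<equiv> \<integral>w. \<bar>I a w * dif a A w\<bar> \<partial>M"
abbreviation "m3 a k l \<equiv> \<integral>w. \<bar>I a w * dif a (G1 k) w * dif a (G1 l) w\<bar> \<partial>M"
abbreviation "mJ a b \<equiv> \<integral>w. I a w * \<bar>I b w - J b a w\<bar> \<partial>M"

lemma G_sub: "a \<in> G1 j \<Longrightarrow> a \<in> Gam" "a \<in> G2 k \<Longrightarrow> a \<in> Gam"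
  by (auto simp: Gam_eq)

lemma G_fin [simp]: "finite (G1 j)" "finite (G2 k)"
  using fin by (auto intro: finite_subset[OF _ fin] simp: Gam_eq)

lemma RI_apply: "a \<in> Gam \<Longrightarrow> RI w a = I a w"
  and RJ_apply: "b \<in> Gam \<Longrightarrow> RJ a w b = J b a w"
  by (simp_all add: RI_def RJ_def)

lemma W1_eq: "W1 w = (\<chi> j. (\<Sum>a\<in>G1 j. I a w - p a) / s j)"
  unfolding w1_def by (simp add: RI_apply G_sub cong: sum.cong)

lemma W2_eq: "W2 w k = nat \<lfloor>\<Sum>a\<in>G2 k. I a w\<rfloor>"
  unfolding w2_def by (simp add: RI_apply G_sub cong: sum.cong)

lemma W1_nth: "W1 w $ j = (\<Sum>a\<in>G1 j. I a w - p a) / s j"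
  by (simp add: W1_eq)

lemma W1_V1: "W1 w $ j - V1 a w $ j = dif a (G1 j) w / s j"
proof -
  have "V1 a w $ j = (\<Sum>b\<in>G1 j. J b a w - p b) / s j"
    unfolding w1_def by (simp add: RJ_apply G_sub cong: sum.cong)
  thus ?thesis unfolding W1_nth dif_def
    by (simp add: diff_divide_distrib[symmetric] sum_subtractf)
qed

lemma W2_real: "w \<in> space M \<Longrightarrow> real (W2 w k) = (\<Sum>a\<in>G2 k. I a w)"
  unfolding W2_eq by (rule real_nat_floor_sum_01) (rule I_01[OF G_sub(2)])

lemma V2_real: "a \<in> Gam \<Longrightarrow> w \<in> space M \<Longrightarrow> real (V2 a w k) = (\<Sum>b\<in>G2 k. J b a w)"
proof -
  assume a: "a \<in> Gam" "w \<in> space M"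
  have "V2 a w k = nat \<lfloor>\<Sum>b\<in>G2 k. J b a w\<rfloor>"
    unfolding w2_def by (simp add: RJ_apply G_sub cong: sum.cong)
  thus ?thesis using real_nat_floor_sum_01[of "G2 k" "\<lambda>b. J b a w", OF J_01[OF a(1) G_sub(2) a(2)]] by simp
qed

lemma W2_V2: "a \<in> Gam \<Longrightarrow> w \<in> space M \<Longrightarrow> real (W2 w k) - real (V2 a w k) = dif a (G2 k) w"
  by (simp add: W2_real V2_real dif_def sum_subtractf)

lemma W_simple: "simple_function M (\<lambda>w. \<phi> (W1 w) (W2 w))"
  by (rule simple_function_compose1[OF RI_simple])

lemma V_simple: "a \<in> Gam \<Longrightarrow> simple_function M (\<lambda>w. \<phi> (V1 a w) (V2 a w))"
  by (rule simple_function_compose1[OF RJ_simple])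

lemma abs_simple: "simple_function M (f :: 'a \<Rightarrow> real) \<Longrightarrow> simple_function M (\<lambda>w. \<bar>f w\<bar>)"
  by (rule simple_function_compose1)

lemma dif_simple: "a \<in> Gam \<Longrightarrow> A \<subseteq> Gam \<Longrightarrow> simple_function M (dif a A)"
  unfolding dif_def[abs_def] by (intro simple_function_sum simple_function_diff I_simple J_simple) auto

lemma dif_simples: "a \<in> Gam \<Longrightarrow> simple_function M (dif a (G1 j))" "a \<in> Gam \<Longrightarrow> simple_function M (dif a (G2 k))"
  by (rule dif_simple; auto simp: Gam_eq)+

lemmas simples = simple_function_mult simple_function_diff simple_function_add simple_function_sum
  I_simple J_simple W_simple V_simple abs_simple dif_simples

lemma coupling_W:
  assumes "a \<in> Gam"
  shows "(\<integral>w. I a w * \<phi> (V1 a w) (V2 a w) \<partial>M) = p a * (\<integral>w. \<phi> (W1 w) (W2 w) \<partial>M)"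
  using coupling_expectation[OF assms, of "\<lambda>v. \<phi> (w1 v) (w2 v)"] .

text \<open>
  Since \<open>p\<^sub>a E \<phi>(W) = E I\<^sub>a \<phi>(V\<^sub>a)\<close>, centring the indicators turns the expectation into increments of
  \<open>\<phi>\<close> between W and its coupled version \<open>V\<^sub>a\<close>.
\<close>

lemma W1_expectation:
  fixes \<phi> :: "real^'d \<Rightarrow> ('r \<Rightarrow> nat) \<Rightarrow> real"
  shows "(\<integral>w. W1 w $ j * \<phi> (W1 w) (W2 w) \<partial>M)
    = (\<Sum>a\<in>G1 j. (\<integral>w. I a w * (\<phi> (W1 w) (W2 w) - \<phi> (V1 a w) (V2 a w)) \<partial>M)) / s j"
proof -
  have i: "integrable M (\<lambda>w. I a w * \<phi> (W1 w) (W2 w))" "integrable M (\<lambda>w. I a w * \<phi> (V1 a w) (V2 a w))"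
    "integrable M (\<lambda>w. \<phi> (W1 w) (W2 w))" if "a \<in> G1 j" for a
    using G_sub(1)[OF that] by (intro integrable_simple simples; simp)+
  have "(\<integral>w. W1 w $ j * \<phi> (W1 w) (W2 w) \<partial>M)
      = (\<integral>w. (\<Sum>a\<in>G1 j. I a w * \<phi> (W1 w) (W2 w) - p a * \<phi> (W1 w) (W2 w)) / s j \<partial>M)"
    unfolding W1_nth by (simp add: sum_distrib_right left_diff_distrib)
  also have "\<dots> = (\<Sum>a\<in>G1 j. (\<integral>w. I a w * \<phi> (W1 w) (W2 w) \<partial>M) - p a * (\<integral>w. \<phi> (W1 w) (W2 w) \<partial>M)) / s j"
    using i by simp
  also have "\<dots> = (\<Sum>a\<in>G1 j. (\<integral>w. I a w * (\<phi> (W1 w) (W2 w) - \<phi> (V1 a w) (V2 a w)) \<partial>M)) / s j"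
    using i by (intro arg_cong[of _ _ "\<lambda>x. x / s j"] sum.cong refl)
      (simp add: right_diff_distrib coupling_W[OF G_sub(1)])
  finally show ?thesis .
qed

section \<open>Mean and covariance of the count vectors\<close>

definition lamW :: "'r \<Rightarrow> real" where "lamW k = (\<integral>w. real (W2 w k) \<partial>M)"

lemma lamW_eq: "lamW k = (\<Sum>a\<in>G2 k. p a)"
proof -
  have "lamW k = (\<integral>w. (\<Sum>a\<in>G2 k. I a w) \<partial>M)"
    unfolding lamW_def by (rule Bochner_Integration.integral_cong) (auto simp: W2_real)
  also have "\<dots> = (\<Sum>a\<in>G2 k. p a)"
    by (subst Bochner_Integration.integral_sum)
       (auto intro!: integrable_simple I_simple G_sub(2) simp: p_def G_sub(2))
  finally show ?thesis .
qed

lemma W1_mean: "(\<integral>w. W1 w $ j \<partial>M) = 0"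
  using W1_expectation[of j "\<lambda>_ _. 1"] by simp

definition SigW :: "real^'d^'d" where "SigW = (\<chi> j k. \<integral>w. W1 w $ j * W1 w $ k \<partial>M)"

text \<open>The sum inside the conditional expectation of the first error term.\<close>

definition XX :: "'d \<Rightarrow> 'd \<Rightarrow> 'a \<Rightarrow> real" where
  "XX j k w = (\<Sum>a\<in>G1 j. I a w * dif a (G1 k) w)"

lemma XX_simple: "simple_function M (XX j k)"
  unfolding XX_def[abs_def] by (intro simples) (auto intro: G_sub)

text \<open>Apply the centring identity to the coordinate function x_k: the increment of W_1 in that
  coordinate is \<open>dif\<close> divided by s_k. Hence the second-order part of the expansion has
  exactly the right mean.\<close>

lemma XX_mean: "(\<integral>w. XX j k w \<partial>M) = s j * s k * SigW $ j $ k"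
proof -
  have i: "integrable M (\<lambda>w. I a w * dif a (G1 k) w)" if "a \<in> G1 j" for a
    using G_sub(1)[OF that] by (intro integrable_simple simples)
  have "SigW $ j $ k = (\<Sum>a\<in>G1 j. (\<integral>w. I a w * (W1 w $ k - V1 a w $ k) \<partial>M)) / s j"
    using W1_expectation[of j "\<lambda>x y. x $ k"] by (simp add: SigW_def)
  also have "\<dots> = (\<Sum>a\<in>G1 j. (\<integral>w. I a w * dif a (G1 k) w \<partial>M)) / (s j * s k)"
    unfolding W1_V1 by (simp add: sum_divide_distrib[symmetric] mult.commute)
  also have "\<dots> = (\<integral>w. XX j k w \<partial>M) / (s j * s k)"
    unfolding XX_def using i by simp
  finally show ?thesis using s_pos[of j] s_pos[of k] by simp
qed

text \<open>W_1 takes finitely many values v, so its covariance is the sum of the rank-one matrices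
  v v^T with weights P(W_1 = v), and the square roots of the weights go into the vectors.\<close>

lemma SigW_factorable: "gauss_factorable SigW"
proof -
  define P where "P = (\<lambda>v. measure M {w\<in>space M. W1 w = v})"
  have sW: "simple_function M (\<lambda>w. W1 w)" by (rule simple_function_compose1[OF RI_simple])
  have finW: "finite (W1 ` space M)" using simple_functionD(1)[OF sW] .
  have m: "{w\<in>space M. W1 w = v} \<in> sets M" for v
  proof -
    have "{w\<in>space M. W1 w = v} = (\<lambda>w. W1 w) -` {v} \<inter> space M" by auto
    thus ?thesis using simple_functionD(2)[OF sW, of "{v}"] by simp
  qed
  have "SigW $ j $ k = (\<Sum>v\<in>W1 ` space M. (sqrt (P v) *\<^sub>R v) $ j * (sqrt (P v) *\<^sub>R v) $ k)" for j k
  proof -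
    have "SigW $ j $ k = (\<integral>w. (\<Sum>v\<in>W1 ` space M. v $ j * v $ k * indicator {w\<in>space M. W1 w = v} w) \<partial>M)"
      unfolding SigW_def vec_lambda_beta
    proof (rule Bochner_Integration.integral_cong[OF refl])
      fix w assume w: "w \<in> space M"
      have "(\<Sum>v\<in>W1 ` space M. v $ j * v $ k * indicator {w\<in>space M. W1 w = v} w)
          = (\<Sum>v\<in>W1 ` space M. if v = W1 w then v $ j * v $ k else 0)"
        using w by (intro sum.cong) auto
      also have "\<dots> = W1 w $ j * W1 w $ k" using w finW by (simp add: sum.delta)
      finally show "W1 w $ j * W1 w $ k = (\<Sum>v\<in>W1 ` space M. v $ j * v $ k * indicator {w\<in>space M. W1 w = v} w)" by simp
    qed
    also have "\<dots> = (\<Sum>v\<in>W1 ` space M. v $ j * v $ k * P v)"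
      unfolding P_def by (rule integral_sum_indicator[OF m])
    also have "\<dots> = (\<Sum>v\<in>W1 ` space M. (sqrt (P v) *\<^sub>R v) $ j * (sqrt (P v) *\<^sub>R v) $ k)"
    proof (rule sum.cong[OF refl])
      fix v
      have "sqrt (P v) * sqrt (P v) = P v" by (simp add: P_def)
      thus "v $ j * v $ k * P v = (sqrt (P v) *\<^sub>R v) $ j * (sqrt (P v) *\<^sub>R v) $ k"
        by (simp only: vector_scaleR_component real_scaleR_def) (metis mult.assoc mult.commute)
    qed
    finally show ?thesis .
  qed
  hence "SigW = (\<Sum>v\<in>W1 ` space M. (\<chi> j k. (sqrt (P v) *\<^sub>R v) $ j * (sqrt (P v) *\<^sub>R v) $ k))"
    by (simp add: vec_eq_iff)
  thus ?thesis using sum_rank_one_factor[OF finW, of "\<lambda>v. sqrt (P v) *\<^sub>R v"] by simp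
qed

text \<open>Meant for g = d_j f. The step from W to V_a is made in two legs: first in x with the
  counts W_2 fixed, by second-order Taylor, then in y with V1 fixed. The linear Taylor terms
  assemble into \<open>XX\<close>.\<close>

lemma gaussian_part:
  fixes g :: "real^'d \<Rightarrow> ('r \<Rightarrow> nat) \<Rightarrow> real"
  assumes g: "smooth1 g" "\<And>k. smooth1 (pdx k g)"
    and B: "\<And>k l x y. \<bar>pdx l (pdx k g) x y\<bar> \<le> B k l" and C: "\<And>k x y. \<bar>ydiff k g x y\<bar> \<le> C k"
  shows "\<bar>(\<integral>w. W1 w $ j * g (W1 w) (W2 w) \<partial>M)
       - (\<Sum>k\<in>UNIV. (\<integral>w. XX j k w * pdx k g (W1 w) (W2 w) \<partial>M) / (s j * s k))\<bar>
    \<le> 1/2 * (\<Sum>k\<in>UNIV. \<Sum>l\<in>UNIV. B k l / (s j * s k * s l)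
         * (\<Sum>a\<in>G1 j. m3 a k l))
     + (\<Sum>k\<in>UNIV. C k / s j * (\<Sum>a\<in>G1 j. m2 a (G2 k)))"
proof -
  let ?d = "\<lambda>a w. g (W1 w) (W2 w) - g (V1 a w) (V2 a w)"
  let ?L = "\<lambda>a w. (\<Sum>k\<in>UNIV. 1 / s k * (I a w * dif a (G1 k) w * pdx k g (W1 w) (W2 w)))"
  let ?R = "\<lambda>a w. 1/2 * (\<Sum>k\<in>UNIV. \<Sum>l\<in>UNIV. B k l / (s k * s l) * \<bar>I a w * dif a (G1 k) w * dif a (G1 l) w\<bar>)
     + (\<Sum>k\<in>UNIV. C k * \<bar>I a w * dif a (G2 k) w\<bar>)"
  \<comment> \<open>Where the indicator is 0 both sides vanish; where it is 1 it can be inserted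
    into or dropped from any factor.\<close>
  have pw: "\<bar>I a w * ?d a w - ?L a w\<bar> \<le> ?R a w" if a: "a \<in> Gam" and w: "w \<in> space M" for a w
  proof (cases "I a w = 0")
    case True thus ?thesis by simp
  next
    case False
    hence 1: "I a w = 1" using I_01[OF a w] by auto
    have v1: "V1 a w $ k - W1 w $ k = - (dif a (G1 k) w / s k)" for k using W1_V1[of w k a] by simp
    have T: "\<bar>g (V1 a w) (W2 w) - g (W1 w) (W2 w) - (\<Sum>k\<in>UNIV. (V1 a w $ k - W1 w $ k) * pdx k g (W1 w) (W2 w))\<bar>
      \<le> 1/2 * (\<Sum>k\<in>UNIV. \<Sum>l\<in>UNIV. B k l * \<bar>(V1 a w $ k - W1 w $ k) * (V1 a w $ l - W1 w $ l)\<bar>)"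
      using C2x_taylor[OF smooth1_C1x[OF g(1), of "W2 w"], of B "V1 a w" "W1 w"]
        smooth1_C1x[OF g(2), of _ "W2 w"] B
      by (simp add: pdx_xpartial[symmetric] pdx_def[symmetric])
    have "(\<Sum>k\<in>UNIV. (V1 a w $ k - W1 w $ k) * pdx k g (W1 w) (W2 w)) = - ?L a w"
      unfolding v1 1 by (simp add: sum_negf)
    moreover have "\<bar>(V1 a w $ k - W1 w $ k) * (V1 a w $ l - W1 w $ l)\<bar> = \<bar>I a w * dif a (G1 k) w * dif a (G1 l) w\<bar> / (s k * s l)" for k l
      unfolding v1 1 using s_pos[of k] s_pos[of l] by (simp add: abs_mult)
    ultimately have T': "\<bar>g (V1 a w) (W2 w) - g (W1 w) (W2 w) + ?L a w\<bar>
      \<le> 1/2 * (\<Sum>k\<in>UNIV. \<Sum>l\<in>UNIV. B k l / (s k * s l) * \<bar>I a w * dif a (G1 k) w * dif a (G1 l) w\<bar>)"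
      using T by simp
    have "\<bar>g (V1 a w) (W2 w) - g (V1 a w) (V2 a w)\<bar> \<le> (\<Sum>k\<in>UNIV. C k * \<bar>real (W2 w k) - real (V2 a w k)\<bar>)"
      by (rule lattice_lipschitz) (rule C[unfolded ydiff_def])
    hence Y: "\<bar>g (V1 a w) (W2 w) - g (V1 a w) (V2 a w)\<bar> \<le> (\<Sum>k\<in>UNIV. C k * \<bar>I a w * dif a (G2 k) w\<bar>)"
      by (simp add: W2_V2[OF a w] 1)
    have "I a w * ?d a w = ?d a w" by (simp add: 1)
    thus ?thesis using T' Y by linarith
  qed
  have iL: "integrable M (\<lambda>w. I a w * dif a (G1 k) w * pdx k g (W1 w) (W2 w))"
    and iD: "integrable M (\<lambda>w. I a w * ?d a w)"
    and iR1: "integrable M (\<lambda>w. \<bar>I a w * dif a (G1 k) w * dif a (G1 l) w\<bar>)"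
    and iR2: "integrable M (\<lambda>w. \<bar>I a w * dif a (G2 m) w\<bar>)" if "a \<in> G1 j" for a k l m
    using G_sub(1)[OF that] by (intro integrable_simple simples; simp)+
  have e1: "(\<integral>w. I a w * ?d a w - ?L a w \<partial>M) = (\<integral>w. I a w * ?d a w \<partial>M)
      - (\<Sum>k\<in>UNIV. 1 / s k * (\<integral>w. I a w * dif a (G1 k) w * pdx k g (W1 w) (W2 w) \<partial>M))" if "a \<in> G1 j" for a
    using iL[OF that] iD[OF that] by simp
  have e2: "(\<integral>w. ?R a w \<partial>M) = 1/2 * (\<Sum>k\<in>UNIV. \<Sum>l\<in>UNIV. B k l / (s k * s l) * m3 a k l)
     + (\<Sum>k\<in>UNIV. C k * m2 a (G2 k))" if "a \<in> G1 j" for a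
    using iR1[OF that] iR2[OF that] by simp
  have "(\<integral>w. XX j k w * pdx k g (W1 w) (W2 w) \<partial>M)
      = (\<Sum>a\<in>G1 j. (\<integral>w. I a w * dif a (G1 k) w * pdx k g (W1 w) (W2 w) \<partial>M))" for k
    unfolding XX_def sum_distrib_right using iL by simp
  hence "(\<Sum>k\<in>UNIV. (\<integral>w. XX j k w * pdx k g (W1 w) (W2 w) \<partial>M) / (s j * s k))
     = (\<Sum>k\<in>UNIV. \<Sum>a\<in>G1 j. 1 / s k * (\<integral>w. I a w * dif a (G1 k) w * pdx k g (W1 w) (W2 w) \<partial>M)) / s j"
    by (simp add: sum_divide_distrib mult.commute)
  also have "\<dots> = (\<Sum>a\<in>G1 j. \<Sum>k\<in>UNIV. 1 / s k * (\<integral>w. I a w * dif a (G1 k) w * pdx k g (W1 w) (W2 w) \<partial>M)) / s j"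
    by (subst sum.swap) simp
  finally have F: "(\<Sum>k\<in>UNIV. (\<integral>w. XX j k w * pdx k g (W1 w) (W2 w) \<partial>M) / (s j * s k))
     = (\<Sum>a\<in>G1 j. \<Sum>k\<in>UNIV. 1 / s k * (\<integral>w. I a w * dif a (G1 k) w * pdx k g (W1 w) (W2 w) \<partial>M)) / s j" .
  have T: "(\<Sum>a\<in>G1 j. (\<integral>w. I a w * ?d a w - ?L a w \<partial>M)) = (\<Sum>a\<in>G1 j. (\<integral>w. I a w * ?d a w \<partial>M))
      - (\<Sum>a\<in>G1 j. \<Sum>k\<in>UNIV. 1 / s k * (\<integral>w. I a w * dif a (G1 k) w * pdx k g (W1 w) (W2 w) \<partial>M))"
    unfolding sum_subtractf[symmetric] by (intro sum.cong refl e1)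
  have lhs: "(\<integral>w. W1 w $ j * g (W1 w) (W2 w) \<partial>M)
       - (\<Sum>k\<in>UNIV. (\<integral>w. XX j k w * pdx k g (W1 w) (W2 w) \<partial>M) / (s j * s k))
     = (\<Sum>a\<in>G1 j. (\<integral>w. I a w * ?d a w - ?L a w \<partial>M)) / s j"
    unfolding W1_expectation F T diff_divide_distrib ..
  have "\<bar>(\<Sum>a\<in>G1 j. (\<integral>w. I a w * ?d a w - ?L a w \<partial>M)) / s j\<bar> \<le> (\<Sum>a\<in>G1 j. (\<integral>w. ?R a w \<partial>M)) / s j"
  proof -
    have "\<bar>\<integral>w. I a w * ?d a w - ?L a w \<partial>M\<bar> \<le> (\<integral>w. ?R a w \<partial>M)" if a: "a \<in> G1 j" for a
    proof (rule order_trans[OF integral_abs_bound integral_mono])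
      show "integrable M (\<lambda>w. \<bar>I a w * ?d a w - ?L a w\<bar>)"
        using iL[OF a] iD[OF a] by simp
      show "integrable M (?R a)" using iR1[OF a] iR2[OF a] by simp
    qed (rule pw[OF G_sub(1)[OF a]])
    hence "\<bar>\<Sum>a\<in>G1 j. (\<integral>w. I a w * ?d a w - ?L a w \<partial>M)\<bar> \<le> (\<Sum>a\<in>G1 j. (\<integral>w. ?R a w \<partial>M))"
      by (intro order_trans[OF sum_abs sum_mono])
    thus ?thesis using s_pos[of j] by (simp add: divide_right_mono)
  qed
  also have "\<dots> = 1/2 * (\<Sum>k\<in>UNIV. \<Sum>l\<in>UNIV. B k l / (s j * s k * s l)
         * (\<Sum>a\<in>G1 j. m3 a k l))
     + (\<Sum>k\<in>UNIV. C k / s j * (\<Sum>a\<in>G1 j. m2 a (G2 k)))"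
  proof -
    have a: "(\<Sum>a\<in>G1 j. \<Sum>k\<in>UNIV. \<Sum>l\<in>UNIV. B k l / (s k * s l) * E a k l)
        = (\<Sum>k\<in>UNIV. \<Sum>l\<in>UNIV. B k l / (s k * s l) * (\<Sum>a\<in>G1 j. E a k l))" for E :: "'i \<Rightarrow> 'd \<Rightarrow> 'd \<Rightarrow> real"
      unfolding sum_distrib_left by (subst sum.swap, intro sum.cong refl, rule sum.swap)
    have b: "(\<Sum>a\<in>G1 j. \<Sum>k\<in>UNIV. C k * E a k) = (\<Sum>k\<in>UNIV. C k * (\<Sum>a\<in>G1 j. E a k))" for E :: "'i \<Rightarrow> 'r \<Rightarrow> real"
      unfolding sum_distrib_left by (rule sum.swap)
    have "(\<Sum>a\<in>G1 j. (\<integral>w. ?R a w \<partial>M)) = 1/2 * (\<Sum>k\<in>UNIV. \<Sum>l\<in>UNIV. B k l / (s k * s l) * (\<Sum>a\<in>G1 j. m3 a k l))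
       + (\<Sum>k\<in>UNIV. C k * (\<Sum>a\<in>G1 j. m2 a (G2 k)))"
    proof -
      have "(\<Sum>a\<in>G1 j. (\<integral>w. ?R a w \<partial>M)) = (\<Sum>a\<in>G1 j. 1/2 * (\<Sum>k\<in>UNIV. \<Sum>l\<in>UNIV. B k l / (s k * s l) * m3 a k l)
         + (\<Sum>k\<in>UNIV. C k * m2 a (G2 k)))"
        by (intro sum.cong refl e2)
      thus ?thesis by (simp only: sum.distrib sum_distrib_left[of "1/2", symmetric] a b)
    qed
    moreover have "b / (x * y) * e / z = b / (z * x * y) * e" for b x y e z :: real
      by (simp add: mult.commute mult.left_commute)
    moreover have "c * e / z = c / z * e" for c e z :: real by simp
    moreover have "1 / 2 * x / z = 1 / 2 * (x / z)" for x z :: real by simp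
    ultimately show ?thesis
      by (simp only: add_divide_distrib sum_divide_distrib)
  qed
  finally show ?thesis unfolding lhs .
qed

text \<open>Meant for q = Delta_k f. The birth term is the coupling identity summed over
  \<open>G2 k\<close>; the death term is split over the individuals that make up W_2k. This pairs
  V_a with the configuration from which a has been removed.\<close>

lemma poisson_part:
  fixes q :: "real^'d \<Rightarrow> ('r \<Rightarrow> nat) \<Rightarrow> real"
  assumes q: "smooth1 q"
    and B: "\<And>j x y. \<bar>pdx j q x y\<bar> \<le> B j" and C: "\<And>l x y. \<bar>ydiff l q x y\<bar> \<le> C"
  shows "\<bar>lamW k * (\<integral>w. q (W1 w) (W2 w) \<partial>M) - (\<integral>w. real (W2 w k) * q (W1 w) (dwn1 k (W2 w)) \<partial>M)\<bar>
    \<le> (\<Sum>j\<in>UNIV. B j / s j * (\<Sum>a\<in>G2 k. m2 a (G1 j)))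
     + C * (\<Sum>a\<in>G2 k. (p a)\<^sup>2 + (\<Sum>b\<in>(\<Union>l. G2 l) - {a}. mJ a b))"
proof -
  define U where "U = (\<Union>l. G2 l)"
  let ?d = "\<lambda>a w. q (V1 a w) (V2 a w) - q (W1 w) (dwn1 k (W2 w))"
  let ?R = "\<lambda>a w. (\<Sum>j\<in>UNIV. B j / s j * \<bar>I a w * dif a (G1 j) w\<bar>)
     + C * (I a w * J a a w + (\<Sum>b\<in>U - {a}. I a w * \<bar>I b w - J b a w\<bar>))"
  have C0: "0 \<le> C" using C[of undefined undefined undefined] by linarith
  have pw: "\<bar>I a w * ?d a w\<bar> \<le> ?R a w" if ak: "a \<in> G2 k" and w: "w \<in> space M" for a w
  proof (cases "I a w = 0")
    case True thus ?thesis by simp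
  next
    case False
    note a = G_sub(2)[OF ak]
    have 1: "I a w = 1" using I_01[OF a w] False by auto
    have "\<bar>q (V1 a w) (V2 a w) - q (W1 w) (V2 a w)\<bar> \<le> (\<Sum>j\<in>UNIV. B j * \<bar>V1 a w $ j - W1 w $ j\<bar>)"
      by (rule C1x_lipschitz[OF smooth1_C1x[OF q]]) (use B in \<open>simp add: pdx_def\<close>)
    also have "\<dots> = (\<Sum>j\<in>UNIV. B j / s j * \<bar>I a w * dif a (G1 j) w\<bar>)"
    proof (rule sum.cong[OF refl])
      fix j
      have "\<bar>V1 a w $ j - W1 w $ j\<bar> = \<bar>dif a (G1 j) w\<bar> / s j"
        unfolding abs_minus_commute[of "V1 a w $ j"] W1_V1 using s_pos[of j] by simp
      thus "B j * \<bar>V1 a w $ j - W1 w $ j\<bar> = B j / s j * \<bar>I a w * dif a (G1 j) w\<bar>" by (simp add: 1)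
    qed
    finally have X: "\<bar>q (V1 a w) (V2 a w) - q (W1 w) (V2 a w)\<bar> \<le> (\<Sum>j\<in>UNIV. B j / s j * \<bar>I a w * dif a (G1 j) w\<bar>)" .
    have Jn: "0 \<le> J a a w" using J_01[OF a a w] by auto
    \<comment> \<open>In the coordinate of a, the coupled count contains \<open>J a a\<close> while
      a has been removed from the other count; this discrepancy is listed separately from the sum
      over b.\<close>
    have dl: "\<bar>real (V2 a w l) - real (dwn1 k (W2 w) l)\<bar> \<le> (\<Sum>b\<in>G2 l - {a}. \<bar>I b w - J b a w\<bar>) + (if l = k then J a a w else 0)" for l
    proof -
      have sub: "\<bar>(\<Sum>b\<in>G2 l - {a}. J b a w) - (\<Sum>b\<in>G2 l - {a}. I b w)\<bar> \<le> (\<Sum>b\<in>G2 l - {a}. \<bar>I b w - J b a w\<bar>)"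
        unfolding sum_subtractf[symmetric] by (rule order_trans[OF sum_abs]) (simp add: abs_minus_commute)
      show ?thesis
      proof (cases "l = k")
        case True
        have wk: "real (W2 w k) = 1 + (\<Sum>b\<in>G2 k - {a}. I b w)"
          unfolding W2_real[OF w] by (subst sum.remove[OF _ ak]) (auto simp: 1)
        have "0 \<le> (\<Sum>b\<in>G2 k - {a}. I b w)"
          using I_01[OF G_sub(2) w] by (intro sum_nonneg) force
        \<comment> \<open>The individual a itself is counted, so the truncated subtraction in
          \<open>dwn1\<close> is a genuine one.\<close>
        hence "W2 w k \<ge> 1" using wk by linarith
        hence "real (dwn1 k (W2 w) k) = (\<Sum>b\<in>G2 k - {a}. I b w)" using wk by (simp add: dwn1_def of_nat_diff)
        moreover have "real (V2 a w k) = J a a w + (\<Sum>b\<in>G2 k - {a}. J b a w)"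
          unfolding V2_real[OF a w] by (subst sum.remove[OF _ ak]) auto
        ultimately show ?thesis using sub Jn True by auto
      next
        case False
        have "a \<notin> G2 l" using disj2 ak False unfolding disjoint_family_on_def by blast
        hence "G2 l - {a} = G2 l" by blast
        thus ?thesis using sub False by (simp add: W2_real[OF w] V2_real[OF a w] dwn1_def)
      qed
    qed
    have "\<bar>q (W1 w) (V2 a w) - q (W1 w) (dwn1 k (W2 w))\<bar> \<le> (\<Sum>l\<in>UNIV. C * \<bar>real (V2 a w l) - real (dwn1 k (W2 w) l)\<bar>)"
      by (rule lattice_lipschitz) (rule C[unfolded ydiff_def])
    also have "\<dots> \<le> (\<Sum>l\<in>UNIV. C * ((\<Sum>b\<in>G2 l - {a}. \<bar>I b w - J b a w\<bar>) + (if l = k then J a a w else 0)))"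
      by (intro sum_mono mult_left_mono dl C0)
    also have "\<dots> = C * ((\<Sum>l\<in>UNIV. \<Sum>b\<in>G2 l - {a}. \<bar>I b w - J b a w\<bar>) + J a a w)"
      by (simp add: sum_distrib_left[symmetric] sum.distrib)
    also have "C * ((\<Sum>l\<in>UNIV. \<Sum>b\<in>G2 l - {a}. \<bar>I b w - J b a w\<bar>) + J a a w) = C * ((\<Sum>b\<in>U - {a}. \<bar>I b w - J b a w\<bar>) + J a a w)"
    proof -
      have "U - {a} = (\<Union>l. G2 l - {a})" unfolding U_def by blast
      moreover have "(\<Sum>b\<in>(\<Union>l. G2 l - {a}). \<bar>I b w - J b a w\<bar>) = (\<Sum>l\<in>UNIV. \<Sum>b\<in>G2 l - {a}. \<bar>I b w - J b a w\<bar>)"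
        by (rule sum.UNION_disjoint) (use disj2 in \<open>auto simp: disjoint_family_on_def\<close>)
      ultimately show ?thesis by simp
    qed
    finally have Y: "\<bar>q (W1 w) (V2 a w) - q (W1 w) (dwn1 k (W2 w))\<bar> \<le> C * (I a w * J a a w + (\<Sum>b\<in>U - {a}. I a w * \<bar>I b w - J b a w\<bar>))"
      by (simp add: 1 add.commute)
    have "I a w * ?d a w = ?d a w" by (simp add: 1)
    thus ?thesis using X Y by linarith
  qed
  have Uf: "finite U" by (simp add: U_def)
  have Us: "b \<in> Gam" if "b \<in> U - {a}" for a b using that G_sub(2) unfolding U_def by blast
  have iV: "integrable M (\<lambda>w. I a w * q (V1 a w) (V2 a w))"
    and iW: "integrable M (\<lambda>w. I a w * q (W1 w) (dwn1 k (W2 w)))"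
    and iR1: "integrable M (\<lambda>w. \<bar>I a w * dif a (G1 j) w\<bar>)"
    and iR2: "integrable M (\<lambda>w. I a w * J a a w)" if "a \<in> G2 k" for a j
    using G_sub(2)[OF that] W_simple[of "\<lambda>x y. q x (dwn1 k y)"]
    by (intro integrable_simple simples; simp)+
  have iR3: "integrable M (\<lambda>w. I a w * \<bar>I b w - J b a w\<bar>)" if "a \<in> G2 k" "b \<in> U - {a}" for a b
    using G_sub(2)[OF that(1)] Us[OF that(2)] by (intro integrable_simple simples; simp)
  have iI: "I a w * ?d a w = I a w * q (V1 a w) (V2 a w) - I a w * q (W1 w) (dwn1 k (W2 w))" for a w
    by (simp add: right_diff_distrib)
  have "lamW k * (\<integral>w. q (W1 w) (W2 w) \<partial>M) = (\<Sum>a\<in>G2 k. (\<integral>w. I a w * q (V1 a w) (V2 a w) \<partial>M))"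
    unfolding lamW_eq sum_distrib_right by (intro sum.cong refl) (simp add: coupling_W[OF G_sub(2)])
  moreover have "(\<integral>w. real (W2 w k) * q (W1 w) (dwn1 k (W2 w)) \<partial>M) = (\<Sum>a\<in>G2 k. (\<integral>w. I a w * q (W1 w) (dwn1 k (W2 w)) \<partial>M))"
  proof -
    have "(\<integral>w. real (W2 w k) * q (W1 w) (dwn1 k (W2 w)) \<partial>M) = (\<integral>w. (\<Sum>a\<in>G2 k. I a w * q (W1 w) (dwn1 k (W2 w))) \<partial>M)"
      by (rule Bochner_Integration.integral_cong) (auto simp: W2_real sum_distrib_right)
    thus ?thesis using iW by simp
  qed
  ultimately have lhs: "lamW k * (\<integral>w. q (W1 w) (W2 w) \<partial>M) - (\<integral>w. real (W2 w k) * q (W1 w) (dwn1 k (W2 w)) \<partial>M)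
     = (\<Sum>a\<in>G2 k. (\<integral>w. I a w * ?d a w \<partial>M))"
    unfolding iI using iV iW by (simp add: sum_subtractf)
  have "\<bar>\<Sum>a\<in>G2 k. (\<integral>w. I a w * ?d a w \<partial>M)\<bar> \<le> (\<Sum>a\<in>G2 k. (\<integral>w. ?R a w \<partial>M))"
  proof (rule order_trans[OF sum_abs sum_mono])
    fix a assume a: "a \<in> G2 k"
    show "\<bar>\<integral>w. I a w * ?d a w \<partial>M\<bar> \<le> (\<integral>w. ?R a w \<partial>M)"
    proof (rule order_trans[OF integral_abs_bound integral_mono])
      show "integrable M (\<lambda>w. \<bar>I a w * ?d a w\<bar>)"
        unfolding iI using iV[OF a] iW[OF a] by simp
      show "integrable M (?R a)" by (intro Bochner_Integration.integrable_add Bochner_Integration.integrable_sum integrable_mult_right iR1 iR2 iR3 a)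
    qed (rule pw[OF a])
  qed
  also have "\<dots> = (\<Sum>a\<in>G2 k. (\<Sum>j\<in>UNIV. B j / s j * m2 a (G1 j))
     + C * ((p a)\<^sup>2 + (\<Sum>b\<in>U - {a}. mJ a b)))"
  proof (rule sum.cong[OF refl])
    fix a assume a: "a \<in> G2 k"
    \<comment> \<open>Given I_a = 1, the variable \<open>J a a\<close> has the unconditional law of
      I_a; this is the source of the squared p_a.\<close>
    have pp: "(\<integral>w. I a w * J a a w \<partial>M) = (p a)\<^sup>2"
      using coupling_expectation[OF G_sub(2)[OF a], of "\<lambda>v. v a"] G_sub(2)[OF a]
      by (simp add: RI_apply RJ_apply p_def power2_eq_square)
    have i1: "integrable M (\<lambda>w. \<Sum>j\<in>UNIV. B j / s j * \<bar>I a w * dif a (G1 j) w\<bar>)"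
      by (intro Bochner_Integration.integrable_sum integrable_mult_right iR1 a)
    have i3: "integrable M (\<lambda>w. \<Sum>b\<in>U - {a}. I a w * \<bar>I b w - J b a w\<bar>)"
      by (intro Bochner_Integration.integrable_sum iR3 a)
    have "(\<integral>w. ?R a w \<partial>M) = (\<integral>w. (\<Sum>j\<in>UNIV. B j / s j * \<bar>I a w * dif a (G1 j) w\<bar>) \<partial>M)
        + (\<integral>w. C * (I a w * J a a w + (\<Sum>b\<in>U - {a}. I a w * \<bar>I b w - J b a w\<bar>)) \<partial>M)"
      by (rule Bochner_Integration.integral_add[OF i1 integrable_mult_right[OF Bochner_Integration.integrable_add[OF iR2[OF a] i3]]])
    moreover have "(\<integral>w. I a w * J a a w + (\<Sum>b\<in>U - {a}. I a w * \<bar>I b w - J b a w\<bar>) \<partial>M)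
        = (p a)\<^sup>2 + (\<Sum>b\<in>U - {a}. mJ a b)"
      unfolding Bochner_Integration.integral_add[OF iR2[OF a] i3] pp
      by (simp only: Bochner_Integration.integral_sum[OF iR3[OF a]])
    moreover have "(\<integral>w. (\<Sum>j\<in>UNIV. B j / s j * \<bar>I a w * dif a (G1 j) w\<bar>) \<partial>M) = (\<Sum>j\<in>UNIV. B j / s j * m2 a (G1 j))"
      using iR1[OF a] by simp
    ultimately show "(\<integral>w. ?R a w \<partial>M) = (\<Sum>j\<in>UNIV. B j / s j * m2 a (G1 j))
     + C * ((p a)\<^sup>2 + (\<Sum>b\<in>U - {a}. mJ a b))"
      by (simp only: integral_mult_right_zero)
  qed
  also have "\<dots> = (\<Sum>j\<in>UNIV. B j / s j * (\<Sum>a\<in>G2 k. m2 a (G1 j)))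
     + C * (\<Sum>a\<in>G2 k. (p a)\<^sup>2 + (\<Sum>b\<in>U - {a}. mJ a b))"
  proof -
    have b: "(\<Sum>a\<in>G2 k. \<Sum>j\<in>UNIV. B j / s j * E a j) = (\<Sum>j\<in>UNIV. B j / s j * (\<Sum>a\<in>G2 k. E a j))" for E :: "'i \<Rightarrow> 'd \<Rightarrow> real"
      unfolding sum_distrib_left by (rule sum.swap)
    show ?thesis unfolding sum.distrib[of "\<lambda>a. \<Sum>j\<in>UNIV. _ a j"] b sum_distrib_left[of C] ..
  qed
  finally show ?thesis unfolding lhs U_def .
qed

end

section \<open>The bound\<close>

context normal_poisson_coupling
begin

lemma normal_poisson_bound:
  fixes h :: "real^'d \<Rightarrow> ('r \<Rightarrow> nat) \<Rightarrow> real"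
  assumes lam: "\<forall>k. 0 < lamW k" and h: "h \<in> H3"
  defines "f \<equiv> fsol SigW lamW h"
  shows "\<bar>(\<integral>w. h (W1 w) (W2 w) \<partial>M) - EhZN SigW lamW h\<bar> \<le>
      (\<Sum>j\<in>UNIV. \<Sum>k\<in>UNIV. supnorm (pdx j (pdx k f)) / (s j * s k)
         * sqrt (varM M (cexp_disc M (\<lambda>w. (W1 w, W2 w)) (XX j k))))
    + 1 / 2 * (\<Sum>j\<in>UNIV. \<Sum>k\<in>UNIV. \<Sum>l\<in>UNIV.
         supnorm (pdx j (pdx k (pdx l f))) / (s j * s k * s l)
         * (\<Sum>a\<in>G1 j. m3 a k l))
    + (\<Sum>j\<in>UNIV. \<Sum>k\<in>UNIV. supnorm (ydiff k (pdx j f)) / s j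
         * (\<Sum>a\<in>G1 j. m2 a (G2 k)))
    + 2 * (\<Sum>k\<in>UNIV. \<Sum>j\<in>UNIV. supnorm (ydiff k (pdx j f)) / s j
         * (\<Sum>a\<in>G2 k. m2 a (G1 j)))
    + 2 * Max ((\<lambda>(j, k). supnorm (ydiff j (ydiff k f))) ` UNIV)
        * ((\<Sum>a\<in>(\<Union>k. G2 k). (p a)\<^sup>2)
           + (\<Sum>a\<in>(\<Union>k. G2 k). \<Sum>b\<in>(\<Union>k. G2 k) - {a}. mJ a b))"
proof -
  note R = fsol_regular[OF SigW_factorable lam h, folded f_def]
  define C where "C = Max ((\<lambda>(j, k). supnorm (ydiff j (ydiff k f))) ` UNIV)"
  have C: "\<bar>ydiff j (ydiff k f) x y\<bar> \<le> C" for j k x y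
  proof -
    have "supnorm (ydiff j (ydiff k f)) \<le> C" unfolding C_def
      by (rule Max_ge) (auto intro!: image_eqI[of _ _ "(j, k)"])
    thus ?thesis using supnorm_bound[OF R(6), of j k x y] by linarith
  qed
  let ?E = "\<lambda>\<phi>. \<integral>w. \<phi> (W1 w) (W2 w) \<partial>M"
  let ?Y = "\<lambda>k. lamW k * ?E (ydiff k f) - (\<integral>w. real (W2 w k) * ydiff k f (W1 w) (dwn1 k (W2 w)) \<partial>M)"
  let ?X = "\<lambda>j k. (\<integral>w. XX j k w * pdx k (pdx j f) (W1 w) (W2 w) \<partial>M)"
  let ?T1 = "\<lambda>j k. supnorm (pdx j (pdx k f)) / (s j * s k) * sqrt (varM M (cexp_disc M (\<lambda>w. (W1 w, W2 w)) (XX j k)))"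
  let ?T2 = "\<lambda>j. 1/2 * (\<Sum>k\<in>UNIV. \<Sum>l\<in>UNIV. supnorm (pdx j (pdx k (pdx l f))) / (s j * s k * s l)
         * (\<Sum>a\<in>G1 j. m3 a k l))
     + (\<Sum>k\<in>UNIV. supnorm (ydiff k (pdx j f)) / s j * (\<Sum>a\<in>G1 j. m2 a (G2 k)))"
  let ?T3 = "\<lambda>k. (\<Sum>j\<in>UNIV. supnorm (ydiff k (pdx j f)) / s j * (\<Sum>a\<in>G2 k. m2 a (G1 j)))
     + C * (\<Sum>a\<in>G2 k. (p a)\<^sup>2 + (\<Sum>b\<in>(\<Union>l. G2 l) - {a}. mJ a b))"
  have stein: "?E h - EhZN SigW lamW h = (\<Sum>j\<in>UNIV. \<Sum>k\<in>UNIV. SigW $ j $ k * ?E (pdx k (pdx j f)))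
     - (\<Sum>j\<in>UNIV. \<integral>w. W1 w $ j * pdx j f (W1 w) (W2 w) \<partial>M) + 2 * (\<Sum>k\<in>UNIV. ?Y k)"
  proof -
    have i: "integrable M (\<lambda>w. \<phi> (W1 w) (W2 w))" for \<phi> :: "real^'d \<Rightarrow> ('r \<Rightarrow> nat) \<Rightarrow> real"
      by (intro integrable_simple W_simple)
    note i' = i[of "\<lambda>x y. x $ j * pdx j f x y" for j] i[of "\<lambda>x y. real (y k) * ydiff k f x (dwn1 k y)" for k]
    have "?E h - EhZN SigW lamW h = (\<integral>w. h (W1 w) (W2 w) - EhZN SigW lamW h \<partial>M)"
      using i[of h] by (simp add: prob_space)
    also have "\<dots> = (\<integral>w. (\<Sum>j\<in>UNIV. \<Sum>k\<in>UNIV. SigW $ j $ k * pdx k (pdx j f) (W1 w) (W2 w))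
       - (\<Sum>j\<in>UNIV. W1 w $ j * pdx j f (W1 w) (W2 w))
       + 2 * (\<Sum>k\<in>UNIV. lamW k * ydiff k f (W1 w) (W2 w) - real (W2 w k) * ydiff k f (W1 w) (dwn1 k (W2 w))) \<partial>M)"
      unfolding stein_equation[OF SigW_factorable lam H3_smooth(1)[OF h], folded f_def, symmetric] ..
    also have "\<dots> = (\<Sum>j\<in>UNIV. \<Sum>k\<in>UNIV. SigW $ j $ k * ?E (pdx k (pdx j f)))
     - (\<Sum>j\<in>UNIV. \<integral>w. W1 w $ j * pdx j f (W1 w) (W2 w) \<partial>M) + 2 * (\<Sum>k\<in>UNIV. ?Y k)"
      using i i' by simp
    finally show ?thesis .
  qed
  \<comment> \<open>Since s_j s_k Sigma_jk is the mean of \<open>XX j k\<close>, the difference is a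
    covariance up to sign and scaling, and the conditional variance bound applies.\<close>
  have A1: "\<bar>SigW $ j $ k * ?E (pdx k (pdx j f)) - ?X j k / (s j * s k)\<bar> \<le> ?T1 j k" for j k
  proof -
    have sp: "s j * s k > 0" using s_pos by simp
    have sV: "simple_function M (\<lambda>w. (W1 w, W2 w))" by (rule simple_function_compose1[OF RI_simple])
    have "\<bar>expectation (XX j k) * (\<integral>w. (\<lambda>v. pdx k (pdx j f) (fst v) (snd v)) (W1 w, W2 w) \<partial>M)
        - (\<integral>w. XX j k w * (\<lambda>v. pdx k (pdx j f) (fst v) (snd v)) (W1 w, W2 w) \<partial>M)\<bar>
      \<le> supnorm (pdx j (pdx k f)) * sqrt (varM M (cexp_disc M (\<lambda>w. (W1 w, W2 w)) (XX j k)))"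
    proof (rule cexp_disc_var_bound[OF sV XX_simple])
      fix v :: "(real^'d) \<times> ('r \<Rightarrow> nat)"
      have "CB (pdx k (pdx j f))" using R(1) by (simp add: smooth1_def)
      from supnorm_bound[OF this, of "fst v" "snd v"]
      show "\<bar>pdx k (pdx j f) (fst v) (snd v)\<bar> \<le> supnorm (pdx j (pdx k f))" unfolding R(8)[of j k] .
    qed
    hence "\<bar>s j * s k * SigW $ j $ k * ?E (pdx k (pdx j f)) - ?X j k\<bar>
      \<le> supnorm (pdx j (pdx k f)) * sqrt (varM M (cexp_disc M (\<lambda>w. (W1 w, W2 w)) (XX j k)))"
      by (simp add: XX_mean)
    from divide_right_mono[OF this less_imp_le[OF sp]]
    have "\<bar>s j * s k * SigW $ j $ k * ?E (pdx k (pdx j f)) - ?X j k\<bar> / (s j * s k) \<le> ?T1 j k" by simp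
    moreover have "\<bar>s j * s k * SigW $ j $ k * ?E (pdx k (pdx j f)) - ?X j k\<bar> / (s j * s k)
       = \<bar>(s j * s k * SigW $ j $ k * ?E (pdx k (pdx j f)) - ?X j k) / (s j * s k)\<bar>"
      using sp by (simp only: abs_divide abs_of_pos)
    moreover have "(s j * s k * SigW $ j $ k * ?E (pdx k (pdx j f)) - ?X j k) / (s j * s k)
       = SigW $ j $ k * ?E (pdx k (pdx j f)) - ?X j k / (s j * s k)"
      using s_pos[of j] s_pos[of k] by (simp add: diff_divide_distrib)
    ultimately show ?thesis by simp
  qed
  have A2: "\<bar>(\<integral>w. W1 w $ j * pdx j f (W1 w) (W2 w) \<partial>M) - (\<Sum>k\<in>UNIV. ?X j k / (s j * s k))\<bar> \<le> ?T2 j" for j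
  proof (rule gaussian_part[OF R(1,2)])
    show "\<bar>pdx l (pdx k (pdx j f)) x y\<bar> \<le> supnorm (pdx j (pdx k (pdx l f)))" for k l x y
      using supnorm_bound[OF R(3), of l k j x y] unfolding R(9)[of l k j] .
    show "\<bar>ydiff k (pdx j f) x y\<bar> \<le> supnorm (ydiff k (pdx j f))" for k x y
      by (rule supnorm_bound[OF R(5)])
  qed
  have A3: "\<bar>?Y k\<bar> \<le> ?T3 k" for k
  proof (rule poisson_part[OF R(4)])
    show "\<bar>pdx j (ydiff k f) x y\<bar> \<le> supnorm (ydiff k (pdx j f))" for j x y
      unfolding R(7) by (rule supnorm_bound[OF R(5)])
  qed (rule C)
  \<comment> \<open>The terms \<open>?X j k / (s j * s k)\<close> are added and subtracted: they
    link the second-order term of the Stein operator to the linear Taylor part of its drift.\<close>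
  have lhs: "?E h - EhZN SigW lamW h = (\<Sum>j\<in>UNIV. \<Sum>k\<in>UNIV. SigW $ j $ k * ?E (pdx k (pdx j f)) - ?X j k / (s j * s k))
     - (\<Sum>j\<in>UNIV. (\<integral>w. W1 w $ j * pdx j f (W1 w) (W2 w) \<partial>M) - (\<Sum>k\<in>UNIV. ?X j k / (s j * s k))) + 2 * (\<Sum>k\<in>UNIV. ?Y k)"
    unfolding stein by (simp add: sum_subtractf)
  have bound: "\<bar>?E h - EhZN SigW lamW h\<bar> \<le> (\<Sum>j\<in>UNIV. \<Sum>k\<in>UNIV. ?T1 j k) + (\<Sum>j\<in>UNIV. ?T2 j) + 2 * (\<Sum>k\<in>UNIV. ?T3 k)"
  proof -
    have "\<bar>\<Sum>j\<in>UNIV. \<Sum>k\<in>UNIV. SigW $ j $ k * ?E (pdx k (pdx j f)) - ?X j k / (s j * s k)\<bar> \<le> (\<Sum>j\<in>UNIV. \<Sum>k\<in>UNIV. ?T1 j k)"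
      by (rule order_trans[OF sum_abs], rule sum_mono, rule order_trans[OF sum_abs], rule sum_mono, rule A1)
    moreover have "\<bar>\<Sum>j\<in>UNIV. (\<integral>w. W1 w $ j * pdx j f (W1 w) (W2 w) \<partial>M) - (\<Sum>k\<in>UNIV. ?X j k / (s j * s k))\<bar> \<le> (\<Sum>j\<in>UNIV. ?T2 j)"
      by (rule order_trans[OF sum_abs], rule sum_mono, rule A2)
    moreover have "\<bar>\<Sum>k\<in>UNIV. ?Y k\<bar> \<le> (\<Sum>k\<in>UNIV. ?T3 k)"
      by (rule order_trans[OF sum_abs], rule sum_mono, rule A3)
    ultimately show ?thesis unfolding lhs by linarith
  qed
  have T3: "(\<Sum>k\<in>UNIV. ?T3 k) = (\<Sum>k\<in>UNIV. \<Sum>j\<in>UNIV. supnorm (ydiff k (pdx j f)) / s j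
         * (\<Sum>a\<in>G2 k. m2 a (G1 j)))
     + C * ((\<Sum>a\<in>(\<Union>k. G2 k). (p a)\<^sup>2) + (\<Sum>a\<in>(\<Union>k. G2 k). \<Sum>b\<in>(\<Union>k. G2 k) - {a}. mJ a b))"
  proof -
    have u: "(\<Sum>k\<in>UNIV. \<Sum>a\<in>G2 k. e a) = (\<Sum>a\<in>(\<Union>k. G2 k). e a)" for e :: "'i \<Rightarrow> real"
      by (rule sum.UNION_disjoint[symmetric]) (use disj2 in \<open>auto simp: disjoint_family_on_def\<close>)
    show ?thesis unfolding sum.distrib sum_distrib_left[of C, symmetric] u ..
  qed
  have T2: "(\<Sum>j\<in>UNIV. ?T2 j) = 1 / 2 * (\<Sum>j\<in>UNIV. \<Sum>k\<in>UNIV. \<Sum>l\<in>UNIV.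
         supnorm (pdx j (pdx k (pdx l f))) / (s j * s k * s l)
         * (\<Sum>a\<in>G1 j. m3 a k l))
    + (\<Sum>j\<in>UNIV. \<Sum>k\<in>UNIV. supnorm (ydiff k (pdx j f)) / s j
         * (\<Sum>a\<in>G1 j. m2 a (G2 k)))"
    by (simp only: sum.distrib sum_distrib_left[of "1/2", symmetric])
  have combine: "e \<le> t1 + (t2 + t3) + 2 * (t4 + c * t5) \<Longrightarrow> e \<le> t1 + t2 + t3 + 2 * t4 + 2 * c * t5"
    for e t1 t2 t3 t4 t5 c :: real
    by (simp add: algebra_simps)
  show ?thesis
    unfolding C_def[symmetric] by (rule combine) (use bound in \<open>simp only: T2 T3\<close>)
qed

end

theorem theorem3p1:
  fixes M :: "'a measure" and Gam :: "'i set"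
    and I :: "'i \<Rightarrow> 'a \<Rightarrow> real" and J :: "'i \<Rightarrow> 'i \<Rightarrow> 'a \<Rightarrow> real"
    and G1 :: "'d::finite \<Rightarrow> 'i set" and G2 :: "'r::finite \<Rightarrow> 'i set"
    and s :: "'d \<Rightarrow> real" and p :: "'i \<Rightarrow> real"
    and W1 :: "'a \<Rightarrow> real^'d" and W2 :: "'a \<Rightarrow> 'r \<Rightarrow> nat"
    and Sig :: "real^'d^'d" and lam :: "'r \<Rightarrow> real"
    and h :: "real^'d \<Rightarrow> ('r \<Rightarrow> nat) \<Rightarrow> real"
    and f :: "real^'d \<Rightarrow> ('r \<Rightarrow> nat) \<Rightarrow> real"
  assumes M: "prob_space M"
    and fin: "finite Gam"
    and I_rv: "\<And>\<alpha>. \<alpha> \<in> Gam \<Longrightarrow> I \<alpha> \<in> borel_measurable M"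
    and I_01: "\<And>\<alpha> \<omega>. \<alpha> \<in> Gam \<Longrightarrow> \<omega> \<in> space M \<Longrightarrow> I \<alpha> \<omega> \<in> {0, 1}"
    and J_rv: "\<And>\<alpha> \<beta>. \<alpha> \<in> Gam \<Longrightarrow> \<beta> \<in> Gam \<Longrightarrow> J \<beta> \<alpha> \<in> borel_measurable M"
    and J_01: "\<And>\<alpha> \<beta> \<omega>. \<alpha> \<in> Gam \<Longrightarrow> \<beta> \<in> Gam \<Longrightarrow> \<omega> \<in> space M \<Longrightarrow> J \<beta> \<alpha> \<omega> \<in> {0, 1}"
    and coupling: "\<And>\<alpha> x. \<alpha> \<in> Gam \<Longrightarrow>
        measure M {\<omega>\<in>space M. I \<alpha> \<omega> = 1 \<and> (\<forall>\<beta>\<in>Gam. J \<beta> \<alpha> \<omega> = x \<beta>)}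
        = measure M {\<omega>\<in>space M. I \<alpha> \<omega> = 1} * measure M {\<omega>\<in>space M. \<forall>\<beta>\<in>Gam. I \<beta> \<omega> = x \<beta>}"
    and disj1: "disjoint_family G1" and disj2: "disjoint_family G2"
    and disj12: "(\<Union>j. G1 j) \<inter> (\<Union>k. G2 k) = {}"
    and Gam_eq: "Gam = (\<Union>j. G1 j) \<union> (\<Union>k. G2 k)"
    and p_def: "\<And>\<alpha>. \<alpha> \<in> Gam \<Longrightarrow> p \<alpha> = (\<integral>\<omega>. I \<alpha> \<omega> \<partial>M)"
    and s_pos: "\<And>j. s j > 0"
    and W1_def: "W1 = (\<lambda>\<omega>. \<chi> j. (\<Sum>\<alpha>\<in>G1 j. I \<alpha> \<omega> - p \<alpha>) / s j)"
    and W2_def: "W2 = (\<lambda>\<omega> k. nat \<lfloor>\<Sum>\<alpha>\<in>G2 k. I \<alpha> \<omega>\<rfloor>)"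
    and Sig_def: "Sig = (\<chi> j k. \<integral>\<omega>. (W1 \<omega> $ j - (\<integral>\<omega>'. W1 \<omega>' $ j \<partial>M))
                                    * (W1 \<omega> $ k - (\<integral>\<omega>'. W1 \<omega>' $ k \<partial>M)) \<partial>M)"
    and lam_def: "lam = (\<lambda>k. \<integral>\<omega>. real (W2 \<omega> k) \<partial>M)"
    and lam_pos: "\<And>k. lam k > 0"
    and h: "h \<in> H3"
    and f_def: "f = fsol Sig lam h"
  shows "\<bar>(\<integral>\<omega>. h (W1 \<omega>) (W2 \<omega>) \<partial>M) - EhZN Sig lam h\<bar> \<le>
      (\<Sum>j\<in>UNIV. \<Sum>k\<in>UNIV. supnorm (pdx j (pdx k f)) / (s j * s k)
         * sqrt (varM M (cexp_disc M (\<lambda>\<omega>. (W1 \<omega>, W2 \<omega>))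
              (\<lambda>\<omega>. \<Sum>\<alpha>\<in>G1 j. I \<alpha> \<omega> * (\<Sum>\<beta>\<in>G1 k. I \<beta> \<omega> - J \<beta> \<alpha> \<omega>)))))
    + 1 / 2 * (\<Sum>j\<in>UNIV. \<Sum>k\<in>UNIV. \<Sum>l\<in>UNIV.
         supnorm (pdx j (pdx k (pdx l f))) / (s j * s k * s l)
         * (\<Sum>\<alpha>\<in>G1 j. \<integral>\<omega>. \<bar>I \<alpha> \<omega> * (\<Sum>\<beta>\<in>G1 k. I \<beta> \<omega> - J \<beta> \<alpha> \<omega>)
                                 * (\<Sum>\<gamma>\<in>G1 l. I \<gamma> \<omega> - J \<gamma> \<alpha> \<omega>)\<bar> \<partial>M))
    + (\<Sum>j\<in>UNIV. \<Sum>k\<in>UNIV. supnorm (ydiff k (pdx j f)) / s j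
         * (\<Sum>\<alpha>\<in>G1 j. \<integral>\<omega>. \<bar>I \<alpha> \<omega> * (\<Sum>\<beta>\<in>G2 k. I \<beta> \<omega> - J \<beta> \<alpha> \<omega>)\<bar> \<partial>M))
    + 2 * (\<Sum>k\<in>UNIV. \<Sum>j\<in>UNIV. supnorm (ydiff k (pdx j f)) / s j
         * (\<Sum>\<alpha>\<in>G2 k. \<integral>\<omega>. \<bar>I \<alpha> \<omega> * (\<Sum>\<beta>\<in>G1 j. I \<beta> \<omega> - J \<beta> \<alpha> \<omega>)\<bar> \<partial>M))
    + 2 * Max ((\<lambda>(j, k). supnorm (ydiff j (ydiff k f))) ` UNIV)
        * ((\<Sum>\<alpha>\<in>(\<Union>k. G2 k). (p \<alpha>)\<^sup>2)
           + (\<Sum>\<alpha>\<in>(\<Union>k. G2 k). \<Sum>\<beta>\<in>(\<Union>k. G2 k) - {\<alpha>}.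
                \<integral>\<omega>. I \<alpha> \<omega> * \<bar>I \<beta> \<omega> - J \<beta> \<alpha> \<omega>\<bar> \<partial>M))"
proof -
  interpret prob_space M by (rule M)
  interpret C: normal_poisson_coupling M Gam I J p G1 G2 s
    by unfold_locales (fact assms)+
  have W1: "W1 = C.W1" unfolding W1_def by (rule ext) (simp only: C.W1_eq)
  have W2: "W2 = C.W2" unfolding W2_def by (intro ext) (simp only: C.W2_eq)
  \<comment> \<open>W_1 has mean zero, so the centred covariance is the plain second-moment
    matrix.\<close>
  have Sig: "Sig = C.SigW"
    unfolding Sig_def C.SigW_def W1 by (simp only: C.W1_mean diff_0_right)
  have lam: "lam = C.lamW" unfolding lam_def W2 by (rule ext) (simp only: C.lamW_def)
  have "\<forall>k. 0 < C.lamW k" using lam_pos unfolding lam by blast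
  from C.normal_poisson_bound[OF this h]
  show ?thesis
    unfolding f_def Sig lam W1 W2 C.XX_def[abs_def] C.dif_def .
qed

end
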